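(* Let $n\ge2$, $s\in(0,1)$, $p\in(1,\infty)$ and $w\in A_p$. There is a constant $C$ depending only on $n$, $p$ and $[w]_{A_p}$ such that for every ball $B\subset\mathbb{R}^n$ of radius $r$ and every $v\in W^{s,p}_w(B)$, $$\Big(\frac1{w(B)}\int_B|v-\langle v\rangle_B|^{\frac{np}{n-s}}w\,dx\Big)^{\frac{n-s}{n}}\le C\,s^{1-2p}(1-s)\frac{r^{sp}}{w(B)}\int_B\int_B\frac{|v(x)-v(y)|^p}{|x-y|^{sp}}\frac{w(x)w(y)}{w(B_{x,y})}\,dx\,dy,$$ where $\langle v\rangle_B=\frac1{|B|}\int_B v\,dx$. Moreover, the mean value $\langle v\rangle_B$ on the left-hand side can be replaced by $\langle v\rangle_\psi:=\int_B v\,\psi\,dx$, where either $\psi=\frac{w}{w(B)}$, or $\psi\in L^\infty(B)$ satisfies $\int_B\psi\,dx=1$ and $\|\psi\|_{L^\infty(B)}\le\frac{c_0}{|B|}$ (in the latter case $C$ depends also on $c_0$).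
   Context: A weight is a function $w\in L^1_{\mathrm{loc}}(\mathbb{R}^n)$ with $w>0$ a.e.; $w(U)=\int_U w\,dx$. For $1<p<\infty$, $w\in A_p$ means $$[w]_{A_p}:=\sup_{B}\Big(\frac1{|B|}\int_B w\,dx\Big)\Big(\frac1{|B|}\int_B w^{\frac1{1-p}}dx\Big)^{p-1}<\infty,$$ the supremum being over all balls in $\mathbb{R}^n$. For $x,y\in\mathbb{R}^n$ let $B_{x,y}$ be the ball with center $\frac{x+y}2$ and radius $\frac12|x-y|$. For open bounded $\Omega\subset\mathbb{R}^n$, $$W^{s,p}_w(\Omega)=\Big\{v\in L^p(\Omega):\int_\Omega\int_\Omega\frac{|v(x)-v(y)|^p}{|x-y|^{sp}}\frac{w(x)w(y)}{w(B_{x,y})}\,dx\,dy<\infty\Big\}.$$ *)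

theory Defs
  imports "HOL-Analysis.Analysis" "HOL-Probability.Essential_Supremum"
begin

(* Only used for exponents a > 0. *)
definition ennpowr :: "ennreal \<Rightarrow> real \<Rightarrow> ennreal" where
  "ennpowr z a = (if z = \<infinity> then \<infinity> else ennreal (enn2real z powr a))"

definition is_weight :: "('a::euclidean_space \<Rightarrow> real) \<Rightarrow> bool" where
  "is_weight w \<longleftrightarrow>
     (\<forall>K. compact K \<longrightarrow> integrable (lebesgue_on K) w) \<and> (AE x in lebesgue. w x > 0)"

definition wmeas :: "('a::euclidean_space \<Rightarrow> real) \<Rightarrow> 'a set \<Rightarrow> real" where
  "wmeas w U = (LINT x|lebesgue_on U. w x)"

(* Extended-real valued: the average of w powr (1 / (1 - p)) may be infinite. *)
definition Ap_const :: "real \<Rightarrow> ('a::euclidean_space \<Rightarrow> real) \<Rightarrow> ennreal" where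
  "Ap_const p w = (SUP (z, r) \<in> UNIV \<times> {0<..}.
     ((\<integral>\<^sup>+x. ennreal (w x) \<partial>lebesgue_on (ball z r)) / emeasure lebesgue (ball z r)) *
     ennpowr ((\<integral>\<^sup>+x. ennreal (w x powr (1 / (1 - p))) \<partial>lebesgue_on (ball z r))
        / emeasure lebesgue (ball z r)) (p - 1))"

definition Ap_class :: "real \<Rightarrow> ('a::euclidean_space \<Rightarrow> real) set" where
  "Ap_class p = {w. is_weight w \<and> Ap_const p w < \<infinity>}"

definition Bxy :: "'a::euclidean_space \<Rightarrow> 'a \<Rightarrow> 'a set" where
  "Bxy x y = ball (midpoint x y) (dist x y / 2)"

(* The kernel is 0 on the diagonal (division by 0 is 0); the diagonal is a null set. *)
definition energy ::
  "real \<Rightarrow> real \<Rightarrow> ('a::euclidean_space \<Rightarrow> real) \<Rightarrow> 'a set \<Rightarrow> ('a \<Rightarrow> real) \<Rightarrow> ennreal" where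
  "energy s p w \<Omega> v =
     (\<integral>\<^sup>+y. (\<integral>\<^sup>+x. ennreal (\<bar>v x - v y\<bar> powr p / norm (x - y) powr (s * p)
        * (w x * w y / wmeas w (Bxy x y))) \<partial>lebesgue_on \<Omega>) \<partial>lebesgue_on \<Omega>)"

(* Functions are total; only their values on \<Omega> matter. *)
definition Lp :: "real \<Rightarrow> 'a::euclidean_space set \<Rightarrow> ('a \<Rightarrow> real) set" where
  "Lp p \<Omega> = {v. v \<in> borel_measurable (lebesgue_on \<Omega>) \<and>
                 integrable (lebesgue_on \<Omega>) (\<lambda>x. \<bar>v x\<bar> powr p)}"

definition Linf_norm :: "'a::euclidean_space set \<Rightarrow> ('a \<Rightarrow> real) \<Rightarrow> ennreal" where
  "Linf_norm \<Omega> \<psi> = esssup (lebesgue_on \<Omega>) (\<lambda>x. ennreal \<bar>\<psi> x\<bar>)"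

definition Linf :: "'a::euclidean_space set \<Rightarrow> ('a \<Rightarrow> real) set" where
  "Linf \<Omega> = {\<psi>. \<psi> \<in> borel_measurable (lebesgue_on \<Omega>) \<and> Linf_norm \<Omega> \<psi> < \<infinity>}"

definition Wsp ::
  "real \<Rightarrow> real \<Rightarrow> ('a::euclidean_space \<Rightarrow> real) \<Rightarrow> 'a set \<Rightarrow> ('a \<Rightarrow> real) set" where
  "Wsp s p w \<Omega> = {v \<in> Lp p \<Omega>. energy s p w \<Omega> v < \<infinity>}"

definition mean :: "('a::euclidean_space \<Rightarrow> real) \<Rightarrow> 'a set \<Rightarrow> real" where
  "mean v B = (LINT x|lebesgue_on B. v x) / measure lebesgue B"

definition psi_mean ::
  "('a::euclidean_space \<Rightarrow> real) \<Rightarrow> 'a set \<Rightarrow> ('a \<Rightarrow> real) \<Rightarrow> real" where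
  "psi_mean \<psi> B v = (LINT x|lebesgue_on B. v x * \<psi> x)"

(* Valued in ennreal, so that an upper bound by a finite number includes finiteness
   of the integral. *)
definition osc_lhs ::
  "real \<Rightarrow> real \<Rightarrow> ('a::euclidean_space \<Rightarrow> real) \<Rightarrow> 'a set \<Rightarrow> ('a \<Rightarrow> real) \<Rightarrow> real \<Rightarrow> ennreal" where
  "osc_lhs s p w B v m =
     (let n = real DIM('a) in
      ennpowr ((\<integral>\<^sup>+x. ennreal (\<bar>v x - m\<bar> powr (n * p / (n - s)) * w x) \<partial>lebesgue_on B)
         / ennreal (wmeas w B)) ((n - s) / n))"

(* The right-hand side, without the constant C, on a ball B of radius r. *)
definition energy_rhs ::
  "real \<Rightarrow> real \<Rightarrow> ('a::euclidean_space \<Rightarrow> real) \<Rightarrow> 'a set \<Rightarrow> real \<Rightarrow> ('a \<Rightarrow> real) \<Rightarrow> ennreal" where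
  "energy_rhs s p w B r v =
     ennreal (s powr (1 - 2 * p) * (1 - s) * (r powr (s * p) / wmeas w B)) * energy s p w B v"

end

theory Submission
  imports Defs
begin

text \<open>
  Write n for the dimension, A for the A_p constant, \<mu> = w dx, q = np/(n - s), \<kappa> = q/p
  = n/(n - s), and osc(B) for the average of |v x - v y| over x, y in B with respect to Lebesgue
  measure. The function v is only evaluated on balls contained in the given ball B, so convexity
  and homotheties of balls are all the geometry that enters, and every constant is explicit in n,
  p and A.

  The A_p condition enters through one inequality, Ap_mean: the Lebesgue average of f \<ge> 0 over
  a ball is at most A^(1/p) times its p-th power mean with respect to \<mu>. For an indicator
  function it says that \<mu> B / \<mu> B' \<le> A (r/r')^(np) for balls B' contained in B
  (W_growth); np is the growth exponent that makes q the right integrability exponent.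

  The factor 1 - s comes from a Poincare inequality osc(B)^p \<le> C (1 - s) r^(sp) E(B) / \<mu>
  B, where E is the energy (fractional_poincare). Cut the segment from x to y into N equal pieces
  and apply the triangle inequality; for each piece the substitution of the endpoints of the piece
  for x and y costs N^n, so osc(B) is at most a constant times N times an average of |v x - v y|
  over pairs at distance less than 2r/N (oscillation_chain). Two uses of Ap_mean turn this into
  osc(B)^p \<le> C N^p E_N / \<mu> B, where E_N is the part of the unnormalised energy carried by
  such pairs. Multiply by N^(-p(1-s)) and sum over N = 2^j: the left side becomes osc(B)^p times a
  geometric series of size about 1/(p(1 - s)), while on the right the geometric sum over the
  scales that see a given pair x, y reproduces |x - y|^(-sp). That last sum costs a factor 1/s,
  which is harmless for s \<ge> 1/2; for smaller s the single choice N = 1 suffices.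

  For x in B let B_k be the image of B under the homothety with centre x and ratio 2^(-k). These
  balls are nested, lie in B and contain x, and the averages of v over B_k tend to v x for almost
  every x, because the energy density at x is finite almost everywhere (avg_shrink_tendsto).
  Telescoping bounds |v x - avg B| by the sum of osc(B_k), to which the Poincare inequality
  applies. For large balls one uses E(B_k) \<le> E(B) with the growth bound, for small ones E(B_k)
  \<le> \<lambda> \<mu>(B_k); optimising in the manner of Hedberg gives |v x - avg B|^q \<le>
  const * \<lambda> as soon as \<lambda> bounds the maximal function sup_k E(B_k) / \<mu>(B_k)
  (pointwise_bound). Since E is superadditive on disjoint balls and \<mu> is doubling, the Vitali
  covering lemma bounds the set where this fails by const * E(B) / \<lambda> (maximal_weak_type),
  and a weak type (q) inequality follows (weak_type). The series over k costs 1/s, hence s^(-p) in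
  total, which is at most s^(1-2p).

  The strong inequality is obtained from the weak one by truncation, after Maz'ya (strong_type):
  the weak inequality is applied to the layers of |v - avg B| between consecutive powers of two,
  whose energies add up to at most E(B), and \<kappa> \<ge> 1 allows the powers to be summed.
  Another mean m is then admissible once |m - avg B| is controlled, which the Poincare inequality
  or the strong inequality itself provides.

  All this is done for Borel functions and a weight that is positive everywhere; changing v and w
  on null sets leaves the statement unchanged.
\<close>

section \<open>Muckenhoupt weights\<close>

text \<open>
  Hoelder's inequality for the factorisation f = (f g^(1/p)) g^(-1/p), with bounds in place of the
  two integrals. The conjugate factor has p'-th power g^(1/(1-p)), the dual weight of A_p theory.
\<close>

lemma nn_integral_Hoelder_weight:
  fixes f g :: "'b \<Rightarrow> real"
  assumes [measurable]: "f \<in> borel_measurable M" "g \<in> borel_measurable M"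
    and f0: "\<And>x. 0 \<le> f x" and g0: "\<And>x. 0 \<le> g x"
    and fg: "\<And>x. x \<in> space M \<Longrightarrow> f x = 0 \<or> 0 < g x"
    and p: "1 < p" and a: "0 \<le> a" and b: "0 \<le> b"
    and A: "(\<integral>\<^sup>+x. ennreal (f x powr p * g x) \<partial>M) \<le> ennreal a"
    and B: "(\<integral>\<^sup>+x. ennreal (g x powr (1 / (1 - p))) \<partial>M) \<le> ennreal b"
  shows "(\<integral>\<^sup>+x. ennreal (f x) \<partial>M) \<le> ennreal (a powr (1 / p) * b powr (1 - 1 / p))"
proof (cases "a = 0 \<or> b = 0")
  case True
  have "AE x in M. f x = 0"
  proof (cases "a = 0")
    case True
    then have "(\<integral>\<^sup>+x. ennreal (f x powr p * g x) \<partial>M) = 0" using A by simp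
    then have "AE x in M. ennreal (f x powr p * g x) = 0"
      by (subst (asm) nn_integral_0_iff_AE) auto
    then show ?thesis
      using AE_space by eventually_elim (use fg g0 f0 in \<open>force simp: ennreal_eq_0_iff mult_le_0_iff\<close>)
  next
    case False
    with True have "b = 0" by simp
    then have "(\<integral>\<^sup>+x. ennreal (g x powr (1 / (1 - p))) \<partial>M) = 0" using B by simp
    then have "AE x in M. ennreal (g x powr (1 / (1 - p))) = 0"
      by (subst (asm) nn_integral_0_iff_AE) auto
    then show ?thesis
      using AE_space by eventually_elim (use fg in force)
  qed
  then have "(\<integral>\<^sup>+x. ennreal (f x) \<partial>M) = 0"
    by (subst nn_integral_0_iff_AE) auto
  then show ?thesis by simp
next
  case False
  then have a: "a > 0" and b: "b > 0" using a b by auto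
  define c where "c = a powr (1 / p) * b powr (1 - 1 / p)"
  have c: "c > 0" using a b by (simp add: c_def)
  have key: "f x \<le> c * (f x powr p * g x / (p * a) + (1 - 1 / p) * g x powr (1 / (1 - p)) / b)"
    if x: "x \<in> space M" for x
  proof (cases "f x = 0")
    case True
    then show ?thesis using c p b by (simp add: divide_simps)
  next
    case False
    with fg[OF x] f0[of x] have f: "f x > 0" and g: "g x > 0" by auto
    \<comment> \<open>Young's inequality for factors normalised by the bounds a and b, so that the integrated right-hand side is 1.\<close>
    define s where "s = f x * g x powr (1 / p) / a powr (1 / p)"
    define t where "t = g x powr (- (1 / p)) / b powr (1 - 1 / p)"
    have q: "(1 - 1 / p) * (1 / (1 - 1/p)) = 1" "1 - 1 / p > 0" using p by (auto simp: field_simps)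
    have "s * t \<le> s powr p / p + t powr (1 / (1 - 1 / p)) / (1 / (1 - 1 / p))"
      by (rule Youngs_inequality) (use p f g a b in \<open>auto simp: s_def t_def field_simps\<close>)
    moreover have "s powr p = f x powr p * g x / a"
      using f g a p by (simp add: s_def powr_divide powr_mult powr_powr)
    moreover have "t powr (1 / (1 - 1 / p)) = g x powr (1 / (1 - p)) / b"
    proof -
      have "- (1 / p) * (1 / (1 - 1 / p)) = 1 / (1 - p)" using p by (simp add: divide_simps)
      then show ?thesis
        using f g b p q by (simp add: t_def powr_divide powr_mult powr_powr)
    qed
    moreover have "s * t = f x / c"
      using f g a b by (simp add: s_def t_def c_def powr_minus field_simps)
    ultimately have "f x / c \<le> f x powr p * g x / (p * a) + (1 - 1 / p) * g x powr (1 / (1 - p)) / b"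
      by (simp add: mult.commute)
    then show ?thesis using c by (simp add: field_simps)
  qed
  have "(\<integral>\<^sup>+x. ennreal (f x) \<partial>M)
      \<le> (\<integral>\<^sup>+x. ennreal (c / (p * a)) * ennreal (f x powr p * g x)
             + ennreal (c * (1 - 1 / p) / b) * ennreal (g x powr (1 / (1 - p))) \<partial>M)"
  proof (rule nn_integral_mono)
    fix x assume x: "x \<in> space M"
    have "ennreal (f x) \<le> ennreal (c * (f x powr p * g x / (p * a) + (1 - 1 / p) * g x powr (1 / (1 - p)) / b))"
      by (intro ennreal_leI key x)
    also have "\<dots> = ennreal (c / (p * a) * (f x powr p * g x) + c * (1 - 1 / p) / b * g x powr (1 / (1 - p)))"
      by (simp add: algebra_simps add_divide_distrib diff_divide_distrib)
    also have "\<dots> = ennreal (c / (p * a)) * ennreal (f x powr p * g x)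
             + ennreal (c * (1 - 1 / p) / b) * ennreal (g x powr (1 / (1 - p)))"
      using a b c p g0[of x] by (simp add: ennreal_mult[symmetric] ennreal_plus[symmetric] del: ennreal_plus)
    finally show "ennreal (f x) \<le> \<dots>" .
  qed
  also have "\<dots> = ennreal (c / (p * a)) * (\<integral>\<^sup>+x. ennreal (f x powr p * g x) \<partial>M)
             + ennreal (c * (1 - 1 / p) / b) * (\<integral>\<^sup>+x. ennreal (g x powr (1 / (1 - p))) \<partial>M)"
    by (simp add: nn_integral_add nn_integral_cmult)
  also have "\<dots> \<le> ennreal (c / (p * a)) * ennreal a + ennreal (c * (1 - 1 / p) / b) * ennreal b"
    by (intro add_mono mult_left_mono A B) auto
  also have "\<dots> = ennreal (c / (p * a) * a + c * (1 - 1 / p) / b * b)"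
    using a b c p by (simp add: ennreal_mult[symmetric] ennreal_plus[symmetric] del: ennreal_plus)
  also have "c / (p * a) * a + c * (1 - 1 / p) / b * b = c"
    using a b p by (simp add: field_simps)
  finally show ?thesis by (simp add: c_def)
qed

lemma measure_ball_pos: "0 < r \<Longrightarrow> 0 < measure lborel (ball z r)" for z :: "'a::euclidean_space"
  by simp

lemma emeasure_ball_lborel: "emeasure lborel (ball z r) = ennreal (measure lborel (ball z r))"
  for z :: "'a::euclidean_space"
  by (rule emeasure_eq_ennreal_measure) (use emeasure_lborel_ball_finite[of z r] in auto)

lemma measure_ball_scale:
  fixes z z' :: "'a::euclidean_space"
  assumes "0 \<le> c" "0 \<le> r"
  shows "measure lborel (ball z (c * r)) = c ^ DIM('a) * measure lborel (ball z' r)"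
  using assms by (simp add: content_ball power_mult_distrib)

text \<open>
  The setting for the analytic part: a Borel representative of the weight, positive at every
  point, and the A_p condition with the dual integral replaced by a finite upper bound b, so that
  all later estimates take place among real numbers.
\<close>

locale muckenhoupt_weight =
  fixes w :: "'a::euclidean_space \<Rightarrow> real" and p A :: real
  assumes w_borel [measurable]: "w \<in> borel_measurable borel"
    and w_pos: "\<And>x. 0 < w x"
    and p_gt_1: "1 < p"
    and w_finite: "\<And>z r. 0 < r \<Longrightarrow> emeasure (density lborel (\<lambda>x. ennreal (w x))) (ball z r) < \<infinity>"
    and Ap_bound: "\<And>z r. 0 < r \<Longrightarrow> \<exists>b\<ge>0.
      (\<integral>\<^sup>+x\<in>ball z r. ennreal (w x powr (1 / (1 - p))) \<partial>lborel) \<le> ennreal b \<and>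
      measure (density lborel (\<lambda>x. ennreal (w x))) (ball z r) * b powr (p - 1)
        \<le> A * measure lborel (ball z r) powr p"
begin

definition \<mu> :: "'a measure" where "\<mu> = density lborel (\<lambda>x. ennreal (w x))"

definition W :: "'a \<Rightarrow> real \<Rightarrow> real" where "W z r = measure \<mu> (ball z r)"

lemma sets_mu [simp, measurable_cong]: "sets \<mu> = sets borel"
  by (simp add: \<mu>_def)

lemma space_mu [simp]: "space \<mu> = UNIV"
  by (simp add: \<mu>_def)

lemma nn_integral_mu:
  "f \<in> borel_measurable borel \<Longrightarrow> (\<integral>\<^sup>+x. f x \<partial>\<mu>) = (\<integral>\<^sup>+x. ennreal (w x) * f x \<partial>lborel)"
  unfolding \<mu>_def by (rule nn_integral_density) auto

lemma AE_mu: "(AE x in \<mu>. P x) \<longleftrightarrow> (AE x in lborel. P x)"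
  unfolding \<mu>_def by (subst AE_density) (auto simp: w_pos)

lemma sigma_finite_mu: "sigma_finite_measure \<mu>"
  unfolding \<mu>_def
  by (subst sigma_finite_measure.sigma_finite_iff_density_finite[OF sigma_finite_lborel]) auto

lemma emeasure_mu_ball: "emeasure \<mu> (ball z r) = ennreal (W z r)"
proof (cases "r > 0")
  case True
  show ?thesis
    unfolding W_def
    by (rule emeasure_eq_ennreal_measure) (use w_finite[OF True, of z] in \<open>auto simp: \<mu>_def\<close>)
next
  case False
  then show ?thesis by (simp add: W_def ball_empty)
qed

lemma W_nonneg [simp]: "0 \<le> W z r"
  by (simp add: W_def)

lemma W_pos: "0 < r \<Longrightarrow> 0 < W z r"
proof (rule ccontr)
  assume r: "0 < r" and "\<not> 0 < W z r"
  then have "emeasure \<mu> (ball z r) = 0" by (simp add: emeasure_mu_ball ennreal_eq_0_iff)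
  then have "AE x in \<mu>. x \<notin> ball z r"
    by (auto intro!: AE_I[of _ _ "ball z r"])
  then have "AE x in lborel. x \<notin> ball z r" by (simp add: AE_mu)
  then have "emeasure lborel (ball z r) = 0"
    by (subst (asm) AE_iff_measurable[of "ball z r"]) auto
  with measure_ball_pos[OF r, of z] show False
    by (simp add: emeasure_ball_lborel ennreal_eq_0_iff del: content_ball_gt_0_iff)
qed

lemma W_mono: "ball z' r' \<subseteq> ball z r \<Longrightarrow> W z' r' \<le> W z r"
  using emeasure_mono[of "ball z' r'" "ball z r" \<mu>] by (simp add: emeasure_mu_ball)

lemma A_nonneg: "0 \<le> A"
proof -
  obtain b where "b \<ge> 0" "W (0::'a) 1 * b powr (p - 1) \<le> A * measure lborel (ball (0::'a) 1) powr p"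
    using Ap_bound[of 1 "0::'a"] unfolding W_def \<mu>_def by auto
  moreover have "0 \<le> W (0::'a) 1 * b powr (p - 1)" by simp
  moreover have "0 < measure lborel (ball (0::'a) 1) powr p"
    using measure_ball_pos[of 1 "0::'a"] by simp
  ultimately show ?thesis by (meson mult_less_0_iff not_less order.trans less_le_trans)
qed

text \<open>
  This inequality is the A_p condition in the form in which it is applied: for f = w^(1/(1-p)) it
  returns the condition itself. It allows Lebesgue averages, for which changes of variables are
  available, to be compared with the weighted energy.
\<close>

lemma Ap_mean:
  assumes [measurable]: "f \<in> borel_measurable borel"
    and f0: "\<And>x. 0 \<le> f x" and r: "0 < r" and a: "0 \<le> a"
    and le: "(\<integral>\<^sup>+x\<in>ball z r. ennreal (f x powr p) \<partial>\<mu>) \<le> ennreal a"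
  shows "(\<integral>\<^sup>+x\<in>ball z r. ennreal (f x) \<partial>lborel)
    \<le> ennreal (A powr (1 / p) * measure lborel (ball z r) * (a / W z r) powr (1 / p))"
proof -
  let ?B = "ball z r"
  obtain b where b: "b \<ge> 0" "(\<integral>\<^sup>+x\<in>?B. ennreal (w x powr (1 / (1 - p))) \<partial>lborel) \<le> ennreal b"
    and Wb: "W z r * b powr (p - 1) \<le> A * measure lborel ?B powr p"
    using Ap_bound[OF r, of z] unfolding W_def \<mu>_def by auto
  let ?M = "restrict_space lborel ?B"
  have "(\<integral>\<^sup>+x. ennreal (f x) \<partial>?M) \<le> ennreal (a powr (1 / p) * b powr (1 - 1 / p))"
  proof (rule nn_integral_Hoelder_weight[where g = w and p = p])
    have "(\<integral>\<^sup>+x. ennreal (f x powr p * w x) \<partial>?M) = (\<integral>\<^sup>+x\<in>?B. ennreal (f x powr p) \<partial>\<mu>)"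
      by (subst nn_integral_mu, measurable)
         (auto simp: nn_integral_restrict_space ennreal_mult' w_pos less_imp_le mult_ac intro!: nn_integral_cong)
    then show "(\<integral>\<^sup>+x. ennreal (f x powr p * w x) \<partial>?M) \<le> ennreal a" using le by simp
    show "(\<integral>\<^sup>+x. ennreal (w x powr (1 / (1 - p))) \<partial>?M) \<le> ennreal b"
      using b by (simp add: nn_integral_restrict_space)
  qed (use f0 w_pos p_gt_1 a b in \<open>auto intro: less_imp_le intro!: measurable_restrict_space1\<close>)
  also have "\<dots> \<le> ennreal (A powr (1 / p) * measure lborel ?B * (a / W z r) powr (1 / p))"
  proof (rule ennreal_leI)
    have Wp: "W z r > 0" using W_pos[OF r] .
    have m: "measure lborel ?B > 0" using r by simp
    have "b powr (p - 1) \<le> A * measure lborel ?B powr p / W z r"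
      using Wb Wp by (simp add: field_simps)
    then have "(b powr (p - 1)) powr (1 / p) \<le> (A * measure lborel ?B powr p / W z r) powr (1 / p)"
      using p_gt_1 by (intro powr_mono2) auto
    also have "(b powr (p - 1)) powr (1 / p) = b powr (1 - 1 / p)"
      using p_gt_1 by (simp add: powr_powr diff_divide_distrib)
    also have "(A * measure lborel ?B powr p / W z r) powr (1 / p)
       = A powr (1 / p) * measure lborel ?B / W z r powr (1 / p)"
      using A_nonneg m p_gt_1 by (simp add: powr_divide powr_mult powr_powr)
    finally have "a powr (1 / p) * b powr (1 - 1 / p)
       \<le> a powr (1 / p) * (A powr (1 / p) * measure lborel ?B / W z r powr (1 / p))"
      by (intro mult_left_mono) auto
    then show "a powr (1 / p) * b powr (1 - 1 / p)
       \<le> A powr (1 / p) * measure lborel ?B * (a / W z r) powr (1 / p)"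
      using a by (simp add: powr_divide mult_ac)
  qed
  finally show ?thesis by (simp add: nn_integral_restrict_space)
qed

text \<open>
  Ap_mean for the indicator function of the smaller ball. With a fixed ratio of radii it is the
  doubling property; with ratio 2^k it bounds E(B) / \<mu>(B_k) by 2^(knp) E(B) / \<mu>(B).
\<close>

lemma W_growth:
  assumes sub: "ball z' r' \<subseteq> ball z r" and r: "0 < r" "0 < r'"
  shows "W z r \<le> A * (r / r') powr (DIM('a) * p) * W z' r'"
proof -
  define n where "n = DIM('a)"
  define V where "V = measure lborel (ball (0::'a) 1)"
  have V: "V > 0" by (simp add: V_def)
  have Vr: "measure lborel (ball x s) = s powr n * V" if "s > 0" for s and x :: 'a
    using measure_ball_scale[of s 1 x 0] that by (simp add: V_def n_def powr_realpow)
  have "(\<integral>\<^sup>+x\<in>ball z r. ennreal (indicator (ball z' r') x powr p) \<partial>\<mu>)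
      = (\<integral>\<^sup>+x. indicator (ball z' r') x \<partial>\<mu>)"
    using sub p_gt_1 by (intro nn_integral_cong) (auto simp: indicator_def)
  also have "\<dots> = ennreal (W z' r')" by (simp add: emeasure_mu_ball)
  finally have "(\<integral>\<^sup>+x\<in>ball z r. ennreal (indicator (ball z' r') x) \<partial>lborel)
    \<le> ennreal (A powr (1 / p) * measure lborel (ball z r) * (W z' r' / W z r) powr (1 / p))"
    by (intro Ap_mean borel_measurable_indicator) (auto simp: r)
  also have "(\<integral>\<^sup>+x\<in>ball z r. ennreal (indicator (ball z' r') x) \<partial>lborel)
      = (\<integral>\<^sup>+x. indicator (ball z' r') x \<partial>lborel)"
    using sub by (intro nn_integral_cong) (auto simp: indicator_def)
  also have "\<dots> = ennreal (measure lborel (ball z' r'))" by (simp add: emeasure_ball_lborel)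
  finally have "measure lborel (ball z' r') \<le> A powr (1 / p) * measure lborel (ball z r) * (W z' r' / W z r) powr (1 / p)"
    by (subst (asm) ennreal_le_iff) auto
  then have "r' powr n * V \<le> A powr (1 / p) * (r powr n * V) * (W z' r' / W z r) powr (1 / p)"
    using Vr r by simp
  then have "r' powr n \<le> A powr (1 / p) * r powr n * (W z' r' / W z r) powr (1 / p)"
    using V by (simp add: field_simps)
  then have "(r' powr n) powr p \<le> (A powr (1 / p) * r powr n * (W z' r' / W z r) powr (1 / p)) powr p"
    using p_gt_1 by (intro powr_mono2) auto
  also have "\<dots> = A * r powr (n * p) * (W z' r' / W z r)"
    using p_gt_1 A_nonneg by (simp add: powr_mult powr_powr powr_divide)
  finally have "r' powr (n * p) \<le> A * r powr (n * p) * (W z' r' / W z r)"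
    by (simp add: powr_powr)
  then show ?thesis
    using W_pos[of r z] r by (simp add: powr_divide field_simps n_def)
qed

text \<open>
  Compare a ball with itself in the growth estimate.
\<close>

lemma A_ge_1: "1 \<le> A"
  using W_growth[of "0::'a" 1 0 1] W_pos[of 1 "0::'a"] by simp

lemma W_eq_nn_integral: "ennreal (W z r) = (\<integral>\<^sup>+u. ennreal (w u) * indicator (ball z r) u \<partial>lborel)"
  by (subst emeasure_mu_ball[symmetric]) (simp add: \<mu>_def emeasure_density)

lemma measurable_W_pair [measurable]:
  "(\<lambda>(x, y). W (midpoint x y) (dist x y / 2)) \<in> borel_measurable (borel \<Otimes>\<^sub>M borel)"
proof -
  have eq: "W (midpoint x y) (dist x y / 2)
     = enn2real (\<integral>\<^sup>+u. ennreal (w u) * (if dist (midpoint x y) u < dist x y / 2 then 1 else 0) \<partial>lborel)" for x y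
    by (subst enn2real_ennreal[of "W _ _", symmetric], simp, subst W_eq_nn_integral)
       (auto intro!: arg_cong[where f = enn2real] nn_integral_cong simp: indicator_def)
  show ?thesis
    unfolding eq unfolding split_beta' midpoint_def by measurable
qed

end

section \<open>Oscillation at a small scale controls oscillation on the ball\<close>

lemma nn_integral_lborel_affine:
  fixes f :: "'a::euclidean_space \<Rightarrow> ennreal"
  assumes [measurable]: "f \<in> borel_measurable borel" and c: "c \<noteq> 0"
  shows "(\<integral>\<^sup>+x. f x \<partial>lborel) = ennreal (\<bar>c\<bar> ^ DIM('a)) * (\<integral>\<^sup>+x. f (t + c *\<^sub>R x) \<partial>lborel)"
  by (subst lborel_affine[OF c, of t])
     (simp add: nn_integral_density nn_integral_distr nn_integral_cmult)

lemma nn_integral_lborel_translate: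
  fixes f :: "'a::euclidean_space \<Rightarrow> ennreal"
  assumes "f \<in> borel_measurable borel"
  shows "(\<integral>\<^sup>+x. f (t + x) \<partial>lborel) = (\<integral>\<^sup>+x. f x \<partial>lborel)"
  using nn_integral_lborel_affine[OF assms, of 1 t] by simp

text \<open>
  Cut the segment from x to y into N equal pieces. With h = (y - x)/N the pieces are the pairs (x
  + ih, x + (i+1)h), which stay in S by convexity. Substituting y = x + Nh costs N^n, the
  translation by ih costs nothing, and there are N pieces.
\<close>

lemma oscillation_chain:
  fixes v :: "'a::euclidean_space \<Rightarrow> real"
  assumes [measurable]: "v \<in> borel_measurable borel" "S \<in> sets borel"
    and S: "convex S" and D: "\<And>x y. x \<in> S \<Longrightarrow> y \<in> S \<Longrightarrow> norm (x - y) < D" and N: "0 < (N::nat)"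
  shows "(\<integral>\<^sup>+x\<in>S. (\<integral>\<^sup>+y\<in>S. ennreal \<bar>v x - v y\<bar> \<partial>lborel) \<partial>lborel)
    \<le> ennreal (real N ^ (DIM('a) + 1)) *
      (\<integral>\<^sup>+x\<in>S. (\<integral>\<^sup>+y\<in>S. ennreal \<bar>v x - v y\<bar> * indicator {y. norm (x - y) < D / N} y \<partial>lborel) \<partial>lborel)"
proof -
  let ?n = "DIM('a)"
  define F where "F \<xi> h = ennreal \<bar>v \<xi> - v (\<xi> + h)\<bar> * (indicator S \<xi> * indicator S (\<xi> + h) * indicator {h. norm h < D / N} h)" for \<xi> h
  have [measurable]: "(\<lambda>(x, h). F x h) \<in> borel_measurable (borel \<Otimes>\<^sub>M borel)"
    unfolding F_def split_beta' by measurable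
  have chain: "ennreal \<bar>v x - v (x + real N *\<^sub>R h)\<bar> * indicator S x * indicator S (x + real N *\<^sub>R h)
      \<le> (\<Sum>i<N. F (x + real i *\<^sub>R h) h)" for x h
  proof (cases "x \<in> S \<and> x + real N *\<^sub>R h \<in> S")
    case True
    have inS: "x + real i *\<^sub>R h \<in> S" if "i \<le> N" for i
    proof -
      have "(1 - i / N) *\<^sub>R x + (i / N) *\<^sub>R (x + real N *\<^sub>R h) \<in> S"
        using True that N by (intro convexD[OF S]) (auto simp: field_simps)
      also have "(1 - i / N) *\<^sub>R x + (i / N) *\<^sub>R (x + real N *\<^sub>R h) = x + real i *\<^sub>R h"
        using N by (simp add: algebra_simps)
      finally show ?thesis .
    qed
    have "norm (x - (x + real N *\<^sub>R h)) < D" using True by (intro D) auto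
    then have h: "norm h < D / N" using N by (simp add: field_simps)
    have "\<bar>v x - v (x + real N *\<^sub>R h)\<bar> = \<bar>\<Sum>i<N. v (x + real i *\<^sub>R h) - v (x + real (Suc i) *\<^sub>R h)\<bar>"
      by (subst sum_lessThan_telescope') simp
    also have "\<dots> \<le> (\<Sum>i<N. \<bar>v (x + real i *\<^sub>R h) - v (x + real (Suc i) *\<^sub>R h)\<bar>)"
      by (rule sum_abs)
    finally have "ennreal \<bar>v x - v (x + real N *\<^sub>R h)\<bar>
      \<le> (\<Sum>i<N. ennreal \<bar>v (x + real i *\<^sub>R h) - v (x + real (Suc i) *\<^sub>R h)\<bar>)"
      by (simp add: sum_ennreal ennreal_leI)
    also have "\<dots> = (\<Sum>i<N. F (x + real i *\<^sub>R h) h)"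
    proof (rule sum.cong)
      fix i assume "i \<in> {..<N}"
      then have "x + real i *\<^sub>R h \<in> S" "x + real (Suc i) *\<^sub>R h \<in> S" by (auto intro!: inS simp del: of_nat_Suc)
      moreover have "x + real (Suc i) *\<^sub>R h = x + real i *\<^sub>R h + h" by (simp add: algebra_simps)
      ultimately show "ennreal \<bar>v (x + real i *\<^sub>R h) - v (x + real (Suc i) *\<^sub>R h)\<bar> = F (x + real i *\<^sub>R h) h"
        using h unfolding F_def by (simp add: add.assoc)
    qed simp
    finally show ?thesis using True by simp
  qed auto
  have "(\<integral>\<^sup>+x\<in>S. (\<integral>\<^sup>+y\<in>S. ennreal \<bar>v x - v y\<bar> \<partial>lborel) \<partial>lborel)
    = (\<integral>\<^sup>+x. (\<integral>\<^sup>+y. ennreal \<bar>v x - v y\<bar> * indicator S x * indicator S y \<partial>lborel) \<partial>lborel)"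
    by (intro nn_integral_cong, subst nn_integral_multc[symmetric], measurable)
       (auto intro!: nn_integral_cong simp: mult_ac)
  also have "\<dots> = (\<integral>\<^sup>+x. ennreal (real N ^ ?n) * (\<integral>\<^sup>+h. ennreal \<bar>v x - v (x + real N *\<^sub>R h)\<bar> * indicator S x * indicator S (x + real N *\<^sub>R h) \<partial>lborel) \<partial>lborel)"
    by (rule nn_integral_cong, subst nn_integral_lborel_affine[where c = "real N" and t = x for x]) (use N in auto)
  also have "\<dots> = ennreal (real N ^ ?n) * (\<integral>\<^sup>+x. (\<integral>\<^sup>+h. ennreal \<bar>v x - v (x + real N *\<^sub>R h)\<bar> * indicator S x * indicator S (x + real N *\<^sub>R h) \<partial>lborel) \<partial>lborel)"
    by (rule nn_integral_cmult) measurable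
  also have "\<dots> \<le> ennreal (real N ^ ?n) * (\<integral>\<^sup>+x. (\<integral>\<^sup>+h. (\<Sum>i<N. F (x + real i *\<^sub>R h) h) \<partial>lborel) \<partial>lborel)"
    by (intro mult_left_mono nn_integral_mono chain) auto
  also have "(\<integral>\<^sup>+x. (\<integral>\<^sup>+h. (\<Sum>i<N. F (x + real i *\<^sub>R h) h) \<partial>lborel) \<partial>lborel)
      = (\<integral>\<^sup>+h. (\<integral>\<^sup>+x. (\<Sum>i<N. F (x + real i *\<^sub>R h) h) \<partial>lborel) \<partial>lborel)"
    by (rule lborel_pair.Fubini') measurable
  also have "\<dots> = (\<integral>\<^sup>+h. (\<Sum>i<N. (\<integral>\<^sup>+x. F (x + real i *\<^sub>R h) h \<partial>lborel)) \<partial>lborel)"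
    by (intro nn_integral_cong nn_integral_sum) measurable
  also have "\<dots> = (\<integral>\<^sup>+h. (\<Sum>i<N. (\<integral>\<^sup>+x. F x h \<partial>lborel)) \<partial>lborel)"
  proof (rule nn_integral_cong, rule sum.cong[OF refl])
    fix h :: 'a and i
    show "(\<integral>\<^sup>+x. F (x + real i *\<^sub>R h) h \<partial>lborel) = (\<integral>\<^sup>+x. F x h \<partial>lborel)"
      using nn_integral_lborel_translate[of "\<lambda>x. F x h" "real i *\<^sub>R h"] by (simp add: add.commute)
  qed
  also have "\<dots> = (\<integral>\<^sup>+h. ennreal N * (\<integral>\<^sup>+x. F x h \<partial>lborel) \<partial>lborel)"
    by (simp add: ennreal_of_nat_eq_real_of_nat)
  also have "\<dots> = ennreal N * (\<integral>\<^sup>+h. (\<integral>\<^sup>+x. F x h \<partial>lborel) \<partial>lborel)"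
    by (rule nn_integral_cmult) measurable
  also have "(\<integral>\<^sup>+h. (\<integral>\<^sup>+x. F x h \<partial>lborel) \<partial>lborel) = (\<integral>\<^sup>+x. (\<integral>\<^sup>+h. F x h \<partial>lborel) \<partial>lborel)"
    by (rule lborel_pair.Fubini') measurable
  also have "\<dots> = (\<integral>\<^sup>+x\<in>S. (\<integral>\<^sup>+y\<in>S. ennreal \<bar>v x - v y\<bar> * indicator {y. norm (x - y) < D / N} y \<partial>lborel) \<partial>lborel)"
  proof (rule nn_integral_cong)
    fix x :: 'a
    have "(\<integral>\<^sup>+h. F x h \<partial>lborel)
      = (\<integral>\<^sup>+h. (\<lambda>y. ennreal \<bar>v x - v y\<bar> * indicator {y. norm (x - y) < D / N} y * indicator S y * indicator S x) (x + h) \<partial>lborel)"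
      by (intro nn_integral_cong) (auto simp: F_def indicator_def)
    also have "\<dots> = (\<integral>\<^sup>+y. ennreal \<bar>v x - v y\<bar> * indicator {y. norm (x - y) < D / N} y * indicator S y * indicator S x \<partial>lborel)"
      by (rule nn_integral_lborel_translate) measurable
    also have "\<dots> = (\<integral>\<^sup>+y\<in>S. ennreal \<bar>v x - v y\<bar> * indicator {y. norm (x - y) < D / N} y \<partial>lborel) * indicator S x"
      by (rule nn_integral_multc) measurable
    finally show "(\<integral>\<^sup>+h. F x h \<partial>lborel) = \<dots>" .
  qed
  finally show ?thesis
    by (simp add: ennreal_mult[symmetric] mult.assoc[symmetric] mult.commute)
qed

section \<open>Oscillation and energy at a fixed scale\<close>

text \<open>
  A truncated geometric series is comparable with its last term; the minimum in the induction
  keeps the two cases, truncation reached or not, in one formula.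
\<close>

lemma dyadic_sum_le:
  fixes a :: real
  assumes t: "0 < t" and R: "0 < R" and a: "a = 2 powr t"
  shows "(\<Sum>j<M. a ^ j * (if 2 ^ j < R then 1 else 0)) \<le> a / (a - 1) * R powr t"
proof -
  have a1: "1 < a" using t a by simp
  have "(\<Sum>j<M. a ^ j * (if 2 ^ j < R then 1 else 0)) \<le> min (a ^ M) (a * R powr t) / (a - 1)"
  proof (induction M)
    case 0
    then show ?case using a1 R by simp
  next
    case (Suc M)
    show ?case
    proof (cases "2 ^ M < R")
      case True
      have "a ^ M = (2 ^ M) powr t"
        by (simp add: a powr_realpow[symmetric] powr_powr mult.commute)
      also have "\<dots> \<le> R powr t" using True t by (intro powr_mono2) auto
      finally have 1: "a * a ^ M \<le> a * R powr t" using a1 by simp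
      have "(\<Sum>j<Suc M. a ^ j * (if 2 ^ j < R then 1 else 0)) \<le> a ^ M / (a - 1) + a ^ M"
        using Suc.IH True a1 by (simp add: divide_right_mono order.trans)
      also have "\<dots> = a * a ^ M / (a - 1)" using a1 by (simp add: field_simps)
      finally show ?thesis using 1 by (simp add: min_def)
    next
      case False
      then have "(\<Sum>j<Suc M. a ^ j * (if 2 ^ j < R then 1 else 0)) \<le> min (a ^ M) (a * R powr t) / (a - 1)"
        using Suc.IH by simp
      also have "\<dots> \<le> min (a ^ Suc M) (a * R powr t) / (a - 1)"
        using a1 by (intro divide_right_mono min.mono) auto
      finally show ?thesis .
    qed
  qed
  also have "\<dots> \<le> a * R powr t / (a - 1)"
    using a1 by (intro divide_right_mono) auto
  finally show ?thesis by simp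
qed

lemma midpoint_ball_subset:
  fixes x y :: "'a::euclidean_space"
  assumes "dist x y \<le> d"
  shows "ball (midpoint x y) (dist x y / 2) \<subseteq> ball x d"
proof
  fix u assume "u \<in> ball (midpoint x y) (dist x y / 2)"
  then have "dist (midpoint x y) u < dist x y / 2" by simp
  moreover have "dist x u \<le> dist x (midpoint x y) + dist (midpoint x y) u" by (rule dist_triangle)
  ultimately show "u \<in> ball x d" using assms by (simp add: dist_midpoint)
qed

context muckenhoupt_weight
begin

definition pair_weight :: "'a \<Rightarrow> 'a \<Rightarrow> real" where
  "pair_weight x y = W (midpoint x y) (dist x y / 2)"

text \<open>
  The energy written against \<mu> in both variables, which absorbs the factors w x and w y.
\<close>

definition mu_energy :: "real \<Rightarrow> 'a set \<Rightarrow> ('a \<Rightarrow> real) \<Rightarrow> ennreal" where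
  "mu_energy s S v = (\<integral>\<^sup>+x\<in>S. (\<integral>\<^sup>+y\<in>S.
     ennreal (\<bar>v x - v y\<bar> powr p / norm (x - y) powr (s * p) / pair_weight x y) \<partial>\<mu>) \<partial>\<mu>)"

definition mu_energy_within :: "real \<Rightarrow> 'a set \<Rightarrow> ('a \<Rightarrow> real) \<Rightarrow> ennreal" where
  "mu_energy_within d S v = (\<integral>\<^sup>+x\<in>S. (\<integral>\<^sup>+y\<in>S.
     ennreal (\<bar>v x - v y\<bar> powr p / pair_weight x y) * indicator {y. norm (x - y) < d} y \<partial>\<mu>) \<partial>\<mu>)"

lemma pair_weight_measurable [measurable]:
  "(\<lambda>(x, y). pair_weight x y) \<in> borel_measurable (borel \<Otimes>\<^sub>M borel)"
  unfolding pair_weight_def by (rule measurable_W_pair)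

lemma pair_weight_nonneg [simp]: "0 \<le> pair_weight x y"
  by (simp add: pair_weight_def)

lemma pair_weight_pos: "x \<noteq> y \<Longrightarrow> 0 < pair_weight x y"
  by (simp add: pair_weight_def W_pos)

lemma pair_weight_le: "dist x y \<le> d \<Longrightarrow> pair_weight x y \<le> W x d"
  unfolding pair_weight_def by (intro W_mono midpoint_ball_subset)

text \<open>
  States measurability of parametric \<mu>-integrals over the Borel sigma algebra rather than that
  of \<mu>, so that measurability of nested integrals is found automatically.
\<close>

lemma borel_measurable_nn_integral_mu [measurable (raw)]:
  assumes "case_prod f \<in> borel_measurable (N \<Otimes>\<^sub>M borel)"
  shows "(\<lambda>x. \<integral>\<^sup>+y. f x y \<partial>\<mu>) \<in> borel_measurable N"
proof -
  interpret sigma_finite_measure \<mu> by (rule sigma_finite_mu)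
  have "sets (N \<Otimes>\<^sub>M borel) = sets (N \<Otimes>\<^sub>M \<mu>)"
    by (intro sets_pair_measure_cong) auto
  then show ?thesis using assms
    by (intro borel_measurable_nn_integral) (simp cong: measurable_cong_sets)
qed

text \<open>
  Ap_mean is applied twice: for fixed x on the ball of radius d about x, where pair_weight x y is
  at most \<mu> of that ball, so that the weight of the pair can be inserted, and then in x on the
  whole ball to the p-th root of the resulting inner integral.
\<close>

lemma local_oscillation_le:
  assumes [measurable]: "v \<in> borel_measurable borel" and r: "0 < r" and d: "0 < d" and a: "0 \<le> a"
    and le: "mu_energy_within d (ball z r) v \<le> ennreal a"
  shows "(\<integral>\<^sup>+x\<in>ball z r. (\<integral>\<^sup>+y\<in>ball z r. ennreal \<bar>v x - v y\<bar> * indicator {y. norm (x - y) < d} y \<partial>lborel) \<partial>lborel)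
    \<le> ennreal (A powr (2 / p) * measure lborel (ball z d) * measure lborel (ball z r) * (a / W z r) powr (1 / p))"
proof -
  let ?B = "ball z r"
  have [measurable]: "?B \<in> sets borel" by simp
  \<comment> \<open>The inner integral may be infinite on a null set; h is its p-th root, made real there by the value 0.\<close>
  define H where "H x = (\<integral>\<^sup>+y\<in>?B. ennreal (\<bar>v x - v y\<bar> powr p / pair_weight x y) * indicator {y. norm (x - y) < d} y \<partial>\<mu>)" for x
  have [measurable]: "H \<in> borel_measurable borel"
    unfolding H_def by measurable
  have H_int: "(\<integral>\<^sup>+x\<in>?B. H x \<partial>\<mu>) \<le> ennreal a"
    using le by (simp add: mu_energy_within_def H_def)
  define h where "h x = enn2real (H x) powr (1 / p)" for x
  have [measurable]: "h \<in> borel_measurable borel" unfolding h_def by measurable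
  define c where "c = A powr (1 / p) * measure lborel (ball z d)"
  have c0: "c \<ge> 0" by (simp add: c_def)
  have fin: "AE x in lborel. H x * indicator ?B x \<noteq> \<infinity>"
    unfolding AE_mu[symmetric]
    by (rule nn_integral_PInf_AE) (use H_int in \<open>auto simp: top_unique\<close>)
  have inner: "(\<integral>\<^sup>+y\<in>?B. ennreal \<bar>v x - v y\<bar> * indicator {y. norm (x - y) < d} y \<partial>lborel) \<le> ennreal c * ennreal (h x)"
    if x: "x \<in> ?B" "H x \<noteq> \<infinity>" for x
  proof -
    define f where "f y = \<bar>v x - v y\<bar> * indicator ?B y" for y
    have Wd: "W x d > 0" using d by (rule W_pos)
    have Hx: "H x = ennreal (enn2real (H x))" using x by (simp add: less_top)
    have "(\<integral>\<^sup>+y\<in>ball x d. ennreal (f y powr p) \<partial>\<mu>)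
       \<le> (\<integral>\<^sup>+y. ennreal (W x d) * (ennreal (\<bar>v x - v y\<bar> powr p / pair_weight x y) * indicator {y. norm (x - y) < d} y * indicator ?B y) \<partial>\<mu>)"
    proof (rule nn_integral_mono)
      fix y
      show "ennreal (f y powr p) * indicator (ball x d) y
        \<le> ennreal (W x d) * (ennreal (\<bar>v x - v y\<bar> powr p / pair_weight x y) * indicator {y. norm (x - y) < d} y * indicator ?B y)"
      proof (cases "y \<in> ball x d \<and> y \<in> ?B \<and> y \<noteq> x")
        case True
        then have "pair_weight x y \<le> W x d" "0 < pair_weight x y"
          using pair_weight_le[of x y d] pair_weight_pos[of x y] by auto
        then have "\<bar>v x - v y\<bar> powr p \<le> W x d * (\<bar>v x - v y\<bar> powr p / pair_weight x y)"
          by (simp add: field_simps mult_right_mono)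
        then show ?thesis using True Wd
          by (simp add: f_def ennreal_mult[symmetric] dist_norm)
      qed (auto simp: f_def indicator_def)
    qed
    also have "\<dots> = ennreal (W x d) * H x"
      unfolding H_def by (rule nn_integral_cmult) measurable
    also have "\<dots> = ennreal (W x d * enn2real (H x))"
      by (subst Hx) (simp add: ennreal_mult)
    finally have "(\<integral>\<^sup>+y\<in>ball x d. ennreal (f y) \<partial>lborel)
      \<le> ennreal (A powr (1 / p) * measure lborel (ball x d) * (W x d * enn2real (H x) / W x d) powr (1 / p))"
      by (intro Ap_mean) (auto simp: f_def d)
    also have "A powr (1 / p) * measure lborel (ball x d) * (W x d * enn2real (H x) / W x d) powr (1 / p) = c * h x"
      using Wd measure_ball_scale[of d 1 x z] d by (simp add: c_def h_def content_ball)
    also have "(\<integral>\<^sup>+y\<in>ball x d. ennreal (f y) \<partial>lborel)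
       = (\<integral>\<^sup>+y\<in>?B. ennreal \<bar>v x - v y\<bar> * indicator {y. norm (x - y) < d} y \<partial>lborel)"
      by (intro nn_integral_cong) (auto simp: f_def indicator_def dist_norm)
    finally show ?thesis using c0 by (simp add: ennreal_mult' h_def)
  qed
  have "(\<integral>\<^sup>+x\<in>?B. (\<integral>\<^sup>+y\<in>?B. ennreal \<bar>v x - v y\<bar> * indicator {y. norm (x - y) < d} y \<partial>lborel) \<partial>lborel)
     \<le> (\<integral>\<^sup>+x. ennreal c * (ennreal (h x) * indicator ?B x) \<partial>lborel)"
    using fin
    by (intro nn_integral_mono_AE, elim eventually_mono) (use inner in \<open>auto simp: indicator_def\<close>)
  also have "\<dots> = ennreal c * (\<integral>\<^sup>+x\<in>?B. ennreal (h x) \<partial>lborel)"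
    by (rule nn_integral_cmult) measurable
  also have "\<dots> \<le> ennreal c * ennreal (A powr (1 / p) * measure lborel ?B * (a / W z r) powr (1 / p))"
  proof (intro mult_left_mono Ap_mean r a)
    have "(\<integral>\<^sup>+x\<in>?B. ennreal (h x powr p) \<partial>\<mu>) \<le> (\<integral>\<^sup>+x\<in>?B. H x \<partial>\<mu>)"
    proof (intro nn_integral_mono mult_right_mono)
      fix x
      show "ennreal (h x powr p) \<le> H x"
        using p_gt_1 by (cases "H x") (auto simp: h_def powr_powr)
    qed auto
    then show "(\<integral>\<^sup>+x\<in>?B. ennreal (h x powr p) \<partial>\<mu>) \<le> ennreal a" using H_int by simp
  qed (auto simp: h_def)
  also have "\<dots> = ennreal (A powr (2 / p) * measure lborel (ball z d) * measure lborel ?B * (a / W z r) powr (1 / p))"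
    using c0 by (simp add: ennreal_mult[symmetric] c_def)
       (metis (no_types, lifting) ab_semigroup_mult_class.mult_ac(1) field_sum_of_halves mult.commute powr_add add_divide_distrib one_add_one)
  finally show ?thesis .
qed

definition poincare_const :: real where
  "poincare_const = 2 powr (DIM('a) * p) * A\<^sup>2 * (2 powr p * (4 * p))"

lemma mu_energy_within_le:
  assumes [measurable]: "v \<in> borel_measurable borel" and r: "0 < r" and s: "0 \<le> s"
  shows "mu_energy_within (2 * r) (ball z r) v \<le> ennreal ((2 * r) powr (s * p)) * mu_energy s (ball z r) v"
proof -
  have [measurable]: "ball z r \<in> sets borel" by simp
  have "mu_energy_within (2 * r) (ball z r) v \<le> (\<integral>\<^sup>+x. (\<integral>\<^sup>+y. ennreal ((2 * r) powr (s * p)) *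
     (ennreal (\<bar>v x - v y\<bar> powr p / norm (x - y) powr (s * p) / pair_weight x y) * indicator (ball z r) y) \<partial>\<mu>) * indicator (ball z r) x \<partial>\<mu>)"
    unfolding mu_energy_within_def
  proof (intro nn_integral_mono mult_right_mono)
    fix x y
    show "ennreal (\<bar>v x - v y\<bar> powr p / pair_weight x y) * indicator {y. norm (x - y) < 2 * r} y * indicator (ball z r) y
      \<le> ennreal ((2 * r) powr (s * p)) *
     (ennreal (\<bar>v x - v y\<bar> powr p / norm (x - y) powr (s * p) / pair_weight x y) * indicator (ball z r) y)"
    proof (cases "y \<in> ball z r \<and> norm (x - y) < 2 * r \<and> x \<noteq> y")
      case True
      have "norm (x - y) powr (s * p) \<le> (2 * r) powr (s * p)"
        using True s p_gt_1 by (intro powr_mono2) auto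
      then have "1 \<le> (2 * r) powr (s * p) / norm (x - y) powr (s * p)"
        using True by (simp add: field_simps)
      then have "1 * (\<bar>v x - v y\<bar> powr p / pair_weight x y)
        \<le> ((2 * r) powr (s * p) / norm (x - y) powr (s * p)) * (\<bar>v x - v y\<bar> powr p / pair_weight x y)"
        by (intro mult_right_mono) auto
      then show ?thesis using True by (simp add: ennreal_mult[symmetric] ennreal_leI)
    qed (auto simp: indicator_def)
  qed auto
  also have "\<dots> = ennreal ((2 * r) powr (s * p)) * mu_energy s (ball z r) v"
    unfolding mu_energy_def by (simp add: nn_integral_cmult mult.assoc)
  finally show ?thesis .
qed

text \<open>
  The energy at scale 2r/2^j is weighted with 2^(jsp). A pair x, y is counted for the j with 2^j <
  2r / |x - y|, and the geometric sum over these j is of order (2r / |x - y|)^(sp): the singular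
  kernel of the energy.
\<close>

lemma sum_mu_energy_within_le:
  assumes [measurable]: "v \<in> borel_measurable borel" and r: "0 < r" and s: "0 < s"
  defines "a \<equiv> 2 powr (s * p)"
  shows "(\<Sum>j<M. ennreal (a ^ j) * mu_energy_within (2 * r / 2 ^ j) (ball z r) v)
     \<le> ennreal (a / (a - 1) * (2 * r) powr (s * p)) * mu_energy s (ball z r) v"
proof -
  have [measurable]: "ball z r \<in> sets borel" by simp
  have sp: "0 < s * p" using s p_gt_1 by simp
  have a1: "1 < a" using sp by (simp add: a_def)
  let ?k = "\<lambda>x y. \<bar>v x - v y\<bar> powr p / pair_weight x y"
  have "(\<Sum>j<M. ennreal (a ^ j) * mu_energy_within (2 * r / 2 ^ j) (ball z r) v)
    = (\<integral>\<^sup>+x. (\<integral>\<^sup>+y. (\<Sum>j<M. ennreal (a ^ j) * (ennreal (?k x y) * indicator {y. norm (x - y) < 2 * r / 2 ^ j} y)) * indicator (ball z r) y \<partial>\<mu>) * indicator (ball z r) x \<partial>\<mu>)"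
    unfolding mu_energy_within_def
    by (simp add: nn_integral_cmult[symmetric] nn_integral_sum[symmetric] nn_integral_multc[symmetric] sum_distrib_left sum_distrib_right mult_ac)
  also have "\<dots> \<le> (\<integral>\<^sup>+x. (\<integral>\<^sup>+y. ennreal (a / (a - 1) * (2 * r) powr (s * p)) *
     (ennreal (\<bar>v x - v y\<bar> powr p / norm (x - y) powr (s * p) / pair_weight x y) * indicator (ball z r) y) \<partial>\<mu>) * indicator (ball z r) x \<partial>\<mu>)"
  proof (intro nn_integral_mono mult_right_mono)
    fix x y
    show "(\<Sum>j<M. ennreal (a ^ j) * (ennreal (?k x y) * indicator {y. norm (x - y) < 2 * r / 2 ^ j} y)) * indicator (ball z r) y
      \<le> ennreal (a / (a - 1) * (2 * r) powr (s * p)) *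
     (ennreal (\<bar>v x - v y\<bar> powr p / norm (x - y) powr (s * p) / pair_weight x y) * indicator (ball z r) y)"
    proof (cases "y \<in> ball z r \<and> x \<noteq> y")
      case True
      define R where "R = 2 * r / norm (x - y)"
      have R: "R > 0" using True r by (simp add: R_def)
      have "(\<Sum>j<M. ennreal (a ^ j) * (ennreal (?k x y) * indicator {y. norm (x - y) < 2 * r / 2 ^ j} y))
        = (\<Sum>j<M. ennreal (?k x y * (a ^ j * (if 2 ^ j < R then 1 else 0))))"
        using True a1 by (intro sum.cong) (auto simp: R_def field_simps ennreal_mult[symmetric])
      also have "\<dots> = ennreal (?k x y * (\<Sum>j<M. a ^ j * (if 2 ^ j < R then 1 else 0)))"
        using a1 by (subst sum_ennreal) (auto simp: sum_distrib_left)
      also have "\<dots> \<le> ennreal (?k x y * (a / (a - 1) * R powr (s * p)))"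
        by (intro ennreal_leI mult_left_mono dyadic_sum_le sp R) (auto simp: a_def)
      also have "\<dots> = ennreal (a / (a - 1) * (2 * r) powr (s * p)) *
         ennreal (\<bar>v x - v y\<bar> powr p / norm (x - y) powr (s * p) / pair_weight x y)"
        using a1 r by (simp add: R_def powr_divide ennreal_mult[symmetric] mult_ac)
      finally show ?thesis using True by simp
    qed auto
  qed auto
  also have "\<dots> = ennreal (a / (a - 1) * (2 * r) powr (s * p)) * mu_energy s (ball z r) v"
    unfolding mu_energy_def by (simp add: nn_integral_cmult mult.assoc)
  finally show ?thesis .
qed

end

section \<open>Poincare inequality with the factor 1 - s\<close>

context muckenhoupt_weight
begin

text \<open>
  Of the factor N^(n+1) in the chain estimate only N survives, since a ball of radius 2r/N has the
  fraction (2/N)^n of the volume.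
\<close>

lemma oscillation_le_mu_energy_within:
  assumes [measurable]: "v \<in> borel_measurable borel" and r: "0 < r" and N: "0 < (N::nat)" and a: "0 \<le> a"
    and le: "mu_energy_within (2 * r / N) (ball z r) v \<le> ennreal a"
  shows "(\<integral>\<^sup>+x\<in>ball z r. (\<integral>\<^sup>+y\<in>ball z r. ennreal \<bar>v x - v y\<bar> \<partial>lborel) \<partial>lborel)
    \<le> ennreal ((measure lborel (ball z r))\<^sup>2 * (2 powr DIM('a) * N * A powr (2 / p) * (a / W z r) powr (1 / p)))"
proof -
  let ?B = "ball z r" and ?n = "DIM('a)"
  have "(\<integral>\<^sup>+x\<in>?B. (\<integral>\<^sup>+y\<in>?B. ennreal \<bar>v x - v y\<bar> \<partial>lborel) \<partial>lborel)
    \<le> ennreal (real N ^ (DIM('a) + 1)) *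
      (\<integral>\<^sup>+x\<in>?B. (\<integral>\<^sup>+y\<in>?B. ennreal \<bar>v x - v y\<bar> * indicator {y. norm (x - y) < 2 * r / N} y \<partial>lborel) \<partial>lborel)"
  proof (rule oscillation_chain)
    fix x y assume "x \<in> ?B" "y \<in> ?B"
    then have "dist x y < 2 * r" using dist_triangle2[of x y z] by (simp add: dist_commute)
    then show "norm (x - y) < 2 * r" by (simp add: dist_norm)
  qed (use N in auto)
  also have "\<dots> \<le> ennreal (real N ^ (?n + 1)) *
      ennreal (A powr (2 / p) * measure lborel (ball z (2 * r / N)) * measure lborel ?B * (a / W z r) powr (1 / p))"
    using r N a by (intro mult_left_mono local_oscillation_le le) auto
  also have "\<dots> = ennreal (real N ^ (?n + 1) * (A powr (2 / p) * measure lborel (ball z (2 * r / N)) * measure lborel ?B * (a / W z r) powr (1 / p)))"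
    by (rule ennreal_mult[symmetric]) auto
  also have "measure lborel (ball z (2 * r / N)) = (2 / N) ^ ?n * measure lborel ?B"
    using measure_ball_scale[of "2 / N" r z z] r by simp
  also have "real N ^ (?n + 1) * (A powr (2 / p) * ((2 / N) ^ ?n * measure lborel ?B) * measure lborel ?B * (a / W z r) powr (1 / p))
    = (measure lborel ?B)\<^sup>2 * (2 powr ?n * N * A powr (2 / p) * (a / W z r) powr (1 / p))"
    using N by (simp add: power_divide powr_realpow power2_eq_square field_simps)
  finally show ?thesis .
qed

text \<open>
  The oscillation at scale 2r/N controls the oscillation on the ball with a loss of N^p in p-th
  power, whereas the energy at that scale gains N^(sp). Hence, up to constants, each of the scales
  N = 2^j contributes at least 2^(-jp(1-s)) osc^p to the energy, and these contributions add up to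
  about osc^p / (p(1 - s)). For s < 1/2 the factor 1 - s is bounded below and the largest scale
  alone is enough, which avoids the constant 1/s of the geometric sum.
\<close>

lemma fractional_poincare:
  assumes [measurable]: "v \<in> borel_measurable borel" and r: "0 < r" and s: "0 < s" "s < 1" and e: "0 \<le> e"
    and le: "mu_energy s (ball z r) v \<le> ennreal e"
  shows "(\<integral>\<^sup>+x\<in>ball z r. (\<integral>\<^sup>+y\<in>ball z r. ennreal \<bar>v x - v y\<bar> \<partial>lborel) \<partial>lborel)
    \<le> ennreal ((measure lborel (ball z r))\<^sup>2 * (poincare_const * (1 - s) * r powr (s * p) * (e / W z r)) powr (1 / p))"
proof -
  let ?B = "ball z r" and ?n = "DIM('a)"
  let ?I = "\<integral>\<^sup>+x\<in>?B. (\<integral>\<^sup>+y\<in>?B. ennreal \<bar>v x - v y\<bar> \<partial>lborel) \<partial>lborel"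
  define m where "m = measure lborel ?B"
  have m: "m > 0" using r by (simp add: m_def)
  have Wp: "W z r > 0" using r by (rule W_pos)
  have sp: "0 < s * p" using s p_gt_1 by simp
  define L where "L = 2 powr (?n * p) * A\<^sup>2"
  have L: "L > 0" using A_ge_1 by (simp add: L_def)
  have w1: "mu_energy_within (2 * r / 1) ?B v \<le> ennreal ((2 * r) powr (s * p) * e)"
  proof -
    have "mu_energy_within (2 * r) ?B v \<le> ennreal ((2 * r) powr (s * p)) * ennreal e"
      using mu_energy_within_le[OF assms(1) r, of s z] s mult_left_mono[OF le, of "ennreal ((2 * r) powr (s * p))"]
      by (meson less_imp_le order.trans zero_le)
    then show ?thesis using e by (simp add: ennreal_mult)
  qed
  have "?I < \<infinity>"
    using oscillation_le_mu_energy_within[OF assms(1) r, of 1 "(2 * r) powr (s * p) * e" z] w1 e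
    by (auto simp: less_top[symmetric] top_unique)
  then obtain J0 where J0: "?I = ennreal J0" "J0 \<ge> 0" by (cases ?I) auto
  define J where "J = J0 / m\<^sup>2"
  have J: "J \<ge> 0" "?I = ennreal (m\<^sup>2 * J)" using J0 m by (auto simp: J_def)
  have scale: "J powr p \<le> L * real N powr p * (a / W z r)"
    if "0 < N" "0 \<le> a" "mu_energy_within (2 * r / real N) ?B v \<le> ennreal a" for N :: nat and a
  proof -
    have "?I \<le> ennreal (m\<^sup>2 * (2 powr ?n * N * A powr (2 / p) * (a / W z r) powr (1 / p)))"
      unfolding m_def by (rule oscillation_le_mu_energy_within) (use that r in auto)
    then have "m\<^sup>2 * J \<le> m\<^sup>2 * (2 powr ?n * N * A powr (2 / p) * (a / W z r) powr (1 / p))"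
      unfolding J by (subst (asm) ennreal_le_iff) auto
    then have "J \<le> 2 powr ?n * N * A powr (2 / p) * (a / W z r) powr (1 / p)"
      using m by simp
    then have "J powr p \<le> (2 powr ?n * N * A powr (2 / p) * (a / W z r) powr (1 / p)) powr p"
      using J p_gt_1 by (intro powr_mono2) auto
    also have "\<dots> = L * real N powr p * (a / W z r)"
      using p_gt_1 A_ge_1 that Wp by (simp add: powr_mult powr_powr L_def mult_ac)
    finally show ?thesis .
  qed
  have main: "J powr p \<le> poincare_const * (1 - s) * r powr (s * p) * (e / W z r)"
  proof (cases "s < 1 / 2")
    case True
    have "J powr p \<le> L * real 1 powr p * ((2 * r) powr (s * p) * e / W z r)"
      by (rule scale) (use w1 e in auto)
    also have "\<dots> = L * (2 powr (s * p) * 1) * (r powr (s * p) * (e / W z r))"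
      using r by (simp add: powr_mult)
    also have "\<dots> \<le> L * (2 powr p * (4 * p * (1 - s))) * (r powr (s * p) * (e / W z r))"
    proof (intro mult_right_mono mult_left_mono mult_mono)
      show "2 powr (s * p) \<le> 2 powr p" using s p_gt_1 by (intro powr_mono) auto
      have "1 * 1 \<le> (2 * p) * (2 * (1 - s))" using True p_gt_1 by (intro mult_mono) auto
      then show "1 \<le> 4 * p * (1 - s)" by (simp add: algebra_simps)
    qed (use L e Wp s p_gt_1 in auto)
    finally show ?thesis by (simp add: poincare_const_def L_def algebra_simps)
  next
    case False
    then have s2: "1 / 2 \<le> s" by simp
    \<comment> \<open>At scale 2r/2^j the energy gains a^j and the oscillation costs (2^j)^p; their quotient is b^j.\<close>
    define a where "a = 2 powr (s * p)"
    define b where "b = 2 powr (- (p * (1 - s)))"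
    have a1: "1 < a" using sp by (simp add: a_def)
    have b1: "0 < b" "b < 1"
      using p_gt_1 s powr_less_mono[of "- (p * (1 - s))" 0 2] by (auto simp: b_def)
    define Y where "Y = a / (a - 1) * (2 * r) powr (s * p) * e"
    have part: "J powr p * (\<Sum>j<M. b ^ j) \<le> L * (Y / W z r)" for M
    proof -
      have total: "(\<Sum>j<M. ennreal (a ^ j) * mu_energy_within (2 * r / 2 ^ j) ?B v) \<le> ennreal Y"
      proof -
        have "(\<Sum>j<M. ennreal (a ^ j) * mu_energy_within (2 * r / 2 ^ j) ?B v)
          \<le> ennreal (a / (a - 1) * (2 * r) powr (s * p)) * mu_energy s ?B v"
          unfolding a_def by (rule sum_mu_energy_within_le) (use r s in auto)
        also have "\<dots> \<le> ennreal (a / (a - 1) * (2 * r) powr (s * p)) * ennreal e"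
          by (intro mult_left_mono le) auto
        finally show ?thesis using a1 e by (simp add: Y_def ennreal_mult[symmetric])
      qed
      define f where "f j = enn2real (mu_energy_within (2 * r / 2 ^ j) ?B v)" for j :: nat
      have f0: "0 \<le> f j" for j by (simp add: f_def)
      have f: "mu_energy_within (2 * r / 2 ^ j) ?B v = ennreal (f j)" if "j < M" for j
      proof -
        have "ennreal (a ^ j) * mu_energy_within (2 * r / 2 ^ j) ?B v \<le> ennreal Y"
          using that by (intro order.trans[OF member_le_sum total]) auto
        then have "mu_energy_within (2 * r / 2 ^ j) ?B v \<noteq> \<infinity>"
          using a1 zero_less_power[of a j] by (auto simp: ennreal_mult_top top_unique not_le split: if_splits)
        then show ?thesis by (simp add: f_def less_top)
      qed
      have "(\<Sum>j<M. a ^ j * f j) \<le> Y"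
      proof -
        have "(\<Sum>j<M. ennreal (a ^ j) * mu_energy_within (2 * r / 2 ^ j) ?B v) = (\<Sum>j<M. ennreal (a ^ j * f j))"
          using a1 by (intro sum.cong) (auto simp: f ennreal_mult f0)
        also have "\<dots> = ennreal (\<Sum>j<M. a ^ j * f j)"
          using a1 by (intro sum_ennreal) (auto simp: f0)
        finally have "ennreal (\<Sum>j<M. a ^ j * f j) \<le> ennreal Y" using total by simp
        moreover have "0 \<le> Y" using a1 e r by (simp add: Y_def)
        ultimately show ?thesis by (simp add: ennreal_le_iff)
      qed
      moreover have "J powr p * b ^ j \<le> L / W z r * (a ^ j * f j)" if "j < M" for j
      proof -
        have "J powr p \<le> L * real (2 ^ j) powr p * (f j / W z r)"
          by (rule scale) (use f[OF that] f0 in auto)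
        then have "J powr p * b ^ j \<le> L * real (2 ^ j) powr p * (f j / W z r) * b ^ j"
          using b1 by (intro mult_right_mono) auto
        also have "real (2 ^ j) powr p = (2 powr p) ^ j"
          by (simp add: powr_realpow[symmetric] powr_powr mult.commute)
        also have "L * (2 powr p) ^ j * (f j / W z r) * b ^ j = L / W z r * ((2 powr p * b) ^ j * f j)"
          by (simp add: power_mult_distrib)
        also have "2 powr p * b = a"
          by (simp add: a_def b_def powr_add[symmetric] algebra_simps)
        finally show ?thesis .
      qed
      then have "J powr p * (\<Sum>j<M. b ^ j) \<le> L / W z r * (\<Sum>j<M. a ^ j * f j)"
        unfolding sum_distrib_left by (intro sum_mono) auto
      ultimately have "J powr p * (\<Sum>j<M. b ^ j) \<le> L / W z r * Y"
        using L Wp by (elim order.trans) (auto intro!: mult_left_mono divide_nonneg_pos simp del: times_divide_eq_left)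
      then show ?thesis by simp
    qed
    have "(\<lambda>M. J powr p * (\<Sum>j<M. b ^ j)) \<longlonglongrightarrow> J powr p * (1 / (1 - b))"
      using b1 geometric_sums[of b] unfolding sums_def by (intro tendsto_mult) auto
    then have "J powr p * (1 / (1 - b)) \<le> L * (Y / W z r)"
      by (rule LIMSEQ_le_const2) (use part in auto)
    then have "J powr p \<le> (1 - b) * (L * (Y / W z r))"
      using b1 by (simp add: field_simps)
    also have "\<dots> \<le> (p * (1 - s)) * (L * (Y / W z r))"
    proof (intro mult_right_mono)
      have "1 - p * (1 - s) * ln 2 \<le> exp (- (p * (1 - s) * ln 2))"
        using exp_ge_add_one_self[of "- (p * (1 - s) * ln 2)"] by simp
      also have "\<dots> = b" by (simp add: b_def powr_def)
      finally have "1 - b \<le> p * (1 - s) * ln 2" by simp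
      also have "\<dots> \<le> p * (1 - s) * 1"
        using ln_2_less_1 p_gt_1 s by (intro mult_left_mono) auto
      finally show "1 - b \<le> p * (1 - s)" by simp
    qed (use L Wp a1 e in \<open>auto simp: Y_def\<close>)
    also have "\<dots> \<le> (p * (1 - s)) * (L * (4 * (2 powr p * r powr (s * p)) * e / W z r))"
    proof (intro mult_left_mono divide_right_mono)
      have "sqrt 2 \<le> a"
      proof -
        have "sqrt 2 = 2 powr (1 / 2)" by (simp add: powr_half_sqrt)
        also have "\<dots> \<le> 2 powr (s * p)"
          using s2 p_gt_1 mult_mono[of "1/2" s 1 p] by (intro powr_mono) auto
        finally show ?thesis by (simp add: a_def)
      qed
      moreover have "4 / 3 \<le> sqrt 2" by (rule real_le_rsqrt) (simp add: power2_eq_square)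
      ultimately have "a / (a - 1) \<le> 4" using a1 by (simp add: field_simps)
      moreover have "(2 * r) powr (s * p) \<le> 2 powr p * r powr (s * p)"
        using r s p_gt_1 by (simp add: powr_mult mult_right_mono powr_mono)
      ultimately show "Y \<le> 4 * (2 powr p * r powr (s * p)) * e"
        unfolding Y_def using e by (intro mult_right_mono mult_mono) auto
    qed (use L Wp p_gt_1 s in auto)
    finally show ?thesis by (simp add: poincare_const_def L_def mult_ac)
  qed
  have "J = (J powr p) powr (1 / p)" using J p_gt_1 by (simp add: powr_powr)
  also have "\<dots> \<le> (poincare_const * (1 - s) * r powr (s * p) * (e / W z r)) powr (1 / p)"
    using main p_gt_1 by (intro powr_mono2) auto
  finally have "m\<^sup>2 * J \<le> m\<^sup>2 * (poincare_const * (1 - s) * r powr (s * p) * (e / W z r)) powr (1 / p)"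
    by (rule mult_left_mono) simp
  then show ?thesis unfolding J m_def[symmetric] by (rule ennreal_leI)
qed

end

section \<open>Geometric sums, averages and shrinking balls\<close>

lemma emeasure_UN_le_count_space:
  assumes [measurable]: "\<And>i. i \<in> C \<Longrightarrow> U i \<in> sets M" and C: "countable C"
  shows "emeasure M (\<Union>i\<in>C. U i) \<le> (\<integral>\<^sup>+i. emeasure M (U i) \<partial>count_space C)"
proof -
  have "emeasure M (\<Union>i\<in>C. U i) = (\<integral>\<^sup>+x. indicator (\<Union>i\<in>C. U i) x \<partial>M)"
    using C by (intro nn_integral_indicator[symmetric] sets.countable_UN'') auto
  also have "\<dots> \<le> (\<integral>\<^sup>+x. (\<integral>\<^sup>+i. indicator (U i) x \<partial>count_space C) \<partial>M)"
  proof (rule nn_integral_mono)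
    fix x
    show "indicator (\<Union>i\<in>C. U i) x \<le> (\<integral>\<^sup>+i. indicator (U i) x \<partial>count_space C)"
    proof (cases "\<exists>j\<in>C. x \<in> U j")
      case True
      then obtain j where j: "j \<in> C" "x \<in> U j" by auto
      show ?thesis using nn_integral_ge_point[OF j(1), of "\<lambda>i. indicator (U i) x"] j
        by (auto simp: indicator_def)
    qed auto
  qed
  also have "\<dots> = (\<integral>\<^sup>+i. (\<integral>\<^sup>+x. indicator (U i) x \<partial>M) \<partial>count_space C)"
    by (rule nn_integral_count_space_nn_integral) (use C in auto)
  also have "\<dots> = (\<integral>\<^sup>+i. emeasure M (U i) \<partial>count_space C)"
    by (intro nn_integral_cong) auto
  finally show ?thesis .
qed

lemma dyadic_tail_sum_le:
  fixes b :: real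
  assumes s: "0 < s" and R: "0 < R" and b: "b = 2 powr (- s)"
  shows "(\<Sum>j<M. b ^ j * (if R \<le> 2 ^ j then 1 else 0)) \<le> R powr (- s) / (1 - b)"
proof -
  have b1: "0 < b" "b < 1" using s powr_less_mono[of "- s" 0 2] by (auto simp: b)
  have "(\<Sum>j<M. b ^ j * (if R \<le> 2 ^ j then 1 else 0)) \<le> max 0 (R powr (- s) - b ^ M) / (1 - b)"
  proof (induction M)
    case (Suc M)
    show ?case
    proof (cases "R \<le> 2 ^ M")
      case True
      have "b ^ M = (2 ^ M) powr (- s)"
        by (simp add: b powr_realpow[symmetric] powr_powr mult.commute)
      also have "\<dots> \<le> R powr (- s)" using True s R by (intro powr_mono2') auto
      finally have "(\<Sum>j<Suc M. b ^ j * (if R \<le> 2 ^ j then 1 else 0)) \<le> (R powr (- s) - b ^ M) / (1 - b) + b ^ M"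
        using Suc.IH True by (simp add: max_def)
      also have "\<dots> = (R powr (- s) - b ^ Suc M) / (1 - b)"
        using b1 by (simp add: field_simps)
      also have "\<dots> \<le> max 0 (R powr (- s) - b ^ Suc M) / (1 - b)"
        using b1 by (intro divide_right_mono) auto
      finally show ?thesis .
    next
      case False
      then have "(\<Sum>j<Suc M. b ^ j * (if R \<le> 2 ^ j then 1 else 0)) \<le> max 0 (R powr (- s) - b ^ M) / (1 - b)"
        using Suc.IH by simp
      also have "\<dots> \<le> max 0 (R powr (- s) - b ^ Suc M) / (1 - b)"
        using b1 by (intro divide_right_mono max.mono diff_left_mono) (auto simp: mult_le_cancel_right1)
      finally show ?thesis .
    qed
  next
    case 0
    have "0 \<le> max 0 (R powr (- s) - b ^ 0) / (1 - b)" using b1 by (intro divide_nonneg_pos) auto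
    then show ?case by simp
  qed
  also have "\<dots> \<le> R powr (- s) / (1 - b)"
    using b1 by (intro divide_right_mono) auto
  finally show ?thesis .
qed

text \<open>
  Convexity of s \<mapsto> 2^(-s) on the unit interval.
\<close>

lemma one_minus_two_powr_ge:
  fixes s :: real
  assumes "0 < s" "s < 1"
  shows "s / 2 \<le> 1 - 2 powr (- s)"
proof -
  have "(1 / 2) powr s * 1 powr (1 - s) \<le> s * (1 / 2) + (1 - s) * 1"
    by (rule Youngs_inequality_0) (use assms in auto)
  then show ?thesis by (simp add: powr_minus powr_divide inverse_eq_divide)
qed

text \<open>
  The minimum changes branch at 2^k = x with x = (\<Lambda>/\<eta>)^(1/n). Below, the terms grow
  geometrically with ratio 2^(n-s) \<ge> 2; above, they decay with ratio 2^(-s), which is the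
  source of the factor 1/s. Both parts are of the size of the crossover term \<Lambda> x^(-s).
\<close>

lemma hedberg_sum_le:
  fixes \<Lambda> \<eta> s :: real
  assumes s: "0 < s" "s < 1" and n: "2 \<le> n" and pos: "0 < \<Lambda>" "0 < \<eta>"
  shows "(\<Sum>k<M. (2 powr (- s)) ^ k * min \<Lambda> ((2 ^ k) ^ n * \<eta>)) \<le> 4 / s * (\<Lambda> powr (1 - s / n) * \<eta> powr (s / n))"
proof -
  define x where "x = (\<Lambda> / \<eta>) powr (1 / n)"
  have x: "x > 0" using pos by (simp add: x_def)
  have xn: "x powr n = \<Lambda> / \<eta>" using pos n by (simp add: x_def powr_powr)
  define a where "a = 2 powr (n - s)"
  define b where "b = 2 powr (- s)"
  have b1: "0 < b" "b < 1" using s powr_less_mono[of "- s" 0 2] by (auto simp: b_def)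
  have a2: "2 \<le> a" using powr_mono[of 1 "n - s" 2] s n by (simp add: a_def)
  have ab: "b ^ k * (2 ^ k) ^ n = a ^ k" for k
    by (simp add: a_def b_def powr_realpow[symmetric] powr_powr powr_add[symmetric] algebra_simps)
  have "(\<Sum>k<M. b ^ k * min \<Lambda> ((2 ^ k) ^ n * \<eta>))
    \<le> (\<Sum>k<M. \<eta> * (a ^ k * (if 2 ^ k < x then 1 else 0)) + \<Lambda> * (b ^ k * (if x \<le> 2 ^ k then 1 else 0)))"
  proof (rule sum_mono)
    fix k
    have "b ^ k * min \<Lambda> ((2 ^ k) ^ n * \<eta>) \<le> b ^ k * ((2 ^ k) ^ n * \<eta>)"
      "b ^ k * min \<Lambda> ((2 ^ k) ^ n * \<eta>) \<le> b ^ k * \<Lambda>"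
      using b1 by (auto intro!: mult_left_mono)
    then show "b ^ k * min \<Lambda> ((2 ^ k) ^ n * \<eta>)
      \<le> \<eta> * (a ^ k * (if 2 ^ k < x then 1 else 0)) + \<Lambda> * (b ^ k * (if x \<le> 2 ^ k then 1 else 0))"
      using ab[of k] by (auto simp: mult_ac not_less)
  qed
  also have "\<dots> = \<eta> * (\<Sum>k<M. a ^ k * (if 2 ^ k < x then 1 else 0)) + \<Lambda> * (\<Sum>k<M. b ^ k * (if x \<le> 2 ^ k then 1 else 0))"
    by (simp add: sum.distrib sum_distrib_left)
  also have "\<dots> \<le> \<eta> * (a / (a - 1) * x powr (n - s)) + \<Lambda> * (x powr (- s) / (1 - b))"
    using pos s n x
    by (intro add_mono mult_left_mono dyadic_sum_le dyadic_tail_sum_le) (auto simp: a_def b_def)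
  also have "\<dots> \<le> \<eta> * (2 * x powr (n - s)) + \<Lambda> * (x powr (- s) * (2 / s))"
  proof (intro add_mono mult_left_mono mult_right_mono)
    show "a / (a - 1) \<le> 2" using a2 by (simp add: field_simps)
    have "s / 2 \<le> 1 - b" unfolding b_def by (rule one_minus_two_powr_ge[OF s])
    then have "1 / (1 - b) \<le> 2 / s" using s b1 by (simp add: field_simps)
    then have "x powr (- s) * (1 / (1 - b)) \<le> x powr (- s) * (2 / s)" by (rule mult_left_mono) simp
    then show "x powr (- s) / (1 - b) \<le> x powr (- s) * (2 / s)" by simp
  qed (use pos in auto)
  also have "\<eta> * (2 * x powr (n - s)) = 2 * (\<Lambda> * x powr (- s))"
  proof -
    have "x powr (n - s) = x powr n * x powr (- s)" by (simp add: powr_add[symmetric])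
    then show ?thesis using pos by (simp add: xn)
  qed
  also have "2 * (\<Lambda> * x powr (- s)) + \<Lambda> * (x powr (- s) * (2 / s)) \<le> 4 / s * (\<Lambda> * x powr (- s))"
  proof -
    have "(2 + 2 / s) * (\<Lambda> * x powr (- s)) \<le> 4 / s * (\<Lambda> * x powr (- s))"
      using s pos by (intro mult_right_mono) (auto simp: field_simps)
    then show ?thesis by (simp add: algebra_simps)
  qed
  also have "\<Lambda> * x powr (- s) = \<Lambda> powr (1 - s / n) * \<eta> powr (s / n)"
    using pos by (simp add: x_def powr_powr powr_divide powr_diff powr_minus field_simps)
  finally show ?thesis by (simp add: b_def)
qed

definition avg :: "('a::euclidean_space \<Rightarrow> real) \<Rightarrow> 'a \<Rightarrow> real \<Rightarrow> real" where
  "avg v z r = (LINT x:ball z r|lborel. v x) / measure lborel (ball z r)"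

lemma avg_minus_le:
  fixes v :: "'a::euclidean_space \<Rightarrow> real"
  assumes v: "set_integrable lborel (ball z r) v" and r: "0 < r"
  shows "ennreal (measure lborel (ball z r) * \<bar>avg v z r - c\<bar>) \<le> (\<integral>\<^sup>+x\<in>ball z r. ennreal \<bar>v x - c\<bar> \<partial>lborel)"
proof -
  let ?B = "ball z r"
  have m: "measure lborel ?B > 0" using r by simp
  have c: "set_integrable lborel ?B (\<lambda>_. c)"
    using emeasure_lborel_ball_finite[of z r] by (simp add: set_integrable_def)
  have "measure lborel ?B * (avg v z r - c) = (LINT x:?B|lborel. v x - c)"
    using m by (subst set_integral_diff(2)[OF v c]) (simp add: avg_def set_lebesgue_integral_def algebra_simps)
  then have "ennreal (measure lborel ?B * \<bar>avg v z r - c\<bar>) = ennreal (norm (LINT x:?B|lborel. v x - c))"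
    using m by (simp add: abs_mult flip: \<open>measure lborel ?B * (avg v z r - c) = _\<close>)
  also have "\<dots> \<le> (\<integral>\<^sup>+x. ennreal (norm (indicator ?B x *\<^sub>R (v x - c))) \<partial>lborel)"
    unfolding set_lebesgue_integral_def
    using set_integral_diff(1)[OF v c] by (intro integral_norm_bound_ennreal) (simp add: set_integrable_def)
  also have "\<dots> = (\<integral>\<^sup>+x\<in>?B. ennreal \<bar>v x - c\<bar> \<partial>lborel)"
    by (intro nn_integral_cong) (auto simp: indicator_def)
  finally show ?thesis .
qed

text \<open>
  Average v x - v y over y.
\<close>

lemma mean_deviation_le:
  fixes v :: "'a::euclidean_space \<Rightarrow> real"
  assumes v: "set_integrable lborel (ball z r) v" and r: "0 < r" and [measurable]: "v \<in> borel_measurable borel"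
    and o: "0 \<le> osc" "(\<integral>\<^sup>+x\<in>ball z r. (\<integral>\<^sup>+y\<in>ball z r. ennreal \<bar>v x - v y\<bar> \<partial>lborel) \<partial>lborel)
      \<le> ennreal ((measure lborel (ball z r))\<^sup>2 * osc)"
  shows "(\<integral>\<^sup>+x\<in>ball z r. ennreal \<bar>v x - avg v z r\<bar> \<partial>lborel) \<le> ennreal (measure lborel (ball z r) * osc)"
proof -
  let ?B = "ball z r"
  define m where "m = measure lborel ?B"
  have m: "m > 0" using r by (simp add: m_def)
  have [measurable]: "?B \<in> sets borel" by simp
  have "ennreal m * (\<integral>\<^sup>+x\<in>?B. ennreal \<bar>v x - avg v z r\<bar> \<partial>lborel)
     = (\<integral>\<^sup>+x. ennreal (m * \<bar>avg v z r - v x\<bar>) * indicator ?B x \<partial>lborel)"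
    using m by (subst nn_integral_cmult[symmetric]) (auto intro!: nn_integral_cong simp: ennreal_mult mult.assoc abs_minus_commute)
  also have "\<dots> \<le> (\<integral>\<^sup>+x\<in>?B. (\<integral>\<^sup>+y\<in>?B. ennreal \<bar>v y - v x\<bar> \<partial>lborel) \<partial>lborel)"
    unfolding m_def by (intro nn_integral_mono mult_right_mono avg_minus_le v r) auto
  also have "\<dots> = (\<integral>\<^sup>+x\<in>?B. (\<integral>\<^sup>+y\<in>?B. ennreal \<bar>v x - v y\<bar> \<partial>lborel) \<partial>lborel)"
    by (simp add: abs_minus_commute)
  also have "\<dots> \<le> ennreal m * ennreal (m * osc)"
    using o m by (simp add: m_def ennreal_mult[symmetric] power2_eq_square mult_ac)
  finally show ?thesis
    using m by (simp add: ennreal_mult_le_mult_iff m_def)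
qed

lemma avg_subball_le:
  fixes v :: "'a::euclidean_space \<Rightarrow> real"
  assumes v: "set_integrable lborel (ball z r) v" and r: "0 < r" "0 < r'" and [measurable]: "v \<in> borel_measurable borel"
    and o: "0 \<le> osc" "(\<integral>\<^sup>+x\<in>ball z r. (\<integral>\<^sup>+y\<in>ball z r. ennreal \<bar>v x - v y\<bar> \<partial>lborel) \<partial>lborel)
      \<le> ennreal ((measure lborel (ball z r))\<^sup>2 * osc)"
    and sub: "ball z' r' \<subseteq> ball z r"
  shows "\<bar>avg v z' r' - avg v z r\<bar> \<le> (r / r') ^ DIM('a) * osc"
proof -
  have "ennreal (measure lborel (ball z' r') * \<bar>avg v z' r' - avg v z r\<bar>)
     \<le> (\<integral>\<^sup>+x\<in>ball z' r'. ennreal \<bar>v x - avg v z r\<bar> \<partial>lborel)"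
    by (rule avg_minus_le[OF set_integrable_subset[OF v] r(2)]) (use sub in auto)
  also have "\<dots> \<le> (\<integral>\<^sup>+x\<in>ball z r. ennreal \<bar>v x - avg v z r\<bar> \<partial>lborel)"
    using sub by (intro nn_integral_mono) (auto simp: indicator_def)
  also have "\<dots> \<le> ennreal (measure lborel (ball z r) * osc)"
    by (rule mean_deviation_le) (use assms in auto)
  finally have *: "measure lborel (ball z' r') * \<bar>avg v z' r' - avg v z r\<bar> \<le> measure lborel (ball z r) * osc"
    using o by (subst (asm) ennreal_le_iff) auto
  have "measure lborel (ball z r) = (r / r') ^ DIM('a) * measure lborel (ball z' r')"
    using measure_ball_scale[of "r / r'" r' z z'] r by simp
  with * have "measure lborel (ball z' r') * \<bar>avg v z' r' - avg v z r\<bar> \<le> measure lborel (ball z' r') * ((r / r') ^ DIM('a) * osc)"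
    by (simp add: mult_ac)
  then show ?thesis using r by (simp add: mult_le_cancel_left del: measure_ball_pos)
qed

text \<open>
  The ball with this centre and radius r / 2^k is the image of ball z r under the homothety with
  centre x and ratio 2^(-k). For x in ball z r it stays in ball z r, unlike balls centred at x.
\<close>

definition shrink_center :: "'a::euclidean_space \<Rightarrow> 'a \<Rightarrow> nat \<Rightarrow> 'a" where
  "shrink_center z x k = x + (1 / 2 ^ k) *\<^sub>R (z - x)"

lemma shrink_ball_mem: "x \<in> ball z r \<Longrightarrow> x \<in> ball (shrink_center z x k) (r / 2 ^ k)"
  by (simp add: shrink_center_def dist_norm divide_strict_right_mono)

lemma shrink_ball_mono:
  assumes x: "x \<in> ball z r" and kl: "k \<le> l"
  shows "ball (shrink_center z x l) (r / 2 ^ l) \<subseteq> ball (shrink_center z x k) (r / 2 ^ k)"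
proof
  fix u assume u: "u \<in> ball (shrink_center z x l) (r / 2 ^ l)"
  define a b :: real where "a = 1 / 2 ^ k" and "b = 1 / 2 ^ l"
  have ab: "b \<le> a" "0 < b" using kl by (auto simp: a_def b_def frac_le)
  have "dist (shrink_center z x k) u \<le> dist (shrink_center z x k) (shrink_center z x l) + dist (shrink_center z x l) u"
    by (rule dist_triangle)
  also have "shrink_center z x k - shrink_center z x l = (a - b) *\<^sub>R (z - x)"
    by (simp add: shrink_center_def a_def b_def algebra_simps)
  then have "dist (shrink_center z x k) (shrink_center z x l) = (a - b) * dist z x"
    using ab by (simp add: dist_norm)
  also have "\<dots> \<le> (a - b) * r" using ab x by (intro mult_left_mono) auto
  also have "dist (shrink_center z x l) u < b * r" using u by (simp add: b_def)
  finally show "u \<in> ball (shrink_center z x k) (r / 2 ^ k)" by (simp add: a_def algebra_simps)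
qed

lemma shrink_center_0 [simp]: "shrink_center z x 0 = z"
  by (simp add: shrink_center_def)

section \<open>Pointwise estimate by a maximal function\<close>

context muckenhoupt_weight
begin

lemma mu_energy_mono_set: "S \<subseteq> T \<Longrightarrow> mu_energy s S v \<le> mu_energy s T v"
  unfolding mu_energy_def by (intro nn_integral_mono mult_mono) (auto simp: indicator_def)

text \<open>
  A Lebesgue point theorem for functions of finite energy, proved from the energy itself. At
  almost every x the inner integral G x is finite. On the k-th ball |x - y| < 2r/2^k, and the
  weight of the pair is at most a constant times the weight of that ball, so the p-th power mean
  of v - v x there is at most a constant times (2r/2^k)^(sp) G x, which tends to 0.
\<close>

lemma avg_shrink_tendsto:
  assumes [measurable]: "v \<in> borel_measurable borel" and v: "set_integrable lborel (ball z r) v"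
    and r: "0 < r" and s: "0 < s" and e: "mu_energy s (ball z r) v < \<infinity>"
  shows "AE x in lborel. x \<in> ball z r \<longrightarrow> (\<lambda>k. avg v (shrink_center z x k) (r / 2 ^ k)) \<longlonglongrightarrow> v x"
proof -
  let ?B = "ball z r" and ?n = "DIM('a)"
  have [measurable]: "?B \<in> sets borel" by simp
  define G where "G x = (\<integral>\<^sup>+y\<in>?B. ennreal (\<bar>v x - v y\<bar> powr p / norm (x - y) powr (s * p) / pair_weight x y) \<partial>\<mu>)" for x
  have [measurable]: "G \<in> borel_measurable borel" unfolding G_def by measurable
  have "AE x in \<mu>. G x * indicator ?B x \<noteq> \<infinity>"
    by (rule nn_integral_PInf_AE) (use e in \<open>auto simp: mu_energy_def G_def\<close>)
  then have "AE x in lborel. G x * indicator ?B x \<noteq> \<infinity>" by (simp add: AE_mu)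
  then show ?thesis
  proof (rule eventually_mono, intro impI)
    fix x assume fin: "G x * indicator ?B x \<noteq> \<infinity>" and x: "x \<in> ?B"
    define g where "g = enn2real (G x)"
    have g: "G x = ennreal g" "0 \<le> g" using fin x by (auto simp: g_def less_top)
    define d where "d k = 2 * r / 2 ^ k" for k :: nat
    have d: "d k > 0" for k using r by (simp add: d_def)
    have bound: "\<bar>avg v (shrink_center z x k) (r / 2 ^ k) - v x\<bar>
      \<le> A powr (1 / p) * (A * 2 powr (?n * p) * g * d k powr (s * p)) powr (1 / p)" for k
    proof -
      define c \<rho> where "c = shrink_center z x k" and "\<rho> = r / 2 ^ k"
      have \<rho>: "\<rho> > 0" "d k = 2 * \<rho>" using r by (auto simp: \<rho>_def d_def)
      have xB: "x \<in> ball c \<rho>" unfolding c_def \<rho>_def by (rule shrink_ball_mem[OF x])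
      have sub: "ball c \<rho> \<subseteq> ?B" using shrink_ball_mono[OF x, of 0 k] by (simp add: c_def \<rho>_def)
      have sub2: "ball c \<rho> \<subseteq> ball x (d k)"
      proof
        fix u assume "u \<in> ball c \<rho>"
        with xB show "u \<in> ball x (d k)" using dist_triangle[of x u c] by (simp add: \<rho> dist_commute)
      qed
      have Wc: "W c \<rho> > 0" using \<rho> by (simp add: W_pos)
      have Wd: "W x (d k) \<le> A * 2 powr (?n * p) * W c \<rho>"
        using W_growth[OF sub2 d \<rho>(1)] \<rho> by simp
      have "(\<integral>\<^sup>+y\<in>ball c \<rho>. ennreal (\<bar>v y - v x\<bar> powr p) \<partial>\<mu>)
         \<le> (\<integral>\<^sup>+y. ennreal (d k powr (s * p) * W x (d k)) *
           (ennreal (\<bar>v x - v y\<bar> powr p / norm (x - y) powr (s * p) / pair_weight x y) * indicator ?B y) \<partial>\<mu>)"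
      proof (rule nn_integral_mono)
        fix y
        show "ennreal (\<bar>v y - v x\<bar> powr p) * indicator (ball c \<rho>) y \<le> ennreal (d k powr (s * p) * W x (d k)) *
           (ennreal (\<bar>v x - v y\<bar> powr p / norm (x - y) powr (s * p) / pair_weight x y) * indicator ?B y)"
        proof (cases "y \<in> ball c \<rho> \<and> y \<noteq> x")
          case True
          then have y: "y \<in> ?B" "dist x y < d k" using sub sub2 by auto
          have P: "0 < pair_weight x y" "pair_weight x y \<le> W x (d k)"
            using True y pair_weight_pos[of x y] pair_weight_le[of x y "d k"] by auto
          have N: "norm (x - y) powr (s * p) \<le> d k powr (s * p)" "0 < norm (x - y) powr (s * p)"
            using True y s p_gt_1 by (auto simp: dist_norm intro!: powr_mono2)
          have "norm (x - y) powr (s * p) * pair_weight x y \<le> d k powr (s * p) * W x (d k)"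
            using P N by (intro mult_mono) auto
          then have "\<bar>v y - v x\<bar> powr p * 1 \<le> \<bar>v y - v x\<bar> powr p * ((d k powr (s * p) * W x (d k)) / (norm (x - y) powr (s * p) * pair_weight x y))"
            using P N by (intro mult_left_mono) (auto simp: divide_simps)
          then show ?thesis using True y
            by (simp add: ennreal_mult[symmetric] abs_minus_commute ennreal_leI mult_ac)
        qed (auto simp: indicator_def)
      qed
      also have "\<dots> = ennreal (d k powr (s * p) * W x (d k)) * G x"
        unfolding G_def by (rule nn_integral_cmult) measurable
      also have "\<dots> = ennreal (d k powr (s * p) * W x (d k) * g)"
        using g by (simp add: ennreal_mult)
      finally have up: "(\<integral>\<^sup>+y\<in>ball c \<rho>. ennreal \<bar>v y - v x\<bar> \<partial>lborel)
        \<le> ennreal (A powr (1 / p) * measure lborel (ball c \<rho>) * (d k powr (s * p) * W x (d k) * g / W c \<rho>) powr (1 / p))"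
        by (intro Ap_mean) (use \<rho> g in auto)
      have lo: "ennreal (measure lborel (ball c \<rho>) * \<bar>avg v c \<rho> - v x\<bar>) \<le> (\<integral>\<^sup>+y\<in>ball c \<rho>. ennreal \<bar>v y - v x\<bar> \<partial>lborel)"
        by (rule avg_minus_le[OF set_integrable_subset[OF v] \<rho>(1)]) (use sub in auto)
      from order.trans[OF lo up] have "measure lborel (ball c \<rho>) * \<bar>avg v c \<rho> - v x\<bar>
        \<le> A powr (1 / p) * measure lborel (ball c \<rho>) * (d k powr (s * p) * W x (d k) * g / W c \<rho>) powr (1 / p)"
        by (subst (asm) ennreal_le_iff) auto
      then have "measure lborel (ball c \<rho>) * \<bar>avg v c \<rho> - v x\<bar>
        \<le> measure lborel (ball c \<rho>) * (A powr (1 / p) * (d k powr (s * p) * W x (d k) * g / W c \<rho>) powr (1 / p))"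
        by (simp add: mult_ac)
      then have "\<bar>avg v c \<rho> - v x\<bar> \<le> A powr (1 / p) * (d k powr (s * p) * W x (d k) * g / W c \<rho>) powr (1 / p)"
        using \<rho> by (simp add: mult_le_cancel_left)
      also have "\<dots> \<le> A powr (1 / p) * (A * 2 powr (?n * p) * g * d k powr (s * p)) powr (1 / p)"
      proof (intro mult_left_mono powr_mono2)
        have "W x (d k) / W c \<rho> \<le> A * 2 powr (?n * p)" using Wd Wc by (simp add: divide_simps)
        then have "(W x (d k) / W c \<rho>) * (g * d k powr (s * p)) \<le> A * 2 powr (?n * p) * (g * d k powr (s * p))"
          using g by (intro mult_right_mono) auto
        then show "d k powr (s * p) * W x (d k) * g / W c \<rho> \<le> A * 2 powr (?n * p) * g * d k powr (s * p)"
          by (simp add: mult_ac)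
      qed (use p_gt_1 g Wc in auto)
      finally show ?thesis by (simp add: c_def \<rho>_def)
    qed
    have d0: "d \<longlonglongrightarrow> 0"
    proof -
      have "(\<lambda>k. 2 * r * (1 / 2) ^ k) \<longlonglongrightarrow> 2 * r * 0"
        by (intro tendsto_mult LIMSEQ_power_zero) auto
      then show ?thesis by (simp add: d_def[abs_def] power_divide)
    qed
    have "(\<lambda>k. d k powr (s * p)) \<longlonglongrightarrow> 0 powr (s * p)"
      using s p_gt_1 d d0 by (intro tendsto_powr') (auto intro!: always_eventually less_imp_le)
    from tendsto_mult[OF tendsto_const this]
    have "(\<lambda>k. A * 2 powr (?n * p) * g * d k powr (s * p)) \<longlonglongrightarrow> A * 2 powr (?n * p) * g * 0 powr (s * p)" .
    then have "(\<lambda>k. (A * 2 powr (?n * p) * g * d k powr (s * p)) powr (1 / p))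
       \<longlonglongrightarrow> (A * 2 powr (?n * p) * g * 0 powr (s * p)) powr (1 / p)"
      by (rule tendsto_powr'[OF _ tendsto_const]) (use p_gt_1 g A_ge_1 in \<open>auto intro!: always_eventually\<close>)
    from tendsto_mult[OF tendsto_const[of "A powr (1 / p)"] this] have "(\<lambda>k. A powr (1 / p) * (A * 2 powr (?n * p) * g * d k powr (s * p)) powr (1 / p)) \<longlonglongrightarrow> 0"
      using p_gt_1 by simp
    then have "(\<lambda>k. avg v (shrink_center z x k) (r / 2 ^ k) - v x) \<longlonglongrightarrow> 0"
      by (rule Lim_null_comparison[rotated]) (use bound in \<open>auto intro!: always_eventually\<close>)
    then show "(\<lambda>k. avg v (shrink_center z x k) (r / 2 ^ k)) \<longlonglongrightarrow> v x"
      by (simp add: LIM_zero_iff)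
  qed
qed

text \<open>
  The factor in front of \<lambda>^(1/q) in the pointwise estimate when the energy of the ball is
  at most \<epsilon> times its weight.
\<close>

definition hedberg_const :: "real \<Rightarrow> real \<Rightarrow> real \<Rightarrow> real" where
  "hedberg_const s r \<epsilon> = 2 ^ DIM('a) * (poincare_const * (1 - s)) powr (1 / p) * r powr s * (4 / s)
     * (A * \<epsilon>) powr (s / (DIM('a) * p))"

lemma poincare_const_pos: "0 < poincare_const"
  using A_ge_1 p_gt_1 by (simp add: poincare_const_def)

text \<open>
  Telescoping over the shrinking balls bounds v x - avg v z r by the sum of their oscillations. By
  the Poincare inequality the k-th one is at most a constant times 2^(-ks) times the p-th root of
  the energy of the k-th ball divided by its weight, and this quotient is at most lam by
  assumption and at most A 2^(knp) \<epsilon> by monotonicity of the energy and the growth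
  estimate. The sum is that of hedberg_sum_le.
\<close>

lemma pointwise_bound:
  fixes s r \<epsilon> lam :: real
  assumes n: "2 \<le> DIM('a)" and [measurable]: "v \<in> borel_measurable borel" and v: "set_integrable lborel (ball z r) v"
    and r: "0 < r" and s: "0 < s" "s < 1" and \<epsilon>: "0 < \<epsilon>" and lam: "0 < lam"
    and e: "mu_energy s (ball z r) v \<le> ennreal (\<epsilon> * W z r)"
    and x: "x \<in> ball z r" and lim: "(\<lambda>k. avg v (shrink_center z x k) (r / 2 ^ k)) \<longlonglongrightarrow> v x"
    and M: "\<And>k. mu_energy s (ball (shrink_center z x k) (r / 2 ^ k)) v \<le> ennreal (lam * W (shrink_center z x k) (r / 2 ^ k))"
  shows "\<bar>v x - avg v z r\<bar> \<le> hedberg_const s r \<epsilon> * lam powr ((DIM('a) - s) / (DIM('a) * p))"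
proof -
  let ?n = "DIM('a)"
  define c where "c = shrink_center z x"
  define \<rho> where "\<rho> k = r / 2 ^ k" for k :: nat
  define Q where "Q = poincare_const * (1 - s)"
  have Q: "Q > 0" using poincare_const_pos s by (simp add: Q_def)
  have \<rho>: "\<rho> k > 0" for k using r by (simp add: \<rho>_def)
  have Wk: "W (c k) (\<rho> k) > 0" for k using \<rho> by (simp add: W_pos)
  have Wz: "W z r > 0" using r by (simp add: W_pos)
  have sub: "ball (c k) (\<rho> k) \<subseteq> ball z r" for k
    using shrink_ball_mono[OF x, of 0 k] by (simp add: c_def \<rho>_def)
  have int: "set_integrable lborel (ball (c k) (\<rho> k)) v" for k
    by (rule set_integrable_subset[OF v]) (use sub in auto)
  define \<Lambda> \<eta> where "\<Lambda> = lam powr (1 / p)" and "\<eta> = (A * \<epsilon>) powr (1 / p)"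
  have pos: "\<Lambda> > 0" "\<eta> > 0" using lam \<epsilon> A_ge_1 by (auto simp: \<Lambda>_def \<eta>_def)
  define T where "T k = Q powr (1 / p) * r powr s * ((2 powr (- s)) ^ k * min \<Lambda> ((2 ^ k) ^ ?n * \<eta>))" for k
  have T0: "T k \<ge> 0" for k using pos by (simp add: T_def)
  have osc: "(\<integral>\<^sup>+x\<in>ball (c k) (\<rho> k). (\<integral>\<^sup>+y\<in>ball (c k) (\<rho> k). ennreal \<bar>v x - v y\<bar> \<partial>lborel) \<partial>lborel)
      \<le> ennreal ((measure lborel (ball (c k) (\<rho> k)))\<^sup>2 * T k)" for k
  proof -
    define ek where "ek = min (lam * W (c k) (\<rho> k)) (\<epsilon> * W z r)"
    have ek: "ek \<ge> 0" using lam \<epsilon> by (simp add: ek_def)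
    have "mu_energy s (ball (c k) (\<rho> k)) v \<le> ennreal (\<epsilon> * W z r)"
      using mu_energy_mono_set[OF sub] e by (rule order.trans)
    then have "mu_energy s (ball (c k) (\<rho> k)) v \<le> ennreal ek"
      using M[of k] by (simp add: ek_def c_def \<rho>_def min_def)
    then have "(\<integral>\<^sup>+x\<in>ball (c k) (\<rho> k). (\<integral>\<^sup>+y\<in>ball (c k) (\<rho> k). ennreal \<bar>v x - v y\<bar> \<partial>lborel) \<partial>lborel)
      \<le> ennreal ((measure lborel (ball (c k) (\<rho> k)))\<^sup>2 * (poincare_const * (1 - s) * \<rho> k powr (s * p) * (ek / W (c k) (\<rho> k))) powr (1 / p))"
      by (intro fractional_poincare) (use \<rho> s ek in auto)
    also have "\<dots> \<le> ennreal ((measure lborel (ball (c k) (\<rho> k)))\<^sup>2 * T k)"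
    proof (intro ennreal_leI mult_left_mono)
      have g: "W z r / W (c k) (\<rho> k) \<le> A * 2 powr (k * (?n * p))"
        using W_growth[OF sub r \<rho>, of k] r Wk[of k]
        by (simp add: \<rho>_def divide_simps powr_realpow[symmetric] powr_powr)
      have "ek / W (c k) (\<rho> k) \<le> min lam (A * 2 powr (k * (?n * p)) * \<epsilon>)"
      proof -
        have "ek / W (c k) (\<rho> k) \<le> lam" using Wk[of k] by (simp add: ek_def divide_simps)
        moreover have "ek / W (c k) (\<rho> k) \<le> \<epsilon> * (W z r / W (c k) (\<rho> k))"
          using Wk[of k] by (simp add: ek_def divide_right_mono)
        moreover have "\<dots> \<le> \<epsilon> * (A * 2 powr (k * (?n * p)))"
          by (rule mult_left_mono[OF g]) (use \<epsilon> in simp)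
        ultimately show ?thesis by (simp add: mult_ac)
      qed
      then have "(Q * \<rho> k powr (s * p) * (ek / W (c k) (\<rho> k))) powr (1 / p)
        \<le> (Q * \<rho> k powr (s * p) * min lam (A * 2 powr (k * (?n * p)) * \<epsilon>)) powr (1 / p)"
        using Q ek Wk[of k] p_gt_1 by (intro powr_mono2 mult_left_mono) auto
      also have "\<dots> = Q powr (1 / p) * \<rho> k powr s * (min lam (A * 2 powr (k * (?n * p)) * \<epsilon>)) powr (1 / p)"
        using Q p_gt_1 \<epsilon> lam A_ge_1 by (simp add: powr_mult powr_powr)
      also have "\<rho> k powr s = r powr s * (2 powr (- s)) ^ k"
        using r by (simp add: \<rho>_def powr_divide powr_realpow[symmetric] powr_powr powr_minus divide_simps mult_ac)
      also have "Q powr (1 / p) * (r powr s * (2 powr (- s)) ^ k) * (min lam (A * 2 powr (k * (?n * p)) * \<epsilon>)) powr (1 / p)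
        \<le> Q powr (1 / p) * (r powr s * (2 powr (- s)) ^ k) * min \<Lambda> ((2 ^ k) ^ ?n * \<eta>)"
      proof (rule mult_left_mono)
        have "(A * 2 powr (k * (?n * p)) * \<epsilon>) powr (1 / p) = (2 ^ k) ^ ?n * \<eta>"
          using p_gt_1 \<epsilon> A_ge_1 by (simp add: \<eta>_def powr_mult powr_powr powr_realpow[symmetric])
        moreover have "(min lam (A * 2 powr (k * (?n * p)) * \<epsilon>)) powr (1 / p) \<le> (A * 2 powr (k * (?n * p)) * \<epsilon>) powr (1 / p)"
          "(min lam (A * 2 powr (k * (?n * p)) * \<epsilon>)) powr (1 / p) \<le> lam powr (1 / p)"
          using p_gt_1 \<epsilon> A_ge_1 lam by (auto intro!: powr_mono2)
        ultimately show "(min lam (A * 2 powr (k * (?n * p)) * \<epsilon>)) powr (1 / p) \<le> min \<Lambda> ((2 ^ k) ^ ?n * \<eta>)"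
          by (simp add: \<Lambda>_def)
      qed simp
      finally show "(poincare_const * (1 - s) * \<rho> k powr (s * p) * (ek / W (c k) (\<rho> k))) powr (1 / p) \<le> T k"
        by (simp add: Q_def T_def mult_ac)
    qed auto
    finally show ?thesis .
  qed
  have step: "\<bar>avg v (c (Suc k)) (\<rho> (Suc k)) - avg v (c k) (\<rho> k)\<bar> \<le> 2 ^ ?n * T k" for k
  proof -
    have sub': "ball (c (Suc k)) (\<rho> (Suc k)) \<subseteq> ball (c k) (\<rho> k)"
      using shrink_ball_mono[OF x, of k "Suc k"] by (simp add: c_def \<rho>_def)
    have "\<bar>avg v (c (Suc k)) (\<rho> (Suc k)) - avg v (c k) (\<rho> k)\<bar> \<le> (\<rho> k / \<rho> (Suc k)) ^ ?n * T k"
      by (rule avg_subball_le[OF int \<rho> \<rho> assms(2) T0 osc sub'])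
    also have "\<rho> k / \<rho> (Suc k) = 2" using r by (simp add: \<rho>_def)
    finally show ?thesis .
  qed
  define R where "R = 2 ^ ?n * (Q powr (1 / p) * r powr s * (4 / s * (\<Lambda> powr (1 - s / ?n) * \<eta> powr (s / ?n))))"
  have partial: "\<bar>avg v (c m) (\<rho> m) - avg v z r\<bar> \<le> R" for m
  proof -
    have "\<bar>avg v (c m) (\<rho> m) - avg v z r\<bar> = \<bar>\<Sum>k<m. avg v (c (Suc k)) (\<rho> (Suc k)) - avg v (c k) (\<rho> k)\<bar>"
      by (subst sum_lessThan_telescope) (simp add: c_def \<rho>_def)
    also have "\<dots> \<le> (\<Sum>k<m. 2 ^ ?n * T k)"
      by (intro order.trans[OF sum_abs] sum_mono step)
    also have "\<dots> = 2 ^ ?n * (Q powr (1 / p) * r powr s * (\<Sum>k<m. (2 powr (- s)) ^ k * min \<Lambda> ((2 ^ k) ^ ?n * \<eta>)))"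
      by (simp add: T_def sum_distrib_left)
    also have "\<dots> \<le> R"
      unfolding R_def by (intro mult_left_mono hedberg_sum_le) (use s n pos in auto)
    finally show ?thesis .
  qed
  have "(\<lambda>k. \<bar>avg v (c k) (\<rho> k) - avg v z r\<bar>) \<longlonglongrightarrow> \<bar>v x - avg v z r\<bar>"
    using lim by (intro tendsto_intros) (simp add: c_def \<rho>_def)
  then have "\<bar>v x - avg v z r\<bar> \<le> R"
    by (rule LIMSEQ_le_const2) (use partial in auto)
  also have "R = hedberg_const s r \<epsilon> * lam powr ((?n - s) / (?n * p))"
  proof -
    have "\<Lambda> powr (1 - s / ?n) = lam powr ((?n - s) / (?n * p))"
      using p_gt_1 n by (simp add: \<Lambda>_def powr_powr field_simps)
    moreover have "\<eta> powr (s / ?n) = (A * \<epsilon>) powr (s / (?n * p))"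
      by (simp add: \<eta>_def powr_powr mult.commute)
    ultimately show ?thesis by (simp add: R_def hedberg_const_def Q_def mult_ac)
  qed
  finally show ?thesis .
qed

end

section \<open>Weak type estimate\<close>

context muckenhoupt_weight
begin

text \<open>
  A Vitali subfamily is disjoint, so the energies of its members add up to at most the energy of
  the whole ball. By doubling, its fivefold enlargements have weight at most a constant times the
  weights of the members, which are at most their energies divided by lam. The enlargements form
  the set U, a measurable substitute for S.
\<close>

lemma maximal_weak_type:
  fixes lam e s r :: real
  assumes [measurable]: "v \<in> borel_measurable borel" and lam: "0 < lam" and r: "0 < r" and e: "0 \<le> e"
    and mu_energy: "mu_energy s (ball z r) v \<le> ennreal e"
    and S: "S \<subseteq> ball z r"
    and bad: "\<And>x. x \<in> S \<Longrightarrow> \<exists>c \<rho>. 0 < \<rho> \<and> \<rho> \<le> r \<and> x \<in> ball c \<rho> \<and> ball c \<rho> \<subseteq> ball z r \<and>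
       ennreal (lam * W c \<rho>) \<le> mu_energy s (ball c \<rho>) v"
  obtains U where "U \<in> sets borel" "S \<subseteq> U" "emeasure \<mu> U \<le> ennreal (A * 5 powr (DIM('a) * p) * e / lam)"
proof -
  let ?n = "DIM('a)"
  have [measurable]: "ball z r \<in> sets borel" by simp
  obtain c \<rho> where c: "\<And>x. x \<in> S \<Longrightarrow> 0 < \<rho> x \<and> \<rho> x \<le> r \<and> x \<in> ball (c x) (\<rho> x) \<and> ball (c x) (\<rho> x) \<subseteq> ball z r \<and>
       ennreal (lam * W (c x) (\<rho> x)) \<le> mu_energy s (ball (c x) (\<rho> x)) v"
    using bad by metis
  obtain C where C: "countable C" "C \<subseteq> S"
     "pairwise (\<lambda>i j. disjnt (ball (c i) (\<rho> i)) (ball (c j) (\<rho> j))) C"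
     "S \<subseteq> (\<Union>i\<in>C. ball (c i) (5 * \<rho> i))"
    by (rule Vitali_covering_lemma_balls[where S = S and K = S and a = c and r = \<rho> and B = r]) (use c in blast)+
  define g where "g x = (\<integral>\<^sup>+y\<in>ball z r. ennreal (\<bar>v x - v y\<bar> powr p / norm (x - y) powr (s * p) / pair_weight x y) \<partial>\<mu>)" for x
  have [measurable]: "g \<in> borel_measurable borel" unfolding g_def by measurable
  define \<nu> where "\<nu> = density \<mu> g"
  have nu_sets [simp]: "sets \<nu> = sets borel" by (simp add: \<nu>_def)
  have nu: "emeasure \<nu> B = (\<integral>\<^sup>+x\<in>B. g x \<partial>\<mu>)" if "B \<in> sets borel" for B
    unfolding \<nu>_def by (rule emeasure_density) (use that in auto)
  define K where "K = A * 5 powr (?n * p) / lam"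
  have K: "K \<ge> 0" using A_ge_1 lam by (simp add: K_def)
  have each: "emeasure \<mu> (ball (c i) (5 * \<rho> i)) \<le> ennreal K * emeasure \<nu> (ball (c i) (\<rho> i))" if i: "i \<in> C" for i
  proof -
    from i C c have ci: "0 < \<rho> i" "ball (c i) (\<rho> i) \<subseteq> ball z r"
      "ennreal (lam * W (c i) (\<rho> i)) \<le> mu_energy s (ball (c i) (\<rho> i)) v" by auto
    have "ball (c i) (\<rho> i) \<subseteq> ball (c i) (5 * \<rho> i)" using ci by (intro subset_ball) auto
    from W_growth[OF this] ci have "W (c i) (5 * \<rho> i) \<le> A * 5 powr (?n * p) * W (c i) (\<rho> i)" by simp
    also have "\<dots> = K * (lam * W (c i) (\<rho> i))" using lam by (simp add: K_def)
    finally have "emeasure \<mu> (ball (c i) (5 * \<rho> i)) \<le> ennreal K * ennreal (lam * W (c i) (\<rho> i))"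
      using K lam by (simp add: emeasure_mu_ball ennreal_mult[symmetric])
    also have "\<dots> \<le> ennreal K * mu_energy s (ball (c i) (\<rho> i)) v"
      by (intro mult_left_mono ci) auto
    also have "mu_energy s (ball (c i) (\<rho> i)) v \<le> emeasure \<nu> (ball (c i) (\<rho> i))"
      unfolding mu_energy_def nu[OF borel_open[OF open_ball]] g_def using ci(2)
      by (intro nn_integral_mono mult_mono) (auto simp: indicator_def)
    finally show ?thesis by (simp add: mult_left_mono)
  qed
  show ?thesis
  proof
    show "(\<Union>i\<in>C. ball (c i) (5 * \<rho> i)) \<in> sets borel" by (intro borel_open open_UN ballI open_ball)
    show "S \<subseteq> (\<Union>i\<in>C. ball (c i) (5 * \<rho> i))" by fact
    have "emeasure \<mu> (\<Union>i\<in>C. ball (c i) (5 * \<rho> i)) \<le> (\<integral>\<^sup>+i. emeasure \<mu> (ball (c i) (5 * \<rho> i)) \<partial>count_space C)"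
      by (rule emeasure_UN_le_count_space) (use C in auto)
    also have "\<dots> \<le> (\<integral>\<^sup>+i. ennreal K * emeasure \<nu> (ball (c i) (\<rho> i)) \<partial>count_space C)"
      by (intro nn_integral_mono each) auto
    also have "\<dots> = ennreal K * (\<integral>\<^sup>+i. emeasure \<nu> (ball (c i) (\<rho> i)) \<partial>count_space C)"
      by (rule nn_integral_cmult) auto
    also have "(\<integral>\<^sup>+i. emeasure \<nu> (ball (c i) (\<rho> i)) \<partial>count_space C) = emeasure \<nu> (\<Union>i\<in>C. ball (c i) (\<rho> i))"
      by (rule emeasure_UN_countable[symmetric])
         (use C in \<open>auto simp: disjoint_family_on_def pairwise_def disjnt_def\<close>)
    also have "\<dots> \<le> emeasure \<nu> (ball z r)"
      using c C(2) by (intro emeasure_mono) auto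
    also have "\<dots> = mu_energy s (ball z r) v" by (simp add: nu mu_energy_def g_def)
    also have "\<dots> \<le> ennreal e" by (rule mu_energy)
    finally have "emeasure \<mu> (\<Union>i\<in>C. ball (c i) (5 * \<rho> i)) \<le> ennreal K * ennreal e"
      by (simp add: mult_left_mono)
    also have "\<dots> = ennreal (A * 5 powr (?n * p) * e / lam)"
      using K e by (simp add: ennreal_mult[symmetric] K_def)
    finally show "emeasure \<mu> (\<Union>i\<in>C. ball (c i) (5 * \<rho> i)) \<le> ennreal (A * 5 powr (?n * p) * e / lam)" .
  qed
qed

definition level_const :: real where
  "level_const = 5 powr (DIM('a) * p) * A\<^sup>2 * 2 powr ((DIM('a) + 2) * (2 * p))"

text \<open>
  The scale invariant quantity, linear in \<epsilon>, in terms of which the weak and strong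
  estimates read alike on all balls. Its factor s^(-p) is the p-th power of the 1/s from the sum
  over the shrinking balls.
\<close>

definition scaled_energy :: "real \<Rightarrow> real \<Rightarrow> real \<Rightarrow> real" where
  "scaled_energy s r \<epsilon> = poincare_const * (1 - s) * s powr (- p) * r powr (s * p) * \<epsilon>"

text \<open>
  The pointwise estimate is applied with the value lam = (t/H)^q for which its right-hand side is
  exactly t. Outside a null set, |v x - avg v z r| > t then forces one of the shrinking balls of x
  to have energy above lam times its weight.
\<close>

lemma weak_type_pos:
  fixes s r \<epsilon> t :: real
  assumes n: "2 \<le> DIM('a)" and [measurable]: "v \<in> borel_measurable borel" and v: "set_integrable lborel (ball z r) v"
    and r: "0 < r" and s: "0 < s" "s < 1" and \<epsilon>: "0 < \<epsilon>" and t: "0 < t"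
    and e: "mu_energy s (ball z r) v \<le> ennreal (\<epsilon> * W z r)"
  shows "emeasure \<mu> {x \<in> ball z r. t < \<bar>v x - avg v z r\<bar>}
    \<le> ennreal (level_const * scaled_energy s r \<epsilon> powr (DIM('a) / (DIM('a) - s)) * W z r
        / t powr (DIM('a) * p / (DIM('a) - s)))"
proof -
  define n where "n = real DIM('a)"
  have n2: "n \<ge> 2" using n by (simp add: n_def)
  define q where "q = n * p / (n - s)"
  define \<kappa> where "\<kappa> = n / (n - s)"
  have ns: "n - s > 0" using n2 s by simp
  have k1: "\<kappa> = 1 + s / (n - s)" using ns by (simp add: \<kappa>_def field_simps)
  have k2: "1 \<le> \<kappa>" "\<kappa> \<le> 2" using n2 s ns by (auto simp: \<kappa>_def field_simps)
  have q1: "q = p * \<kappa>" by (simp add: q_def \<kappa>_def)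
  have q: "q = p * \<kappa>" "q > 0" "q \<le> 2 * p"
    unfolding q1 using p_gt_1 k2 mult_left_mono[of \<kappa> 2 p] by auto
  define H where "H = hedberg_const s r \<epsilon>"
  have H: "H > 0" using s r \<epsilon> poincare_const_pos A_ge_1 by (simp add: H_def hedberg_const_def)
  \<comment> \<open>The level at which the pointwise bound H lam^(1/q) equals t.\<close>
  define lam where "lam = (t / H) powr q"
  have lam: "lam > 0" using t H by (simp add: lam_def)
  have Wz: "W z r > 0" using r by (simp add: W_pos)
  have lamH: "H * lam powr ((n - s) / (n * p)) = t"
    using t H n2 ns p_gt_1 by (simp add: lam_def powr_powr q_def)
  have fin: "mu_energy s (ball z r) v < \<infinity>" using e ennreal_less_top le_less_trans by fastforce
  define good where "good x \<longleftrightarrow> (x \<in> ball z r \<longrightarrow> (\<lambda>k. avg v (shrink_center z x k) (r / 2 ^ k)) \<longlonglongrightarrow> v x)" for x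
  have "AE x in \<mu>. good x"
    unfolding AE_mu good_def by (rule avg_shrink_tendsto) (use v r s fin in auto)
  then obtain N where N: "N \<in> null_sets \<mu>" "{x. \<not> good x} \<subseteq> N"
    by (auto elim!: AE_E simp: null_sets_def)
  define S where "S = {x \<in> ball z r. good x \<and> t < \<bar>v x - avg v z r\<bar>}"
  obtain U where U: "U \<in> sets borel" "S \<subseteq> U" "emeasure \<mu> U \<le> ennreal (A * 5 powr (n * p) * (\<epsilon> * W z r) / lam)"
    unfolding n_def
  proof (rule maximal_weak_type[OF assms(2) lam r _ e])
    fix x assume x: "x \<in> S"
    show "\<exists>c \<rho>. 0 < \<rho> \<and> \<rho> \<le> r \<and> x \<in> ball c \<rho> \<and> ball c \<rho> \<subseteq> ball z r \<and>
       ennreal (lam * W c \<rho>) \<le> mu_energy s (ball c \<rho>) v"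
    proof (rule ccontr)
      assume neg: "\<not> ?thesis"
      have xB: "x \<in> ball z r" using x by (simp add: S_def)
      have "mu_energy s (ball (shrink_center z x k) (r / 2 ^ k)) v \<le> ennreal (lam * W (shrink_center z x k) (r / 2 ^ k))" for k
      proof (rule ccontr)
        assume *: "\<not> ?thesis"
        have "r / 2 ^ k \<le> r / 1" using r by (intro divide_left_mono) auto
        with * neg r shrink_ball_mem[OF xB, of k] shrink_ball_mono[OF xB, of 0 k] show False
          by (auto simp: not_le dest!: spec[of _ "shrink_center z x k"] spec[of _ "r / 2 ^ k"])
      qed
      then have "\<bar>v x - avg v z r\<bar> \<le> H * lam powr ((n - s) / (n * p))"
        unfolding H_def n_def using x v r s \<epsilon> lam e n xB
        by (intro pointwise_bound) (auto simp: S_def good_def)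
      with x show False by (simp add: lamH S_def)
    qed
  qed (use \<epsilon> in \<open>auto simp: S_def\<close>)
  have "emeasure \<mu> {x \<in> ball z r. t < \<bar>v x - avg v z r\<bar>} \<le> emeasure \<mu> (N \<union> U)"
    using N U by (intro emeasure_mono) (auto simp: S_def)
  also have "\<dots> \<le> emeasure \<mu> N + emeasure \<mu> U"
    by (rule emeasure_subadditive) (use N U in auto)
  also have "emeasure \<mu> N = 0" using N by auto
  also have "0 + emeasure \<mu> U \<le> ennreal (A * 5 powr (n * p) * (\<epsilon> * W z r) / lam)" using U by simp
  also have "\<dots> \<le> ennreal (level_const * scaled_energy s r \<epsilon> powr \<kappa> * W z r / t powr q)"
  proof (rule ennreal_leI)
    define Q where "Q = poincare_const * (1 - s)"
    have Q: "Q > 0" using poincare_const_pos s by (simp add: Q_def)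
    have "A * 5 powr (n * p) * (\<epsilon> * W z r) / lam = A * 5 powr (n * p) * (\<epsilon> * W z r) * H powr q / t powr q"
      using t H by (simp add: lam_def powr_divide)
    also have "H powr q = (2 ^ DIM('a) * 4) powr q * Q powr \<kappa> * (r powr (s * p)) powr \<kappa> * (s powr (- p)) powr \<kappa> * (A * \<epsilon>) powr (\<kappa> - 1)"
    proof -
      have e1: "s / (n * p) * q = \<kappa> - 1" using n2 p_gt_1 by (simp add: q_def k1)
      have "H powr q = (2 ^ DIM('a) * 4) powr q * (Q powr (1 / p)) powr q * (r powr s) powr q * (1 / s) powr q * ((A * \<epsilon>) powr (s / (n * p))) powr q"
        using s r \<epsilon> A_ge_1 Q by (simp add: H_def hedberg_const_def Q_def[symmetric] n_def powr_mult powr_divide)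
      moreover have "(Q powr (1 / p)) powr q = Q powr \<kappa>" using p_gt_1 by (simp add: powr_powr q)
      moreover have "(r powr s) powr q = (r powr (s * p)) powr \<kappa>" by (simp add: powr_powr q mult_ac)
      moreover have "(1 / s) powr q = (s powr (- p)) powr \<kappa>"
        using s by (simp add: powr_powr q powr_divide powr_minus divide_simps)
      moreover have "((A * \<epsilon>) powr (s / (n * p))) powr q = (A * \<epsilon>) powr (\<kappa> - 1)" by (simp only: powr_powr e1)
      ultimately show ?thesis by simp
    qed
    also have "A * 5 powr (n * p) * (\<epsilon> * W z r) * ((2 ^ DIM('a) * 4) powr q * Q powr \<kappa> * (r powr (s * p)) powr \<kappa> * (s powr (- p)) powr \<kappa> * (A * \<epsilon>) powr (\<kappa> - 1)) / t powr q
      = (5 powr (n * p) * A powr \<kappa> * (2 ^ DIM('a) * 4) powr q) * (scaled_energy s r \<epsilon> powr \<kappa> * W z r / t powr q)"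
    proof -
      have "scaled_energy s r \<epsilon> powr \<kappa> = Q powr \<kappa> * (s powr (- p)) powr \<kappa> * (r powr (s * p)) powr \<kappa> * (\<epsilon> * \<epsilon> powr (\<kappa> - 1))"
        using Q s r \<epsilon> by (simp add: scaled_energy_def Q_def[symmetric] powr_mult powr_diff)
      moreover have "A powr \<kappa> = A * A powr (\<kappa> - 1)" using A_ge_1 by (simp add: powr_diff)
      moreover have "(A * \<epsilon>) powr (\<kappa> - 1) = A powr (\<kappa> - 1) * \<epsilon> powr (\<kappa> - 1)"
        using A_ge_1 \<epsilon> by (simp add: powr_mult)
      ultimately show ?thesis by (simp add: mult_ac)
    qed
    also have "\<dots> \<le> level_const * (scaled_energy s r \<epsilon> powr \<kappa> * W z r / t powr q)"
    proof (intro mult_right_mono)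
      have "A powr \<kappa> \<le> A powr 2" using A_ge_1 k2 by (intro powr_mono) auto
      then have a: "A powr \<kappa> \<le> A\<^sup>2" using A_ge_1 by (simp add: powr_numeral)
      have "(2 ^ DIM('a) * 4 :: real) = 2 powr (n + 2)" by (simp add: n_def powr_add powr_realpow)
      then have "(2 ^ DIM('a) * 4) powr q = 2 powr ((n + 2) * q)" by (simp add: powr_powr)
      also have "\<dots> \<le> 2 powr ((n + 2) * (2 * p))" using q n2 by (intro powr_mono mult_left_mono) auto
      finally have b: "(2 ^ DIM('a) * 4) powr q \<le> 2 powr ((n + 2) * (2 * p))" .
      show "5 powr (n * p) * A powr \<kappa> * (2 ^ DIM('a) * 4) powr q \<le> level_const"
        unfolding level_const_def n_def[symmetric] by (intro mult_mono a) (use b in \<open>auto simp: n_def add.commute\<close>)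
    qed auto
    finally show "A * 5 powr (n * p) * (\<epsilon> * W z r) / lam \<le> level_const * scaled_energy s r \<epsilon> powr \<kappa> * W z r / t powr q"
      by simp
  qed
  finally show ?thesis by (simp add: \<kappa>_def q_def n_def)
qed

end

section \<open>Strong type estimate by truncation\<close>

text \<open>
  Each summand satisfies a^p = a a^(p-1) \<le> a S^(p-1), where S is the sum.
\<close>

lemma sum_powr_le_powr_sum:
  fixes a :: "'b \<Rightarrow> real"
  assumes a: "\<And>i. i \<in> I \<Longrightarrow> 0 \<le> a i" and I: "finite I" and p: "1 \<le> p"
  shows "(\<Sum>i\<in>I. a i powr p) \<le> (\<Sum>i\<in>I. a i) powr p"
proof -
  define S where "S = (\<Sum>i\<in>I. a i)"
  have S: "0 \<le> S" "\<And>i. i \<in> I \<Longrightarrow> a i \<le> S"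
    using a I by (auto simp: S_def intro!: sum_nonneg member_le_sum)
  have split: "x powr p = x * x powr (p - 1)" if "0 \<le> x" for x :: real
    using that by (cases "x = 0") (auto simp: powr_diff)
  have "(\<Sum>i\<in>I. a i powr p) \<le> (\<Sum>i\<in>I. a i * S powr (p - 1))"
    using a S p by (intro sum_mono) (auto simp: split intro!: mult_left_mono powr_mono2)
  also have "\<dots> = S powr p" by (simp add: sum_distrib_right[symmetric] S_def[symmetric] split S(1))
  finally show ?thesis by (simp add: S_def)
qed

context muckenhoupt_weight
begin

lemma level_const_ge_1: "1 \<le> level_const"
proof -
  have "1 \<le> (5::real) powr (DIM('a) * p)" "1 \<le> (2::real) powr ((DIM('a) + 2) * (2 * p))"
    using p_gt_1 by (auto intro!: ge_one_powr_ge_zero)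
  moreover have "1 \<le> A\<^sup>2" using A_ge_1 by simp
  ultimately have "1 * 1 * 1 \<le> level_const"
    unfolding level_const_def by (intro mult_mono) auto
  then show ?thesis by simp
qed

lemma scaled_energy_pos: "0 < s \<Longrightarrow> s < 1 \<Longrightarrow> 0 < r \<Longrightarrow> 0 < \<epsilon> \<Longrightarrow> 0 < scaled_energy s r \<epsilon>"
  using poincare_const_pos by (simp add: scaled_energy_def)

text \<open>
  Letting \<epsilon> tend to 0 includes the case of vanishing energy. The truncations of v may
  well have energy zero even though v has not.
\<close>

lemma weak_type:
  fixes s r \<epsilon> t :: real
  assumes n: "2 \<le> DIM('a)" and v: "v \<in> borel_measurable borel" "set_integrable lborel (ball z r) v"
    and r: "0 < r" and s: "0 < s" "s < 1" and \<epsilon>: "0 \<le> \<epsilon>" and t: "0 < t"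
    and e: "mu_energy s (ball z r) v \<le> ennreal (\<epsilon> * W z r)"
  shows "emeasure \<mu> {x \<in> ball z r. t < \<bar>v x - avg v z r\<bar>}
    \<le> ennreal (level_const * scaled_energy s r \<epsilon> powr (DIM('a) / (DIM('a) - s)) * W z r
        / t powr (DIM('a) * p / (DIM('a) - s)))"
proof (cases "\<epsilon> = 0")
  case False
  with weak_type_pos[OF n v r s _ t e] \<epsilon> show ?thesis by simp
next
  case True
  let ?f = "\<lambda>\<epsilon>. level_const * scaled_energy s r \<epsilon> powr (DIM('a) / (DIM('a) - s)) * W z r
        / t powr (DIM('a) * p / (DIM('a) - s))"
  have ns: "real DIM('a) - s > 0" using n s by linarith
  have "(\<lambda>k. scaled_energy s r (1 / real (Suc k))) \<longlonglongrightarrow> poincare_const * (1 - s) * s powr (- p) * r powr (s * p) * 0"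
    unfolding scaled_energy_def by (intro tendsto_mult tendsto_const) (rule LIMSEQ_inverse_real_of_nat[unfolded inverse_eq_divide])
  then have "(\<lambda>k. scaled_energy s r (1 / real (Suc k))) \<longlonglongrightarrow> 0" by simp
  then have pw: "(\<lambda>k. scaled_energy s r (1 / real (Suc k)) powr (DIM('a) / (DIM('a) - s))) \<longlonglongrightarrow> 0 powr (DIM('a) / (DIM('a) - s))"
    using ns n s r by (intro tendsto_powr'[OF _ tendsto_const])
       (auto intro!: always_eventually less_imp_le[OF scaled_energy_pos])
  have "(\<lambda>k. ?f (1 / real (Suc k))) \<longlonglongrightarrow> level_const * 0 powr (DIM('a) / (DIM('a) - s)) * W z r
        / t powr (DIM('a) * p / (DIM('a) - s))"
    by (intro tendsto_divide tendsto_mult tendsto_const pw) (use t in auto)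
  then have lim: "(\<lambda>k. ennreal (?f (1 / real (Suc k)))) \<longlonglongrightarrow> ennreal 0"
    by (intro tendsto_ennrealI) simp
  have "emeasure \<mu> {x \<in> ball z r. t < \<bar>v x - avg v z r\<bar>} \<le> ennreal 0"
  proof (rule LIMSEQ_le_const[OF lim], intro exI allI impI)
    fix k
    have "mu_energy s (ball z r) v \<le> ennreal (1 / real (Suc k) * W z r)" using e True by simp
    from weak_type_pos[OF n v r s _ t this]
    show "emeasure \<mu> {x \<in> ball z r. t < \<bar>v x - avg v z r\<bar>} \<le> ennreal (?f (1 / real (Suc k)))"
      by simp
  qed
  then show ?thesis by simp
qed

definition strong_const :: real where
  "strong_const = 3 * 16 powr (2 * p) * level_const"

text \<open>
  Maz'ya's truncation method. Let u = |v - avg v z r| and choose t0 so that, by the weak type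
  inequality, u \<le> t0 on at least half of the ball in the sense of \<mu>. The function T k is
  the part of u between t0 2^k and t0 2^(k+1). Since T k vanishes on half of the ball, its level
  set where it is maximal is controlled by the weak type inequality whatever its mean is. The
  differences of the T k at two points have absolute values adding up to at most |v x - v y|,
  hence p-th powers adding up to at most |v x - v y|^p, and so the energies of the T k add up to
  at most that of v. Summing the weak bounds over k with the exponent \<kappa> \<ge> 1 gives the
  strong inequality with no further loss in s.
\<close>

lemma strong_type:
  fixes s r \<epsilon> :: real
  assumes n: "2 \<le> DIM('a)" and v_meas [measurable]: "v \<in> borel_measurable borel" and v: "set_integrable lborel (ball z r) v"
    and r: "0 < r" and s: "0 < s" "s < 1" and \<epsilon>: "0 < \<epsilon>"
    and e: "mu_energy s (ball z r) v \<le> ennreal (\<epsilon> * W z r)"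
  shows "(\<integral>\<^sup>+x\<in>ball z r. ennreal (\<bar>v x - avg v z r\<bar> powr (DIM('a) * p / (DIM('a) - s))) \<partial>\<mu>)
    \<le> ennreal (strong_const * scaled_energy s r \<epsilon> powr (DIM('a) / (DIM('a) - s)) * W z r)"
proof -
  let ?B = "ball z r"
  have [measurable]: "?B \<in> sets borel" by simp
  define n where "n = real DIM('a)"
  have n2: "n \<ge> 2" using n by (simp add: n_def)
  define q where "q = n * p / (n - s)"
  define \<kappa> where "\<kappa> = n / (n - s)"
  have ns: "n - s > 0" using n2 s by simp
  have k2: "1 \<le> \<kappa>" "\<kappa> \<le> 2" using n2 s ns by (auto simp: \<kappa>_def field_simps)
  have q1: "q = p * \<kappa>" by (simp add: q_def \<kappa>_def)
  have q: "q > 0" "q \<le> 2 * p"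
    unfolding q1 using p_gt_1 k2 mult_left_mono[of \<kappa> 2 p] by auto
  have Wz: "W z r > 0" using r by (simp add: W_pos)
  define X where "X = scaled_energy s r \<epsilon>"
  have X: "X > 0" using s r \<epsilon> by (simp add: X_def scaled_energy_pos)
  define L where "L = level_const"
  have L: "L > 0" using level_const_ge_1 by (simp add: L_def)
  have weak: "emeasure \<mu> {x \<in> ?B. t < \<bar>f x - avg f z r\<bar>} \<le> ennreal (L * scaled_energy s r \<epsilon>' powr \<kappa> * W z r / t powr q)"
    if "f \<in> borel_measurable borel" "set_integrable lborel ?B f" "0 \<le> \<epsilon>'" "0 < t"
      "mu_energy s ?B f \<le> ennreal (\<epsilon>' * W z r)" for f \<epsilon>' t
    using weak_type[OF \<open>2 \<le> DIM('a)\<close> that(1,2) r s that(3,4,5)] by (simp add: L_def \<kappa>_def q_def n_def)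
  \<comment> \<open>With this value the weak type inequality at level t0 leaves at most half of the weight of the ball.\<close>
  define t0 where "t0 = (2 * L * X powr \<kappa>) powr (1 / q)"
  have t0: "t0 > 0" "t0 powr q = 2 * L * X powr \<kappa>" using X L q by (auto simp: t0_def powr_powr)
  define u where "u x = \<bar>v x - avg v z r\<bar>" for x
  have [measurable]: "u \<in> borel_measurable borel" unfolding u_def by measurable
  define T where "T k x = min (u x) (t0 * 2 ^ Suc k) - min (u x) (t0 * 2 ^ k)" for k :: nat and x
  have [measurable]: "T k \<in> borel_measurable borel" for k unfolding T_def by measurable
  have t0k: "t0 * 2 ^ k > 0" for k :: nat using t0 by simp
  have t0S: "t0 * 2 ^ Suc k = 2 * (t0 * 2 ^ k)" for k by simp
  have T_bd: "0 \<le> T k x" "T k x \<le> t0 * 2 ^ k" for k x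
    using t0k[of k] unfolding T_def t0S by (auto simp: min_def)
  have T_int: "set_integrable lborel ?B (T k)" for k
    unfolding set_integrable_def
    by (rule integrableI_bounded_set[of ?B _ _ "t0 * 2 ^ k"])
       (use T_bd in \<open>auto simp: indicator_def intro!: emeasure_lborel_ball_finite[unfolded infinity_ennreal_def] AE_I2\<close>)
  have T_sum: "(\<Sum>k<M. \<bar>T k x - T k y\<bar> powr p) \<le> \<bar>v x - v y\<bar> powr p" for M x y
  proof -
    have 1: "(\<Sum>k<M. \<bar>T k x - T k y\<bar>) \<le> u x - u y" if "u y \<le> u x" for x y
    proof -
      have mono: "T k y \<le> T k x" for k
        using that t0k[of k] unfolding T_def t0S by (auto simp: min_def)
      have tel: "(\<Sum>k<M. T k x) = min (u x) (t0 * 2 ^ M) - min (u x) t0" for x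
        unfolding T_def by (subst sum_lessThan_telescope) simp
      have "(\<Sum>k<M. \<bar>T k x - T k y\<bar>) = (\<Sum>k<M. T k x) - (\<Sum>k<M. T k y)"
        using mono by (simp add: sum_subtractf)
      also have "\<dots> \<le> u x - u y"
        unfolding tel using that by (auto simp: min_def)
      finally show ?thesis .
    qed
    have "(\<Sum>k<M. \<bar>T k x - T k y\<bar>) \<le> \<bar>u x - u y\<bar>"
      using 1[of x y] 1[of y x] by (cases "u y \<le> u x") (auto simp: abs_minus_commute)
    also have "\<dots> \<le> \<bar>v x - v y\<bar>" by (simp add: u_def)
    finally have le: "(\<Sum>k<M. \<bar>T k x - T k y\<bar>) \<le> \<bar>v x - v y\<bar>" .
    have "(\<Sum>k<M. \<bar>T k x - T k y\<bar> powr p) \<le> (\<Sum>k<M. \<bar>T k x - T k y\<bar>) powr p"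
      by (rule sum_powr_le_powr_sum) (use p_gt_1 in auto)
    also have "\<dots> \<le> \<bar>v x - v y\<bar> powr p"
      using le p_gt_1 by (intro powr_mono2) (auto intro!: sum_nonneg)
    finally show ?thesis .
  qed
  have mu_energy_sum: "(\<Sum>k<M. mu_energy s ?B (T k)) \<le> ennreal (\<epsilon> * W z r)" for M
  proof -
    have "(\<Sum>k<M. mu_energy s ?B (T k)) = (\<integral>\<^sup>+x. (\<integral>\<^sup>+y. (\<Sum>k<M. ennreal (\<bar>T k x - T k y\<bar> powr p / norm (x - y) powr (s * p) / pair_weight x y)) * indicator ?B y \<partial>\<mu>) * indicator ?B x \<partial>\<mu>)"
    proof -
      let ?f = "\<lambda>k x y. ennreal (\<bar>T k x - T k y\<bar> powr p / norm (x - y) powr (s * p) / pair_weight x y)"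
      have "(\<Sum>k<M. mu_energy s ?B (T k)) = (\<integral>\<^sup>+x. (\<Sum>k<M. (\<integral>\<^sup>+y. ?f k x y * indicator ?B y \<partial>\<mu>) * indicator ?B x) \<partial>\<mu>)"
        unfolding mu_energy_def by (subst nn_integral_sum) measurable
      also have "\<dots> = (\<integral>\<^sup>+x. (\<integral>\<^sup>+y. (\<Sum>k<M. ?f k x y * indicator ?B y) \<partial>\<mu>) * indicator ?B x \<partial>\<mu>)"
      proof (rule nn_integral_cong)
        fix x
        have "(\<integral>\<^sup>+y. (\<Sum>k<M. ?f k x y * indicator ?B y) \<partial>\<mu>) = (\<Sum>k<M. \<integral>\<^sup>+y. ?f k x y * indicator ?B y \<partial>\<mu>)"
          by (rule nn_integral_sum) measurable
        then show "(\<Sum>k<M. (\<integral>\<^sup>+y. ?f k x y * indicator ?B y \<partial>\<mu>) * indicator ?B x)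
          = (\<integral>\<^sup>+y. (\<Sum>k<M. ?f k x y * indicator ?B y) \<partial>\<mu>) * indicator ?B x"
          by (simp only: sum_distrib_right)
      qed
      finally show ?thesis by (simp only: sum_distrib_right)
    qed
    also have "\<dots> \<le> mu_energy s ?B v"
      unfolding mu_energy_def
    proof (intro nn_integral_mono mult_right_mono)
      fix x y
      have "(\<Sum>k<M. ennreal (\<bar>T k x - T k y\<bar> powr p / norm (x - y) powr (s * p) / pair_weight x y))
        = ennreal ((\<Sum>k<M. \<bar>T k x - T k y\<bar> powr p) / norm (x - y) powr (s * p) / pair_weight x y)"
        by (subst sum_ennreal) (auto simp: sum_divide_distrib)
      also have "\<dots> \<le> ennreal (\<bar>v x - v y\<bar> powr p / norm (x - y) powr (s * p) / pair_weight x y)"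
        by (intro ennreal_leI divide_right_mono T_sum) auto
      finally show "(\<Sum>k<M. ennreal (\<bar>T k x - T k y\<bar> powr p / norm (x - y) powr (s * p) / pair_weight x y)) \<le> \<dots>" .
    qed auto
    finally show ?thesis using e by simp
  qed
  define \<epsilon>k where "\<epsilon>k k = enn2real (mu_energy s ?B (T k)) / W z r" for k
  have ek0: "\<epsilon>k k \<ge> 0" for k using Wz by (simp add: \<epsilon>k_def)
  have ek: "mu_energy s ?B (T k) = ennreal (\<epsilon>k k * W z r)" for k
  proof -
    have "mu_energy s ?B (T k) \<le> (\<Sum>k<Suc k. mu_energy s ?B (T k))" by simp
    then have "mu_energy s ?B (T k) < \<infinity>" using mu_energy_sum[of "Suc k"] ennreal_less_top le_less_trans
      by (metis infinity_ennreal_def)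
    then show ?thesis using Wz by (simp add: \<epsilon>k_def)
  qed
  have ek_sum: "(\<Sum>k<M. \<epsilon>k k) \<le> \<epsilon>" for M
  proof -
    have "(\<Sum>k<M. mu_energy s ?B (T k)) = ennreal (\<Sum>k<M. \<epsilon>k k * W z r)"
      unfolding ek using ek0 by (intro sum_ennreal) auto
    with mu_energy_sum[of M] have "ennreal (\<Sum>k<M. \<epsilon>k k * W z r) \<le> ennreal (\<epsilon> * W z r)" by simp
    then have "(\<Sum>k<M. \<epsilon>k k) * W z r \<le> \<epsilon> * W z r"
      using \<epsilon> by (simp add: ennreal_le_iff sum_distrib_right)
    then show ?thesis using Wz by simp
  qed
  define Xk where "Xk k = scaled_energy s r (\<epsilon>k k)" for k
  have Xk0: "0 \<le> Xk k" for k using ek0[of k] s poincare_const_pos by (simp add: Xk_def scaled_energy_def)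
  \<comment> \<open>The exponent \<kappa> is at least 1, so the powers of the pieces add up to at most the power of the whole.\<close>
  have Xk_sum: "(\<Sum>k<M. Xk k powr \<kappa>) \<le> X powr \<kappa>" for M
  proof -
    have "(\<Sum>k<M. Xk k powr \<kappa>) \<le> (\<Sum>k<M. Xk k) powr \<kappa>"
      by (rule sum_powr_le_powr_sum) (use Xk0 k2 in auto)
    also have "\<dots> \<le> X powr \<kappa>"
    proof (rule powr_mono2)
      have "(\<Sum>k<M. Xk k) = scaled_energy s r (\<Sum>k<M. \<epsilon>k k)"
        by (simp add: Xk_def scaled_energy_def sum_distrib_left)
      also have "\<dots> \<le> X"
        unfolding X_def scaled_energy_def using s poincare_const_pos
        by (intro mult_left_mono ek_sum) auto
      finally show "(\<Sum>k<M. Xk k) \<le> X" .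
    qed (use k2 Xk0 in \<open>auto intro!: sum_nonneg\<close>)
    finally show ?thesis .
  qed
  have half: "emeasure \<mu> {x \<in> ?B. t0 < u x} \<le> ennreal (W z r / 2)"
  proof -
    have "emeasure \<mu> {x \<in> ?B. t0 < u x} \<le> ennreal (L * X powr \<kappa> * W z r / t0 powr q)"
      unfolding u_def X_def by (rule weak) (use v \<epsilon> t0 e in auto)
    also have "L * X powr \<kappa> * W z r / t0 powr q = W z r / 2"
      using L X by (simp add: t0)
    finally show ?thesis .
  qed
  have level: "emeasure \<mu> {x \<in> ?B. t0 * 2 ^ Suc k < u x} \<le> ennreal (L * Xk k powr \<kappa> * W z r / (t0 * 2 ^ k / 4) powr q)" for k
  proof -
    define S where "S = {x \<in> ?B. t0 * 2 ^ k / 4 < \<bar>T k x - avg (T k) z r\<bar>}"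
    have [measurable]: "S \<in> sets borel" unfolding S_def by measurable
    \<comment> \<open>If the mean of T k is small, T k is far from it where u is large; if it is large, T k is far from it where T k vanishes, which is half of the ball.\<close>
    have "emeasure \<mu> {x \<in> ?B. t0 * 2 ^ Suc k < u x} \<le> emeasure \<mu> S"
    proof (cases "avg (T k) z r \<le> t0 * 2 ^ k / 2")
      case True
      have "{x \<in> ?B. t0 * 2 ^ Suc k < u x} \<subseteq> S"
      proof safe
        fix x assume "x \<in> ?B" "t0 * 2 ^ Suc k < u x"
        moreover from this have "T k x = t0 * 2 ^ k"
          using t0k[of k] unfolding T_def t0S by (auto simp: min_def)
        ultimately show "x \<in> S" using True t0k[of k] by (simp add: S_def)
      qed
      then show ?thesis by (rule emeasure_mono) simp
    next
      case False
      have "t0 * 1 \<le> t0 * 2 ^ k" using t0 by (intro mult_left_mono) auto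
      then have t0l: "t0 \<le> t0 * 2 ^ k" by simp
      have low: "x \<in> S" if "x \<in> ?B" "u x \<le> t0" for x
      proof -
        have "T k x = 0" using that t0l t0k[of k] unfolding T_def t0S by (auto simp: min_def)
        then show ?thesis using that False t0k[of k] by (simp add: S_def)
      qed
      then have low': "x \<in> S \<or> t0 < u x" if "x \<in> ?B" for x
        using that by (cases "u x \<le> t0") auto
      have sub: "?B \<subseteq> S \<union> {x \<in> ?B. t0 < u x}"
      proof
        fix x assume "x \<in> ?B"
        with low'[of x] show "x \<in> S \<union> {x \<in> ?B. t0 < u x}" by blast
      qed
      have "ennreal (W z r / 2) + ennreal (W z r / 2) = emeasure \<mu> ?B"
        using Wz by (simp add: emeasure_mu_ball ennreal_plus[symmetric] del: ennreal_plus)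
      also have "\<dots> \<le> emeasure \<mu> (S \<union> {x \<in> ?B. t0 < u x})"
        by (rule emeasure_mono[OF sub]) measurable
      also have "\<dots> \<le> emeasure \<mu> S + emeasure \<mu> {x \<in> ?B. t0 < u x}"
        by (rule emeasure_subadditive) auto
      also have "\<dots> \<le> emeasure \<mu> S + ennreal (W z r / 2)" by (intro add_left_mono half)
      finally have "ennreal (W z r / 2) \<le> emeasure \<mu> S"
        by (simp add: ennreal_add_left_cancel_le add.commute)
      moreover have "emeasure \<mu> {x \<in> ?B. t0 * 2 ^ Suc k < u x} \<le> emeasure \<mu> {x \<in> ?B. t0 < u x}"
        by (rule emeasure_mono) (use t0l t0k[of k] in \<open>auto simp: t0S simp del: power_Suc\<close>)
      ultimately show ?thesis using half by (meson order.trans)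
    qed
    also have "\<dots> \<le> ennreal (L * Xk k powr \<kappa> * W z r / (t0 * 2 ^ k / 4) powr q)"
      unfolding S_def Xk_def by (rule weak) (use T_int ek0 t0k[of k] ek in auto)
    finally show ?thesis .
  qed
  have term_le_suminf: "g k \<le> suminf g" for g :: "nat \<Rightarrow> ennreal" and k
    using sum_le_suminf[of g "{k}"] by simp
  have layer: "ennreal (u x powr q) * indicator ?B x \<le> ennreal ((2 * t0) powr q) * indicator ?B x
     + (\<Sum>k. ennreal ((t0 * 2 ^ (k + 2)) powr q) * indicator {x \<in> ?B. t0 * 2 ^ Suc k < u x} x)" for x
  proof (cases "x \<in> ?B \<and> 2 * t0 < u x")
    case False
    then have "ennreal (u x powr q) * indicator ?B x \<le> ennreal ((2 * t0) powr q) * indicator ?B x"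
      using q by (auto simp: indicator_def u_def intro!: ennreal_leI powr_mono2)
    then show ?thesis by (simp add: add_increasing2)
  next
    case True
    obtain j where "u x / t0 < 2 ^ j" using real_arch_pow[of 2 "u x / t0"] by auto
    then have ex: "u x \<le> t0 * 2 ^ j" using t0 by (simp add: field_simps)
    \<comment> \<open>As u x > 2 t0, the least such j is at least 2, and u x lies in the layer of index j - 2.\<close>
    define j0 where "j0 = (LEAST j. u x \<le> t0 * 2 ^ j)"
    have j0: "u x \<le> t0 * 2 ^ j0" unfolding j0_def by (rule LeastI, rule ex)
    have j0': "t0 * 2 ^ i < u x" if "i < j0" for i
      using not_less_Least[of i "\<lambda>j. u x \<le> t0 * 2 ^ j"] that by (simp add: j0_def)
    have "2 \<le> j0"
    proof (rule ccontr)
      assume "\<not> ?thesis"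
      then have "j0 = 0 \<or> j0 = 1" by auto
      with j0 True t0 show False by auto
    qed
    then obtain k where k: "j0 = k + 2" using le_Suc_ex by (metis add.commute)
    have "ennreal (u x powr q) * indicator ?B x \<le> ennreal ((t0 * 2 ^ (k + 2)) powr q) * indicator {x \<in> ?B. t0 * 2 ^ Suc k < u x} x"
      using True j0 j0'[of "Suc k"] k q t0 by (auto simp: indicator_def u_def intro!: ennreal_leI powr_mono2)
    also have "\<dots> \<le> (\<Sum>k. ennreal ((t0 * 2 ^ (k + 2)) powr q) * indicator {x \<in> ?B. t0 * 2 ^ Suc k < u x} x)"
      by (rule term_le_suminf[of "\<lambda>k. ennreal ((t0 * 2 ^ (k + 2)) powr q) * indicator {x \<in> ?B. t0 * 2 ^ Suc k < u x} x"])
    finally show ?thesis by (simp add: add_increasing)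
  qed
  have "(\<integral>\<^sup>+x\<in>?B. ennreal (u x powr q) \<partial>\<mu>)
    \<le> (\<integral>\<^sup>+x. ennreal ((2 * t0) powr q) * indicator ?B x
     + (\<Sum>k. ennreal ((t0 * 2 ^ (k + 2)) powr q) * indicator {x \<in> ?B. t0 * 2 ^ Suc k < u x} x) \<partial>\<mu>)"
    by (rule nn_integral_mono) (rule layer)
  also have "\<dots> = ennreal ((2 * t0) powr q) * emeasure \<mu> ?B
     + (\<Sum>k. ennreal ((t0 * 2 ^ (k + 2)) powr q) * emeasure \<mu> {x \<in> ?B. t0 * 2 ^ Suc k < u x})"
    by (subst nn_integral_add) (auto simp: nn_integral_suminf nn_integral_cmult_indicator)
  also have "\<dots> \<le> ennreal (2 powr q * (2 * L * X powr \<kappa>) * W z r) + ennreal (16 powr q * L * X powr \<kappa> * W z r)"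
  proof (rule add_mono)
    show "ennreal ((2 * t0) powr q) * emeasure \<mu> ?B \<le> ennreal (2 powr q * (2 * L * X powr \<kappa>) * W z r)"
      using t0 L by (simp add: powr_mult emeasure_mu_ball ennreal_mult'')
    show "(\<Sum>k. ennreal ((t0 * 2 ^ (k + 2)) powr q) * emeasure \<mu> {x \<in> ?B. t0 * 2 ^ Suc k < u x})
      \<le> ennreal (16 powr q * L * X powr \<kappa> * W z r)"
    proof (rule suminf_le_const)
      fix M
      have "(\<Sum>k<M. ennreal ((t0 * 2 ^ (k + 2)) powr q) * emeasure \<mu> {x \<in> ?B. t0 * 2 ^ Suc k < u x})
        \<le> (\<Sum>k<M. ennreal (16 powr q * L * W z r * Xk k powr \<kappa>))"
      proof (rule sum_mono)
        fix k
        have "ennreal ((t0 * 2 ^ (k + 2)) powr q) * emeasure \<mu> {x \<in> ?B. t0 * 2 ^ Suc k < u x}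
          \<le> ennreal ((t0 * 2 ^ (k + 2)) powr q) * ennreal (L * Xk k powr \<kappa> * W z r / (t0 * 2 ^ k / 4) powr q)"
          by (intro mult_left_mono level) auto
        also have "\<dots> = ennreal ((t0 * 2 ^ (k + 2)) powr q * (L * Xk k powr \<kappa> * W z r / (t0 * 2 ^ k / 4) powr q))"
          by (rule ennreal_mult[symmetric]) (use L in auto)
        also have "(t0 * 2 ^ (k + 2)) powr q * (L * Xk k powr \<kappa> * W z r / (t0 * 2 ^ k / 4) powr q)
          = 16 powr q * L * W z r * Xk k powr \<kappa>"
        proof -
          have "(t0 * 2 ^ (k + 2)) powr q = 16 powr q * (t0 * 2 ^ k / 4) powr q"
            using t0 by (simp add: powr_mult[symmetric] mult_ac)
          then show ?thesis using t0 by simp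
        qed
        finally show "ennreal ((t0 * 2 ^ (k + 2)) powr q) * emeasure \<mu> {x \<in> ?B. t0 * 2 ^ Suc k < u x}
          \<le> ennreal (16 powr q * L * W z r * Xk k powr \<kappa>)" .
      qed
      also have "\<dots> = ennreal (16 powr q * L * W z r * (\<Sum>k<M. Xk k powr \<kappa>))"
        using L by (subst sum_ennreal) (auto simp: sum_distrib_left)
      also have "\<dots> \<le> ennreal (16 powr q * L * W z r * X powr \<kappa>)"
        using L by (intro ennreal_leI mult_left_mono Xk_sum) auto
      finally show "(\<Sum>k<M. ennreal ((t0 * 2 ^ (k + 2)) powr q) * emeasure \<mu> {x \<in> ?B. t0 * 2 ^ Suc k < u x})
        \<le> ennreal (16 powr q * L * X powr \<kappa> * W z r)" by (simp add: mult_ac)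
    qed simp
  qed
  also have "\<dots> = ennreal ((2 * 2 powr q + 16 powr q) * (L * X powr \<kappa> * W z r))"
    using L by (simp add: ennreal_plus[symmetric] algebra_simps del: ennreal_plus)
  also have "\<dots> \<le> ennreal ((3 * 16 powr (2 * p)) * (L * X powr \<kappa> * W z r))"
  proof (intro ennreal_leI mult_right_mono)
    have "2 powr q \<le> 16 powr q" "16 powr q \<le> (16::real) powr (2 * p)"
      using q by (auto intro!: powr_mono2 powr_mono)
    then show "2 * 2 powr q + 16 powr q \<le> 3 * 16 powr (2 * p)" by linarith
  qed (use L in auto)
  also have "\<dots> = ennreal (strong_const * X powr \<kappa> * W z r)"
    by (simp add: strong_const_def L_def mult_ac)
  finally show ?thesis by (simp add: u_def X_def \<kappa>_def q_def n_def)
qed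

end

section \<open>Replacing the mean value\<close>

context muckenhoupt_weight
begin

lemma strong_const_ge_1: "1 \<le> strong_const"
proof -
  have "1 \<le> (16::real) powr (2 * p)" using p_gt_1 by (intro ge_one_powr_ge_zero) auto
  then have "1 * 1 * 1 \<le> strong_const"
    unfolding strong_const_def using level_const_ge_1 by (intro mult_mono) auto
  then show ?thesis by simp
qed

text \<open>
  The right-hand side of the Poincare inequality, raised to the power q, is at most the quantity
  in the strong bound, since s^(-p) \<ge> 1.
\<close>

lemma poincare_le_scaled_energy:
  fixes s r \<epsilon> :: real
  assumes n: "2 \<le> DIM('a)" and r: "0 < r" and s: "0 < s" "s < 1" and \<epsilon>: "0 < \<epsilon>"
  shows "((poincare_const * (1 - s) * r powr (s * p) * \<epsilon>) powr (1 / p)) powr (DIM('a) * p / (DIM('a) - s))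
    \<le> scaled_energy s r \<epsilon> powr (DIM('a) / (DIM('a) - s))"
proof -
  have ns: "real DIM('a) - s > 0" using n s by linarith
  have Q: "0 < poincare_const * (1 - s) * r powr (s * p) * \<epsilon>" using poincare_const_pos s r \<epsilon> by simp
  have "((poincare_const * (1 - s) * r powr (s * p) * \<epsilon>) powr (1 / p)) powr (DIM('a) * p / (DIM('a) - s))
    = (poincare_const * (1 - s) * r powr (s * p) * \<epsilon>) powr (DIM('a) / (DIM('a) - s))"
    using p_gt_1 by (simp add: powr_powr)
  also have "\<dots> \<le> scaled_energy s r \<epsilon> powr (DIM('a) / (DIM('a) - s))"
  proof (rule powr_mono2)
    have "1 \<le> s powr (- p)" using s p_gt_1 powr_mono2'[of "- p" s 1] by simp
    then have "(poincare_const * (1 - s) * r powr (s * p) * \<epsilon>) * 1 \<le> (poincare_const * (1 - s) * r powr (s * p) * \<epsilon>) * s powr (- p)"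
      using Q by (intro mult_left_mono) auto
    then show "poincare_const * (1 - s) * r powr (s * p) * \<epsilon> \<le> scaled_energy s r \<epsilon>"
      by (simp add: scaled_energy_def mult_ac)
  qed (use Q ns in auto)
  finally show ?thesis .
qed

text \<open>
  The passage from the strong inequality to the final form, for any number m whose distance from
  the mean is controlled. The hypotheses on \<epsilon> > 0 are exploited for \<epsilon> slightly
  larger than the energy divided by the weight, so that vanishing energy needs no separate
  treatment. The exponent 1/\<kappa> = (n - s)/n makes the bound linear in the energy.
\<close>

lemma sobolev_poincare_about:
  fixes s r m K :: real
  assumes n: "2 \<le> DIM('a)" and v_meas [measurable]: "v \<in> borel_measurable borel" and v: "set_integrable lborel (ball z r) v"
    and r: "0 < r" and s: "0 < s" "s < 1" and K: "0 \<le> K"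
    and fin: "mu_energy s (ball z r) v < \<infinity>"
    and close: "\<And>\<epsilon>. 0 < \<epsilon> \<Longrightarrow> mu_energy s (ball z r) v \<le> ennreal (\<epsilon> * W z r) \<Longrightarrow>
      \<bar>avg v z r - m\<bar> powr (DIM('a) * p / (DIM('a) - s)) \<le> K * scaled_energy s r \<epsilon> powr (DIM('a) / (DIM('a) - s))"
  shows "ennpowr ((\<integral>\<^sup>+x\<in>ball z r. ennreal (\<bar>v x - m\<bar> powr (DIM('a) * p / (DIM('a) - s))) \<partial>\<mu>) / ennreal (W z r))
      ((DIM('a) - s) / DIM('a))
    \<le> ennreal (2 powr (2 * p) * (strong_const + K) * poincare_const) *
      (ennreal (s powr (1 - 2 * p) * (1 - s) * (r powr (s * p) / W z r)) * mu_energy s (ball z r) v)"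
proof -
  let ?B = "ball z r"
  have [measurable]: "?B \<in> sets borel" by simp
  define n where "n = real DIM('a)"
  have n2: "n \<ge> 2" using n by (simp add: n_def)
  define q where "q = n * p / (n - s)"
  define \<kappa> where "\<kappa> = n / (n - s)"
  have ns: "n - s > 0" using n2 s by simp
  have k2: "1 \<le> \<kappa>" "\<kappa> \<le> 2" using n2 s ns by (auto simp: \<kappa>_def field_simps)
  have q1: "q = p * \<kappa>" by (simp add: q_def \<kappa>_def)
  have q: "q > 0" "q \<le> 2 * p"
    unfolding q1 using p_gt_1 k2 mult_left_mono[of \<kappa> 2 p] by auto
  have Wz: "W z r > 0" using r by (simp add: W_pos)
  define I where "I = (\<integral>\<^sup>+x\<in>?B. ennreal (\<bar>v x - m\<bar> powr q) \<partial>\<mu>)"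
  define G where "G = 2 powr (2 * p) * (strong_const + K)"
  have G: "G \<ge> 1"
  proof -
    have "1 \<le> (2::real) powr (2 * p)" using p_gt_1 by (intro ge_one_powr_ge_zero) auto
    then have "1 * 1 \<le> G" unfolding G_def using strong_const_ge_1 K by (intro mult_mono) auto
    then show ?thesis by simp
  qed
  have bound: "ennpowr (I / ennreal (W z r)) (1 / \<kappa>) \<le> ennreal (G * scaled_energy s r \<epsilon>)"
    if \<epsilon>: "0 < \<epsilon>" "mu_energy s ?B v \<le> ennreal (\<epsilon> * W z r)" for \<epsilon>
  proof -
    define X where "X = scaled_energy s r \<epsilon>"
    have X: "X > 0" using s r \<epsilon> by (simp add: X_def scaled_energy_pos)
    define d where "d = \<bar>avg v z r - m\<bar>"
    have d: "d \<ge> 0" "d powr q \<le> K * X powr \<kappa>"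
      using close[OF \<epsilon>] by (auto simp: d_def q_def n_def X_def \<kappa>_def)
    have "I \<le> (\<integral>\<^sup>+x. ennreal (2 powr q) * (ennreal (\<bar>v x - avg v z r\<bar> powr q) * indicator ?B x)
        + ennreal (2 powr q * d powr q) * indicator ?B x \<partial>\<mu>)"
      unfolding I_def
    proof (rule nn_integral_mono)
      fix x
      define a where "a = \<bar>v x - avg v z r\<bar>"
      have a: "a \<ge> 0" by (simp add: a_def)
      have "\<bar>v x - m\<bar> \<le> a + d" unfolding a_def d_def by linarith
      then have "\<bar>v x - m\<bar> \<le> 2 * max a d" by (auto simp: max_def)
      then have "\<bar>v x - m\<bar> powr q \<le> (2 * max a d) powr q" using q by (intro powr_mono2) auto
      also have "\<dots> = 2 powr q * (max a d) powr q" using a d by (simp add: powr_mult)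
      also have "\<dots> \<le> 2 powr q * (a powr q + d powr q)"
        by (intro mult_left_mono) (auto simp: max_def)
      finally have "ennreal (\<bar>v x - m\<bar> powr q) \<le> ennreal (2 powr q) * ennreal (a powr q) + ennreal (2 powr q * d powr q)"
        by (simp add: ennreal_mult[symmetric] ennreal_plus[symmetric] distrib_left del: ennreal_plus)
      then show "ennreal (\<bar>v x - m\<bar> powr q) * indicator ?B x
        \<le> ennreal (2 powr q) * (ennreal (\<bar>v x - avg v z r\<bar> powr q) * indicator ?B x) + ennreal (2 powr q * d powr q) * indicator ?B x"
        by (simp add: a_def indicator_def)
    qed
    also have "\<dots> = ennreal (2 powr q) * (\<integral>\<^sup>+x\<in>?B. ennreal (\<bar>v x - avg v z r\<bar> powr q) \<partial>\<mu>) + ennreal (2 powr q * d powr q) * emeasure \<mu> ?B"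
      by (subst nn_integral_add) (auto simp: nn_integral_cmult nn_integral_cmult_indicator)
    also have "\<dots> \<le> ennreal (2 powr q) * ennreal (strong_const * X powr \<kappa> * W z r) + ennreal (2 powr q * (K * X powr \<kappa>)) * ennreal (W z r)"
    proof (intro add_mono mult_left_mono mult_mono ennreal_leI d)
      show "(\<integral>\<^sup>+x\<in>?B. ennreal (\<bar>v x - avg v z r\<bar> powr q) \<partial>\<mu>) \<le> ennreal (strong_const * X powr \<kappa> * W z r)"
        using strong_type[OF \<open>2 \<le> DIM('a)\<close> v_meas v r s \<epsilon>] by (simp add: q_def \<kappa>_def X_def n_def)
    qed (auto simp: emeasure_mu_ball)
    also have "\<dots> = ennreal (2 powr q * (strong_const + K) * X powr \<kappa> * W z r)"
      using K strong_const_ge_1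
      by (simp add: ennreal_mult[symmetric] ennreal_plus[symmetric] algebra_simps del: ennreal_plus)
    also have "\<dots> \<le> ennreal (G * X powr \<kappa> * W z r)"
      unfolding G_def using q K strong_const_ge_1 by (intro ennreal_leI mult_right_mono powr_mono) auto
    finally have I_le: "I \<le> ennreal (G * X powr \<kappa> * W z r)" .
    then obtain J where J: "I = ennreal J" "0 \<le> J" by (cases I) (auto simp: top_unique)
    have JW: "J \<le> G * X powr \<kappa> * W z r" using I_le J G by (simp add: ennreal_le_iff)
    have "ennpowr (I / ennreal (W z r)) (1 / \<kappa>) = ennreal ((J / W z r) powr (1 / \<kappa>))"
      using J Wz by (simp add: ennpowr_def divide_ennreal)
    also have "\<dots> \<le> ennreal ((G * X powr \<kappa>) powr (1 / \<kappa>))"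
      using JW J Wz k2 by (intro ennreal_leI powr_mono2) (auto simp: divide_simps)
    also have "(G * X powr \<kappa>) powr (1 / \<kappa>) = G powr (1 / \<kappa>) * X"
      using G X k2 by (simp add: powr_mult powr_powr)
    also have "\<dots> \<le> G powr 1 * X"
      using G X k2 by (intro mult_right_mono powr_mono) auto
    finally show ?thesis using G by (simp add: X_def ennreal_leI order.trans)
  qed
  obtain E where E: "mu_energy s ?B v = ennreal E" "0 \<le> E" using fin by (cases "mu_energy s ?B v") auto
  define c where "c = G * poincare_const * (s powr (1 - 2 * p) * (1 - s) * r powr (s * p))"
  have c: "c > 0" using G poincare_const_pos s r by (simp add: c_def)
  have "ennpowr (I / ennreal (W z r)) (1 / \<kappa>) \<le> ennreal (c * (E / W z r))"
  proof (rule ennreal_le_epsilon)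
    fix e :: real assume e: "0 < e"
    \<comment> \<open>The excess e / c over the actual energy turns into the error e on the right-hand side.\<close>
    define \<epsilon> where "\<epsilon> = E / W z r + e / c"
    have \<epsilon>: "0 < \<epsilon>" using E Wz e c by (simp add: \<epsilon>_def add_nonneg_pos)
    have "E \<le> \<epsilon> * W z r" using Wz e c by (simp add: \<epsilon>_def distrib_right)
    then have "mu_energy s ?B v \<le> ennreal (\<epsilon> * W z r)" by (simp add: E ennreal_leI)
    with \<epsilon> have "ennpowr (I / ennreal (W z r)) (1 / \<kappa>) \<le> ennreal (G * scaled_energy s r \<epsilon>)" by (rule bound)
    also have "\<dots> \<le> ennreal (c * \<epsilon>)"
    proof (rule ennreal_leI)
      have "s powr (- p) \<le> s powr (1 - 2 * p)" using s p_gt_1 by (intro powr_mono') auto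
      then have "G * poincare_const * (1 - s) * r powr (s * p) * \<epsilon> * s powr (- p)
        \<le> G * poincare_const * (1 - s) * r powr (s * p) * \<epsilon> * s powr (1 - 2 * p)"
        using G poincare_const_pos s \<epsilon> by (intro mult_left_mono) auto
      then show "G * scaled_energy s r \<epsilon> \<le> c * \<epsilon>" by (simp add: c_def scaled_energy_def mult_ac)
    qed
    also have "c * \<epsilon> = c * (E / W z r) + e" using c by (simp add: \<epsilon>_def distrib_left)
    also have "ennreal (c * (E / W z r) + e) = ennreal (c * (E / W z r)) + ennreal e"
      using c E Wz e by (intro ennreal_plus) auto
    finally show "ennpowr (I / ennreal (W z r)) (1 / \<kappa>) \<le> ennreal (c * (E / W z r)) + ennreal e" .
  qed
  also have "ennreal (c * (E / W z r)) = ennreal (G * poincare_const) *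
      (ennreal (s powr (1 - 2 * p) * (1 - s) * (r powr (s * p) / W z r)) * mu_energy s ?B v)"
    using G poincare_const_pos s Wz E by (simp add: c_def E ennreal_mult[symmetric])
  finally show ?thesis
    by (simp add: I_def G_def \<kappa>_def q_def n_def)
qed

lemma mean_deviation_lborel:
  fixes s r \<epsilon> :: real
  assumes v_meas: "v \<in> borel_measurable borel" and v: "set_integrable lborel (ball z r) v"
    and r: "0 < r" and s: "0 < s" "s < 1" and \<epsilon>: "0 < \<epsilon>" "mu_energy s (ball z r) v \<le> ennreal (\<epsilon> * W z r)"
  shows "(\<integral>\<^sup>+x\<in>ball z r. ennreal \<bar>v x - avg v z r\<bar> \<partial>lborel)
    \<le> ennreal (measure lborel (ball z r) * (poincare_const * (1 - s) * r powr (s * p) * \<epsilon>) powr (1 / p))"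
proof (rule mean_deviation_le[OF v r v_meas])
  have "W z r > 0" using r by (rule W_pos)
  then show "(\<integral>\<^sup>+x\<in>ball z r. (\<integral>\<^sup>+y\<in>ball z r. ennreal \<bar>v x - v y\<bar> \<partial>lborel) \<partial>lborel)
      \<le> ennreal ((measure lborel (ball z r))\<^sup>2 * (poincare_const * (1 - s) * r powr (s * p) * \<epsilon>) powr (1 / p))"
    using fractional_poincare[OF v_meas r s _ \<epsilon>(2)] \<epsilon>(1) by simp
qed simp

text \<open>
  Hoelder's inequality with exponent q applied to the strong inequality.
\<close>

lemma mean_deviation_mu:
  fixes s r \<epsilon> :: real
  assumes n: "2 \<le> DIM('a)" and v_meas [measurable]: "v \<in> borel_measurable borel" and v: "set_integrable lborel (ball z r) v"
    and r: "0 < r" and s: "0 < s" "s < 1" and \<epsilon>: "0 < \<epsilon>" "mu_energy s (ball z r) v \<le> ennreal (\<epsilon> * W z r)"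
  shows "(\<integral>\<^sup>+x\<in>ball z r. ennreal \<bar>v x - avg v z r\<bar> \<partial>\<mu>)
    \<le> ennreal (W z r * (strong_const * scaled_energy s r \<epsilon> powr (DIM('a) / (DIM('a) - s))) powr (1 / (DIM('a) * p / (DIM('a) - s))))"
proof -
  let ?B = "ball z r"
  define n where "n = real DIM('a)"
  have n2: "n \<ge> 2" using n by (simp add: n_def)
  define q where "q = n * p / (n - s)"
  have ns: "n - s > 0" using n2 s by simp
  have "1 * (n - s) < p * n" using p_gt_1 ns s by (intro mult_strict_mono) auto
  then have q: "q > 1" using ns by (simp add: q_def divide_simps mult.commute)
  define Y where "Y = strong_const * scaled_energy s r \<epsilon> powr (n / (n - s))"
  have Y: "Y \<ge> 0" using strong_const_ge_1 by (simp add: Y_def)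
  have Wz: "W z r > 0" using r by (simp add: W_pos)
  let ?M = "restrict_space \<mu> ?B"
  have "(\<integral>\<^sup>+x. ennreal \<bar>v x - avg v z r\<bar> \<partial>?M) \<le> ennreal ((Y * W z r) powr (1 / q) * W z r powr (1 - 1 / q))"
  proof (rule nn_integral_Hoelder_weight[where g = "\<lambda>_. 1" and p = q])
    show "(\<integral>\<^sup>+x. ennreal (\<bar>v x - avg v z r\<bar> powr q * 1) \<partial>?M) \<le> ennreal (Y * W z r)"
      using strong_type[OF \<open>2 \<le> DIM('a)\<close> v_meas v r s \<epsilon>]
      by (simp add: nn_integral_restrict_space Y_def q_def n_def)
    show "(\<integral>\<^sup>+x. ennreal (1 powr (1 / (1 - q))) \<partial>?M) \<le> ennreal (W z r)"
      by (simp add: emeasure_restrict_space space_restrict_space emeasure_mu_ball)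
  qed (use q Y in \<open>auto intro!: measurable_restrict_space1\<close>)
  also have "(Y * W z r) powr (1 / q) * W z r powr (1 - 1 / q) = W z r * Y powr (1 / q)"
    using Wz Y by (simp add: powr_mult powr_diff)
  finally show ?thesis by (simp add: nn_integral_restrict_space Y_def q_def n_def)
qed

end

section \<open>Borel representatives\<close>

lemma nn_integral_lebesgue_on_ball:
  "(\<integral>\<^sup>+x. f x \<partial>lebesgue_on (ball z r)) = (\<integral>\<^sup>+x\<in>ball z r. f x \<partial>lborel)"
  for z :: "'a::euclidean_space"
  by (simp add: nn_integral_restrict_space nn_integral_completion)

lemma lebesgue_on_ball_measurable_iff:
  fixes v :: "'a::euclidean_space \<Rightarrow> real"
  shows "v \<in> borel_measurable (lebesgue_on (ball z r)) \<longleftrightarrow> (\<lambda>x. indicator (ball z r) x *\<^sub>R v x) \<in> borel_measurable lebesgue"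
  by (rule borel_measurable_restrict_space_iff) simp

lemma borel_version_on_ball:
  fixes v :: "'a::euclidean_space \<Rightarrow> real"
  assumes "v \<in> borel_measurable (lebesgue_on (ball z r))"
  obtains v' where "v' \<in> borel_measurable borel" "AE x in lborel. x \<in> ball z r \<longrightarrow> v x = v' x"
proof -
  obtain v' where v': "v' \<in> borel_measurable lborel" "AE x in lborel. indicator (ball z r) x *\<^sub>R v x = v' x"
    using completion_ex_borel_measurable_real[OF assms[unfolded lebesgue_on_ball_measurable_iff]] by blast
  have "AE x in lborel. x \<in> ball z r \<longrightarrow> v x = v' x"
    using v'(2) by eventually_elim auto
  with v'(1) show ?thesis by (intro that) auto
qed

text \<open>
  Integrability on compact sets gives measurability on balls about the origin, and hence in the
  limit on the whole space.
\<close>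

lemma weight_lebesgue_measurable:
  fixes w :: "'a::euclidean_space \<Rightarrow> real"
  assumes "is_weight w"
  shows "w \<in> borel_measurable lebesgue"
proof (rule borel_measurable_LIMSEQ_real)
  fix k :: nat
  have "integrable (lebesgue_on (cball 0 (real k))) w" using assms by (simp add: is_weight_def)
  then show "(\<lambda>x. indicator (cball 0 (real k)) x *\<^sub>R w x) \<in> borel_measurable lebesgue"
    by (subst borel_measurable_restrict_space_iff[symmetric]) (auto dest: borel_measurable_integrable)
next
  fix x :: 'a
  obtain k0 :: nat where "norm x \<le> real k0" using real_arch_simple by blast
  then have "\<forall>\<^sub>F k in sequentially. indicator (cball 0 (real k)) x *\<^sub>R w x = w x"
    by (intro eventually_sequentiallyI[of k0]) (auto simp: indicator_def)
  then show "(\<lambda>k. indicator (cball 0 (real k)) x *\<^sub>R w x) \<longlonglongrightarrow> w x"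
    by (rule tendsto_eventually)
qed

lemma borel_version_of_weight:
  fixes w :: "'a::euclidean_space \<Rightarrow> real"
  assumes w: "is_weight w"
  obtains w' where "w' \<in> borel_measurable borel" "\<And>x. 0 < w' x" "AE x in lborel. w x = w' x"
proof -
  obtain g where g: "g \<in> borel_measurable lborel" "AE x in lborel. w x = g x"
    using completion_ex_borel_measurable_real[OF weight_lebesgue_measurable[OF w]] by blast
  have [measurable]: "g \<in> borel_measurable borel" using g(1) by simp
  have pos: "AE x in lborel. 0 < w x" using w by (simp add: is_weight_def AE_completion_iff)
  show ?thesis
  proof (rule that)
    show "(\<lambda>x. if 0 < g x then g x else 1) \<in> borel_measurable borel" by measurable
    show "AE x in lborel. w x = (if 0 < g x then g x else 1)"
      using g(2) pos by eventually_elim auto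
  qed auto
qed

text \<open>
  Finiteness of the A_p constant excludes that the dual integral over a ball is infinite, because
  the weight of the ball is positive; this provides the number b of the locale.
\<close>

lemma Ap_class_muckenhoupt_weight:
  fixes w w' :: "'a::euclidean_space \<Rightarrow> real"
  assumes w: "w \<in> Ap_class p" and p: "1 < p"
    and [measurable]: "w' \<in> borel_measurable borel" and pos: "\<And>x. 0 < w' x" and eq: "AE x in lborel. w x = w' x"
  shows "muckenhoupt_weight w' p (enn2real (Ap_const p w))"
proof -
  have wt: "is_weight w" and fin: "Ap_const p w < \<infinity>" using w by (auto simp: Ap_class_def)
  have int_w: "(\<integral>\<^sup>+x. ennreal (w x) \<partial>lebesgue_on (ball z r)) = emeasure (density lborel (\<lambda>x. ennreal (w' x))) (ball z r)" for z r
  proof -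
    have "(\<integral>\<^sup>+x\<in>ball z r. ennreal (w x) \<partial>lborel) = (\<integral>\<^sup>+x\<in>ball z r. ennreal (w' x) \<partial>lborel)"
      using eq by (intro nn_integral_cong_AE) auto
    then show ?thesis by (simp add: nn_integral_lebesgue_on_ball emeasure_density)
  qed
  have int_s: "(\<integral>\<^sup>+x. ennreal (w x powr (1 / (1 - p))) \<partial>lebesgue_on (ball z r)) = (\<integral>\<^sup>+x\<in>ball z r. ennreal (w' x powr (1 / (1 - p))) \<partial>lborel)" for z r
    unfolding nn_integral_lebesgue_on_ball using eq by (intro nn_integral_cong_AE) auto
  have finite: "emeasure (density lborel (\<lambda>x. ennreal (w' x))) (ball z r) < \<infinity>" for z r
  proof -
    have "integrable (lebesgue_on (cball z r)) w" using wt by (simp add: is_weight_def)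
    then have "(\<integral>\<^sup>+x. ennreal \<bar>w x\<bar> \<partial>lebesgue_on (cball z r)) < \<infinity>"
      by (simp add: integrable_iff_bounded)
    then have fin_c: "(\<integral>\<^sup>+x\<in>cball z r. ennreal \<bar>w x\<bar> \<partial>lborel) < \<infinity>"
      by (simp add: nn_integral_restrict_space nn_integral_completion)
    have "emeasure (density lborel (\<lambda>x. ennreal (w' x))) (ball z r) = (\<integral>\<^sup>+x\<in>ball z r. ennreal (w x) \<partial>lborel)"
      by (simp add: int_w[symmetric] nn_integral_lebesgue_on_ball)
    also have "\<dots> \<le> (\<integral>\<^sup>+x\<in>cball z r. ennreal \<bar>w x\<bar> \<partial>lborel)"
      by (intro nn_integral_mono) (auto simp: indicator_def intro: ennreal_leI)
    finally show ?thesis using fin_c by (rule le_less_trans)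
  qed
  show ?thesis
  proof
    fix z :: 'a and r :: real assume r: "0 < r"
    let ?B = "ball z r" and ?mu = "density lborel (\<lambda>x. ennreal (w' x))"
    have [measurable]: "?B \<in> sets borel" by simp
    define m where "m = measure lborel ?B"
    have m: "m > 0" using r by (simp add: m_def)
    define V where "V = measure ?mu ?B"
    have V: "emeasure ?mu ?B = ennreal V"
      unfolding V_def by (rule emeasure_eq_ennreal_measure) (use finite[of z r] in auto)
    have Vpos: "V > 0"
    proof (rule ccontr)
      assume "\<not> 0 < V"
      then have "emeasure ?mu ?B = 0" by (simp add: V ennreal_eq_0_iff)
      then have null: "(\<integral>\<^sup>+x. ennreal (w' x) * indicator ?B x \<partial>lborel) = 0"
        by (simp add: emeasure_density)
      have "(\<lambda>x. ennreal (w' x) * indicator ?B x) \<in> borel_measurable lborel" by measurable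
      from nn_integral_0_iff_AE[OF this] null
      have "AE x in lborel. ennreal (w' x) * indicator ?B x = 0" by (rule iffD1)
      then have "AE x in lborel. x \<notin> ?B"
      proof eventually_elim
        fix x assume "ennreal (w' x) * indicator ?B x = 0"
        then show "x \<notin> ?B" using pos[of x] by (auto simp: indicator_def ennreal_eq_0_iff split: if_splits)
      qed
      then have "emeasure lborel ?B = 0" by (subst (asm) AE_iff_measurable[of ?B]) auto
      then show False using m by (simp add: emeasure_ball_lborel m_def)
    qed
    define \<sigma> where "\<sigma> = (\<integral>\<^sup>+x\<in>?B. ennreal (w' x powr (1 / (1 - p))) \<partial>lborel)"
    define a where "a = enn2real (Ap_const p w)"
    have Ap_a: "Ap_const p w = ennreal a" using fin by (simp add: a_def)
    have "(ennreal V / ennreal m) * ennpowr (\<sigma> / ennreal m) (p - 1) \<le> Ap_const p w"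
      unfolding Ap_const_def
      by (rule SUP_upper2[where i = "(z, r)"]) (use r in \<open>auto simp: int_w int_s emeasure_ball_lborel m_def V \<sigma>_def\<close>)
    then have le: "ennreal (V / m) * ennpowr (\<sigma> / ennreal m) (p - 1) \<le> ennreal a"
      using Vpos m by (simp add: divide_ennreal Ap_a)
    have "\<sigma> \<noteq> \<infinity>"
    proof
      assume "\<sigma> = \<infinity>"
      then have "ennpowr (\<sigma> / ennreal m) (p - 1) = \<infinity>" by (simp add: ennpowr_def ennreal_top_divide)
      with le Vpos m show False by (auto simp: ennreal_mult_top top_unique)
    qed
    then obtain b where b: "\<sigma> = ennreal b" "0 \<le> b" by (cases \<sigma>) auto
    have "ennpowr (\<sigma> / ennreal m) (p - 1) = ennreal ((b / m) powr (p - 1))"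
      using b m by (simp add: ennpowr_def divide_ennreal)
    then have "ennreal (V / m * (b / m) powr (p - 1)) \<le> ennreal a"
      using le Vpos m by (subst ennreal_mult) auto
    then have "V / m * (b / m) powr (p - 1) \<le> a"
      by (subst (asm) ennreal_le_iff) (auto simp: a_def)
    moreover have "m powr p = m * m powr (p - 1)" using m by (simp add: powr_diff)
    ultimately have "V * b powr (p - 1) \<le> a * m powr p"
      using m b by (simp add: powr_divide field_simps)
    then show "\<exists>b\<ge>0. (\<integral>\<^sup>+x\<in>?B. ennreal (w' x powr (1 / (1 - p))) \<partial>lborel) \<le> ennreal b \<and>
      measure ?mu ?B * b powr (p - 1) \<le> enn2real (Ap_const p w) * measure lborel ?B powr p"
      using b by (intro exI[of _ b]) (auto simp: \<sigma>_def V_def a_def m_def)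
  qed (use p pos finite in auto)
qed

lemma integral_lebesgue_on_ball:
  fixes f g :: "'a::euclidean_space \<Rightarrow> real"
  assumes f: "f \<in> borel_measurable (lebesgue_on (ball z r))" and g [measurable]: "g \<in> borel_measurable borel"
    and eq: "AE x in lborel. x \<in> ball z r \<longrightarrow> f x = g x"
  shows "(LINT x|lebesgue_on (ball z r). f x) = (LINT x:ball z r|lborel. g x)"
    and "integrable (lebesgue_on (ball z r)) f \<longleftrightarrow> set_integrable lborel (ball z r) g"
proof -
  have [measurable]: "ball z r \<in> sets borel" by simp
  have ae: "AE x in lebesgue. indicator (ball z r) x *\<^sub>R f x = indicator (ball z r) x *\<^sub>R g x"
    using AE_completion[OF eq] by eventually_elim (auto simp: indicator_def)
  have mf: "(\<lambda>x. indicator (ball z r) x *\<^sub>R f x) \<in> borel_measurable lebesgue"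
    using f by (simp only: lebesgue_on_ball_measurable_iff)
  have mg: "(\<lambda>x. indicator (ball z r) x *\<^sub>R g x) \<in> borel_measurable lborel" by measurable
  have "(LINT x|lebesgue_on (ball z r). f x) = (LINT x|lebesgue. indicator (ball z r) x *\<^sub>R f x)"
    by (rule integral_restrict_space) simp
  also have "\<dots> = (LINT x|lebesgue. indicator (ball z r) x *\<^sub>R g x)"
    by (rule integral_cong_AE[OF mf measurable_completion[OF mg] ae])
  also have "\<dots> = (LINT x:ball z r|lborel. g x)"
    unfolding set_lebesgue_integral_def by (rule integral_completion[OF mg])
  finally show "(LINT x|lebesgue_on (ball z r). f x) = (LINT x:ball z r|lborel. g x)" .
  have "integrable (lebesgue_on (ball z r)) f \<longleftrightarrow> integrable lebesgue (\<lambda>x. indicator (ball z r) x *\<^sub>R f x)"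
    by (rule integrable_restrict_space) simp
  also have "\<dots> \<longleftrightarrow> integrable lebesgue (\<lambda>x. indicator (ball z r) x *\<^sub>R g x)"
    by (rule integrable_cong_AE[OF mf measurable_completion[OF mg] ae])
  also have "\<dots> \<longleftrightarrow> set_integrable lborel (ball z r) g"
    unfolding set_integrable_def by (rule integrable_completion[OF mg])
  finally show "integrable (lebesgue_on (ball z r)) f \<longleftrightarrow> set_integrable lborel (ball z r) g" .
qed

text \<open>
  On a set of finite measure |t| \<le> 1 + |t|^p is enough.
\<close>

lemma Lp_integrable:
  fixes v :: "'a::euclidean_space \<Rightarrow> real"
  assumes v: "v \<in> Lp p (ball z r)" and p: "1 < p"
  shows "integrable (lebesgue_on (ball z r)) v"
proof (rule Bochner_Integration.integrable_bound)
  have "integrable (lebesgue_on (ball z r)) (\<lambda>_. 1 :: real)"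
    using emeasure_lborel_ball_finite[of z r]
    by (subst integral_lebesgue_on_ball(2)[where g = "\<lambda>_. 1"]) (auto simp: set_integrable_def)
  then show "integrable (lebesgue_on (ball z r)) (\<lambda>x. 1 + \<bar>v x\<bar> powr p)"
    using v by (intro Bochner_Integration.integrable_add) (auto simp: Lp_def)
  show "v \<in> borel_measurable (lebesgue_on (ball z r))" using v by (simp add: Lp_def)
  have "\<bar>t\<bar> \<le> 1 + \<bar>t\<bar> powr p" for t :: real
  proof (cases "\<bar>t\<bar> \<le> 1")
    case False
    then have "\<bar>t\<bar> powr 1 \<le> \<bar>t\<bar> powr p" using p by (intro powr_mono) auto
    then show ?thesis using False by simp
  qed (use powr_ge_zero[of "\<bar>t\<bar>" p] in linarith)
  then show "AE x in lebesgue_on (ball z r). norm (v x) \<le> norm (1 + \<bar>v x\<bar> powr p)"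
    by (intro AE_I2) (simp add: add_nonneg_nonneg)
qed

context muckenhoupt_weight
begin

lemma pair_weight_commute: "pair_weight x y = pair_weight y x"
  by (simp add: pair_weight_def dist_commute midpoint_sym)

lemma wmeas_ball:
  assumes "w0 \<in> borel_measurable lebesgue" and eq: "AE x in lborel. w0 x = w x"
  shows "wmeas w0 (ball z r) = W z r"
proof -
  have "wmeas w0 (ball z r) = (LINT x:ball z r|lborel. w x)"
    unfolding wmeas_def using assms
    by (intro integral_lebesgue_on_ball) (auto intro!: measurable_restrict_space1)
  also have "\<dots> = enn2real (\<integral>\<^sup>+x. ennreal (w x) * indicator (ball z r) x \<partial>lborel)"
    unfolding set_lebesgue_integral_def
    by (subst integral_eq_nn_integral)
       (auto simp: w_pos less_imp_le indicator_def intro!: arg_cong[where f = enn2real] nn_integral_cong)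
  finally show ?thesis by (simp flip: W_eq_nn_integral)
qed

lemma nn_integral_weighted_ball:
  assumes eq: "AE x in lborel. w0 x = w x" and eqf: "AE x in lborel. x \<in> ball z r \<longrightarrow> f0 x = f x"
    and [measurable]: "f \<in> borel_measurable borel"
  shows "(\<integral>\<^sup>+x. ennreal (f0 x * w0 x) \<partial>lebesgue_on (ball z r)) = (\<integral>\<^sup>+x\<in>ball z r. ennreal (f x) \<partial>\<mu>)"
proof -
  have [measurable]: "ball z r \<in> sets borel" by simp
  have "(\<integral>\<^sup>+x\<in>ball z r. ennreal (f x) \<partial>\<mu>) = (\<integral>\<^sup>+x. ennreal (w x) * (ennreal (f x) * indicator (ball z r) x) \<partial>lborel)"
    by (rule nn_integral_mu) measurable
  also have "\<dots> = (\<integral>\<^sup>+x\<in>ball z r. ennreal (f0 x * w0 x) \<partial>lborel)"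
    using eq eqf
    by (intro nn_integral_cong_AE, eventually_elim)
       (auto simp: indicator_def ennreal_mult'' w_pos less_imp_le mult.commute)
  finally show ?thesis by (simp add: nn_integral_lebesgue_on_ball)
qed

lemma energy_eq_mu_energy:
  assumes w0: "w0 \<in> borel_measurable lebesgue" and eq: "AE x in lborel. w0 x = w x"
    and [measurable]: "v \<in> borel_measurable borel" and eqv: "AE x in lborel. x \<in> ball z r \<longrightarrow> v0 x = v x"
  shows "energy s p w0 (ball z r) v0 = mu_energy s (ball z r) v"
proof -
  let ?B = "ball z r"
  have [measurable]: "?B \<in> sets borel" by simp
  let ?k = "\<lambda>y x. \<bar>v y - v x\<bar> powr p / norm (y - x) powr (s * p) / pair_weight y x"
  have Wxy: "wmeas w0 (Bxy x y) = pair_weight y x" for x y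
    unfolding Bxy_def wmeas_ball[OF w0 eq] pair_weight_commute[of y x] by (simp add: pair_weight_def)
  have inner: "(\<integral>\<^sup>+x\<in>?B. ennreal (\<bar>v0 x - v0 y\<bar> powr p / norm (x - y) powr (s * p) * (w0 x * w0 y / wmeas w0 (Bxy x y))) \<partial>lborel)
      = ennreal (w y) * (\<integral>\<^sup>+x\<in>?B. ennreal (?k y x) \<partial>\<mu>)"
    if y: "v0 y = v y" "w0 y = w y" for y
  proof -
    have "ennreal (w y) * (\<integral>\<^sup>+x\<in>?B. ennreal (?k y x) \<partial>\<mu>)
      = ennreal (w y) * (\<integral>\<^sup>+x. ennreal (w x) * (ennreal (?k y x) * indicator ?B x) \<partial>lborel)"
      by (subst nn_integral_mu) measurable
    also have "\<dots> = (\<integral>\<^sup>+x. ennreal (w y) * (ennreal (w x) * (ennreal (?k y x) * indicator ?B x)) \<partial>lborel)"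
      by (rule nn_integral_cmult[symmetric]) measurable
    also have "\<dots> = (\<integral>\<^sup>+x\<in>?B. ennreal (\<bar>v0 x - v0 y\<bar> powr p / norm (x - y) powr (s * p) * (w0 x * w0 y / wmeas w0 (Bxy x y))) \<partial>lborel)"
      using eq eqv
    proof (intro nn_integral_cong_AE, eventually_elim)
      fix x assume x: "w0 x = w x" "x \<in> ?B \<longrightarrow> v0 x = v x"
      have "w y * (w x * ?k y x) = \<bar>v x - v y\<bar> powr p / norm (x - y) powr (s * p) * (w x * w y / pair_weight y x)"
        by (simp add: abs_minus_commute norm_minus_commute)
      then show "ennreal (w y) * (ennreal (w x) * (ennreal (?k y x) * indicator ?B x))
        = ennreal (\<bar>v0 x - v0 y\<bar> powr p / norm (x - y) powr (s * p) * (w0 x * w0 y / wmeas w0 (Bxy x y))) * indicator ?B x"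
        using x y w_pos[of x] w_pos[of y]
        by (auto simp: Wxy indicator_def ennreal_mult[symmetric])
    qed
    finally show ?thesis ..
  qed
  have "mu_energy s ?B v = (\<integral>\<^sup>+y. ennreal (w y) * ((\<integral>\<^sup>+x\<in>?B. ennreal (?k y x) \<partial>\<mu>) * indicator ?B y) \<partial>lborel)"
    unfolding mu_energy_def by (rule nn_integral_mu) measurable
  also have "\<dots> = energy s p w0 ?B v0"
    unfolding energy_def nn_integral_lebesgue_on_ball using eq eqv
  proof (intro nn_integral_cong_AE, eventually_elim)
    fix y assume y: "w0 y = w y" "y \<in> ?B \<longrightarrow> v0 y = v y"
    show "ennreal (w y) * ((\<integral>\<^sup>+x\<in>?B. ennreal (?k y x) \<partial>\<mu>) * indicator ?B y)
      = (\<integral>\<^sup>+x\<in>?B. ennreal (\<bar>v0 x - v0 y\<bar> powr p / norm (x - y) powr (s * p) * (w0 x * w0 y / wmeas w0 (Bxy x y))) \<partial>lborel) * indicator ?B y"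
    proof (cases "y \<in> ?B")
      case True
      with y have "v0 y = v y" by simp
      then show ?thesis by (subst inner[OF _ y(1)]) (simp_all only: mult.assoc)
    qed simp
  qed
  finally show ?thesis ..
qed

definition sobolev_const :: "real \<Rightarrow> real" where
  "sobolev_const K = 2 powr (2 * p) * (strong_const + K) * poincare_const"

text \<open>
  Transfers the estimate from the Borel representatives w and v to the given functions w0 and v0,
  which agree with them almost everywhere.
\<close>

lemma osc_lhs_le:
  fixes s r m K :: real
  assumes n: "2 \<le> DIM('a)" and w0: "w0 \<in> borel_measurable lebesgue" and eq: "AE x in lborel. w0 x = w x"
    and v_meas [measurable]: "v \<in> borel_measurable borel" and eqv: "AE x in lborel. x \<in> ball z r \<longrightarrow> v0 x = v x"
    and v0: "v0 \<in> Wsp s p w0 (ball z r)"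
    and r: "0 < r" and s: "0 < s" "s < 1" and K: "0 \<le> K"
    and close: "\<And>\<epsilon>. 0 < \<epsilon> \<Longrightarrow> mu_energy s (ball z r) v \<le> ennreal (\<epsilon> * W z r) \<Longrightarrow>
      \<bar>avg v z r - m\<bar> powr (DIM('a) * p / (DIM('a) - s)) \<le> K * scaled_energy s r \<epsilon> powr (DIM('a) / (DIM('a) - s))"
  shows "osc_lhs s p w0 (ball z r) v0 m \<le> ennreal (sobolev_const K) * energy_rhs s p w0 (ball z r) r v0"
proof -
  have v0': "v0 \<in> Lp p (ball z r)" "energy s p w0 (ball z r) v0 < \<infinity>" using v0 by (auto simp: Wsp_def)
  have v: "set_integrable lborel (ball z r) v"
    using Lp_integrable[OF v0'(1) p_gt_1] v0'(1)
    by (subst (asm) integral_lebesgue_on_ball(2)[OF _ v_meas eqv]) (auto simp: Lp_def)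
  have eqm: "AE x in lborel. x \<in> ball z r \<longrightarrow> \<bar>v0 x - m\<bar> powr q = \<bar>v x - m\<bar> powr q" for q
    using eqv by eventually_elim auto
  have "osc_lhs s p w0 (ball z r) v0 m = ennpowr ((\<integral>\<^sup>+x\<in>ball z r. ennreal (\<bar>v x - m\<bar> powr (DIM('a) * p / (DIM('a) - s))) \<partial>\<mu>) / ennreal (W z r))
      ((DIM('a) - s) / DIM('a))"
    unfolding osc_lhs_def Let_def wmeas_ball[OF w0 eq]
    by (subst nn_integral_weighted_ball[OF eq eqm]) (auto simp: mult.commute)
  also have "\<dots> \<le> ennreal (sobolev_const K) *
      (ennreal (s powr (1 - 2 * p) * (1 - s) * (r powr (s * p) / W z r)) * mu_energy s (ball z r) v)"
    unfolding sobolev_const_def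
    by (rule sobolev_poincare_about[OF n v_meas v r s K _ close])
       (use v0' in \<open>simp_all add: energy_eq_mu_energy[OF w0 eq v_meas eqv, symmetric]\<close>)
  also have "\<dots> = ennreal (sobolev_const K) * energy_rhs s p w0 (ball z r) r v0"
    by (simp add: energy_rhs_def wmeas_ball[OF w0 eq] energy_eq_mu_energy[OF w0 eq v_meas eqv])
  finally show ?thesis .
qed

end

section \<open>Admissible means\<close>

context muckenhoupt_weight
begin

lemma Wsp_borel_version:
  assumes v0: "v0 \<in> Wsp s p w0 (ball z r)"
  obtains v where "v \<in> borel_measurable borel" "AE x in lborel. x \<in> ball z r \<longrightarrow> v0 x = v x"
    "set_integrable lborel (ball z r) v" "mean v0 (ball z r) = avg v z r"
proof -
  have Lp: "v0 \<in> Lp p (ball z r)" using v0 by (simp add: Wsp_def)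
  then have meas: "v0 \<in> borel_measurable (lebesgue_on (ball z r))" by (simp add: Lp_def)
  obtain v where v: "v \<in> borel_measurable borel" "AE x in lborel. x \<in> ball z r \<longrightarrow> v0 x = v x"
    by (rule borel_version_on_ball[OF meas])
  show ?thesis
  proof (rule that[OF v])
    show "set_integrable lborel (ball z r) v"
      using Lp_integrable[OF Lp p_gt_1] integral_lebesgue_on_ball(2)[OF meas v] by simp
    show "mean v0 (ball z r) = avg v z r"
      by (simp add: mean_def avg_def integral_lebesgue_on_ball(1)[OF meas v])
  qed
qed

lemma sobolev_mean:
  fixes s r :: real
  assumes n: "2 \<le> DIM('a)" and w0: "w0 \<in> borel_measurable lebesgue" and eq: "AE x in lborel. w0 x = w x"
    and v0: "v0 \<in> Wsp s p w0 (ball z r)" and r: "0 < r" and s: "0 < s" "s < 1"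
  shows "osc_lhs s p w0 (ball z r) v0 (mean v0 (ball z r)) \<le> ennreal (sobolev_const 0) * energy_rhs s p w0 (ball z r) r v0"
proof -
  obtain v where v: "v \<in> borel_measurable borel" "AE x in lborel. x \<in> ball z r \<longrightarrow> v0 x = v x"
    "mean v0 (ball z r) = avg v z r"
    by (rule Wsp_borel_version[OF v0])
  show ?thesis
    by (rule osc_lhs_le[OF n w0 eq v(1,2) v0 r s]) (simp_all add: v(3))
qed

text \<open>
  As \<psi> has integral 1, the difference of the two means is the integral of (v - avg v) \<psi>,
  which is at most c0 times the Lebesgue average of |v - avg v|; the Poincare inequality bounds
  the latter. The maximum with 1 makes c0 at least 1, so that a power of c0 with exponent q is
  bounded by the one with exponent 2p, which is independent of s.
\<close>

lemma sobolev_psi_mean: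
  fixes s r c0 :: real
  assumes n: "2 \<le> DIM('a)" and w0: "w0 \<in> borel_measurable lebesgue" and eq: "AE x in lborel. w0 x = w x"
    and v0: "v0 \<in> Wsp s p w0 (ball z r)" and r: "0 < r" and s: "0 < s" "s < 1"
    and \<psi>: "\<psi> \<in> Linf (ball z r)" "(LINT x|lebesgue_on (ball z r). \<psi> x) = 1"
      "Linf_norm (ball z r) \<psi> \<le> ennreal (c0 / measure lebesgue (ball z r))"
  shows "osc_lhs s p w0 (ball z r) v0 (psi_mean \<psi> (ball z r) v0)
    \<le> ennreal (sobolev_const (max 1 c0 powr (2 * p))) * energy_rhs s p w0 (ball z r) r v0"
proof -
  let ?B = "ball z r" and ?L = "lebesgue_on (ball z r)"
  obtain v where v: "v \<in> borel_measurable borel" "AE x in lborel. x \<in> ?B \<longrightarrow> v0 x = v x"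
    "set_integrable lborel ?B v"
    by (rule Wsp_borel_version[OF v0])
  define a where "a = avg v z r"
  define m where "m = measure lborel ?B"
  have m: "m > 0" using r by (simp add: m_def)
  define c where "c = max 1 c0"
  have c: "c \<ge> 1" "c0 \<le> c" by (auto simp: c_def)
  have Lp: "v0 \<in> Lp p ?B" using v0 by (simp add: Wsp_def)
  then have [measurable]: "v0 \<in> borel_measurable ?L" by (simp add: Lp_def)
  have v0_int: "integrable ?L v0" by (rule Lp_integrable[OF Lp p_gt_1])
  have [measurable]: "\<psi> \<in> borel_measurable ?L" using \<psi> by (simp add: Linf_def)
  have \<psi>_int: "integrable ?L \<psi>" using \<psi>(2) not_integrable_integral_eq by fastforce
  have bd: "AE x in ?L. \<bar>\<psi> x\<bar> \<le> c / m"
  proof -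
    have "AE x in ?L. ennreal \<bar>\<psi> x\<bar> \<le> Linf_norm ?B \<psi>"
      unfolding Linf_norm_def by (rule esssup_AE)
    then show ?thesis
    proof eventually_elim
      fix x assume "ennreal \<bar>\<psi> x\<bar> \<le> Linf_norm ?B \<psi>"
      also have "\<dots> \<le> ennreal (c0 / m)" using \<psi>(3) by (simp add: m_def)
      also have "\<dots> \<le> ennreal (c / m)" using c m by (intro ennreal_leI divide_right_mono) auto
      finally show "\<bar>\<psi> x\<bar> \<le> c / m" using c m by (subst (asm) ennreal_le_iff) auto
    qed
  qed
  have vpsi: "integrable ?L (\<lambda>x. v0 x * \<psi> x)"
  proof (rule Bochner_Integration.integrable_bound)
    show "integrable ?L (\<lambda>x. c / m * v0 x)" using v0_int by simp
    show "AE x in ?L. norm (v0 x * \<psi> x) \<le> norm (c / m * v0 x)"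
      using bd
    proof eventually_elim
      fix x assume "\<bar>\<psi> x\<bar> \<le> c / m"
      then have "\<bar>\<psi> x\<bar> * \<bar>v0 x\<bar> \<le> c / m * \<bar>v0 x\<bar>" by (rule mult_right_mono) simp
      then show "norm (v0 x * \<psi> x) \<le> norm (c / m * v0 x)"
        using c m by (simp add: abs_mult mult.commute)
    qed
  qed measurable
  have diff: "psi_mean \<psi> ?B v0 - a = (LINT x|?L. (v0 x - a) * \<psi> x)"
  proof -
    have "(LINT x|?L. (v0 x - a) * \<psi> x) = (LINT x|?L. v0 x * \<psi> x - a * \<psi> x)"
      by (simp add: left_diff_distrib)
    also have "\<dots> = (LINT x|?L. v0 x * \<psi> x) - (LINT x|?L. a * \<psi> x)"
      using vpsi \<psi>_int by (intro Bochner_Integration.integral_diff) auto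
    also have "\<dots> = psi_mean \<psi> ?B v0 - a" using \<psi>(2) by (simp add: psi_mean_def)
    finally show ?thesis ..
  qed
  have dist: "ennreal \<bar>a - psi_mean \<psi> ?B v0\<bar> \<le> ennreal (c / m) * (\<integral>\<^sup>+x\<in>?B. ennreal \<bar>v x - a\<bar> \<partial>lborel)"
  proof -
    have "ennreal \<bar>a - psi_mean \<psi> ?B v0\<bar> = ennreal (norm (LINT x|?L. (v0 x - a) * \<psi> x))"
      by (simp add: diff[symmetric] abs_minus_commute)
    also have "\<dots> \<le> (\<integral>\<^sup>+x. ennreal (norm ((v0 x - a) * \<psi> x)) \<partial>?L)"
      using vpsi \<psi>_int by (intro integral_norm_bound_ennreal) (simp add: left_diff_distrib)
    also have "\<dots> \<le> (\<integral>\<^sup>+x. ennreal (c / m) * ennreal \<bar>v0 x - a\<bar> \<partial>?L)"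
      using bd
    proof (intro nn_integral_mono_AE, elim eventually_mono)
      fix x assume "\<bar>\<psi> x\<bar> \<le> c / m"
      then have "\<bar>\<psi> x\<bar> * \<bar>v0 x - a\<bar> \<le> c / m * \<bar>v0 x - a\<bar>" by (rule mult_right_mono) simp
      then have "ennreal (norm ((v0 x - a) * \<psi> x)) \<le> ennreal (c / m * \<bar>v0 x - a\<bar>)"
        by (intro ennreal_leI) (simp add: abs_mult mult.commute)
      also have "\<dots> = ennreal (c / m) * ennreal \<bar>v0 x - a\<bar>" using c m by (intro ennreal_mult) auto
      finally show "ennreal (norm ((v0 x - a) * \<psi> x)) \<le> ennreal (c / m) * ennreal \<bar>v0 x - a\<bar>" .
    qed
    also have "\<dots> = ennreal (c / m) * (\<integral>\<^sup>+x. ennreal \<bar>v0 x - a\<bar> \<partial>?L)"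
      by (rule nn_integral_cmult) measurable
    also have "(\<integral>\<^sup>+x. ennreal \<bar>v0 x - a\<bar> \<partial>?L) = (\<integral>\<^sup>+x\<in>?B. ennreal \<bar>v x - a\<bar> \<partial>lborel)"
      unfolding nn_integral_lebesgue_on_ball using v(2) by (intro nn_integral_cong_AE, elim eventually_mono) (auto simp: indicator_def)
    finally show ?thesis .
  qed
  show ?thesis
  proof (rule osc_lhs_le[OF n w0 eq v(1,2) v0 r s])
    fix \<epsilon> :: real assume \<epsilon>: "0 < \<epsilon>" "mu_energy s ?B v \<le> ennreal (\<epsilon> * W z r)"
    define o1 where "o1 = (poincare_const * (1 - s) * r powr (s * p) * \<epsilon>) powr (1 / p)"
    define n where "n = real DIM('a)"
    define q where "q = n * p / (n - s)"
    have n2: "n \<ge> 2" using assms(1) by (simp add: n_def)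
    have ns: "n - s > 0" using n2 s by simp
    have q0: "q \<ge> 0" using ns n2 p_gt_1 by (simp add: q_def)
    have q2: "q \<le> 2 * p"
      using mult_left_mono[of "n / (n - s)" 2 p] n2 s ns p_gt_1 by (simp add: q_def field_simps)
    have "ennreal \<bar>a - psi_mean \<psi> ?B v0\<bar> \<le> ennreal (c / m) * ennreal (m * o1)"
      unfolding a_def o1_def m_def
      by (rule order.trans[OF dist[unfolded a_def m_def] mult_left_mono[OF mean_deviation_lborel[OF v(1,3) r s \<epsilon>]]]) simp
    also have "\<dots> = ennreal (c * o1)" using c m by (simp add: ennreal_mult[symmetric] o1_def)
    finally have le: "\<bar>a - psi_mean \<psi> ?B v0\<bar> \<le> c * o1"
      using c by (subst (asm) ennreal_le_iff) (auto simp: o1_def)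
    have "\<bar>a - psi_mean \<psi> ?B v0\<bar> powr q \<le> (c * o1) powr q"
      using le q0 by (intro powr_mono2) auto
    also have "\<dots> = c powr q * o1 powr q" using c by (simp add: powr_mult o1_def)
    also have "\<dots> \<le> c powr (2 * p) * scaled_energy s r \<epsilon> powr (n / (n - s))"
    proof (intro mult_mono powr_mono q2 c(1))
      show "o1 powr q \<le> scaled_energy s r \<epsilon> powr (n / (n - s))"
        unfolding o1_def q_def n_def by (rule poincare_le_scaled_energy[OF assms(1) r s \<epsilon>(1)])
    qed auto
    finally show "\<bar>avg v z r - psi_mean \<psi> ?B v0\<bar> powr (DIM('a) * p / (DIM('a) - s))
      \<le> max 1 c0 powr (2 * p) * scaled_energy s r \<epsilon> powr (DIM('a) / (DIM('a) - s))"
      by (simp add: a_def c_def q_def n_def)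
  qed simp
qed

text \<open>
  The difference of the two means is at most the \<mu>-average of |v - avg v|, which the strong
  inequality bounds. It also shows that v is integrable with respect to \<mu>, so that the
  weighted mean is meaningful.
\<close>

lemma sobolev_weighted_mean:
  fixes s r :: real
  assumes n: "2 \<le> DIM('a)" and w0: "w0 \<in> borel_measurable lebesgue" and eq: "AE x in lborel. w0 x = w x"
    and v0: "v0 \<in> Wsp s p w0 (ball z r)" and r: "0 < r" and s: "0 < s" "s < 1"
  defines "\<psi> \<equiv> \<lambda>x. w0 x / wmeas w0 (ball z r)"
  shows "integrable (lebesgue_on (ball z r)) (\<lambda>x. v0 x * \<psi> x)"
    and "osc_lhs s p w0 (ball z r) v0 (psi_mean \<psi> (ball z r) v0)
    \<le> ennreal (sobolev_const strong_const) * energy_rhs s p w0 (ball z r) r v0"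
proof -
  let ?B = "ball z r" and ?L = "lebesgue_on (ball z r)"
  obtain v where v [measurable]: "v \<in> borel_measurable borel" and eqv: "AE x in lborel. x \<in> ?B \<longrightarrow> v0 x = v x"
    and v_int: "set_integrable lborel ?B v"
    by (rule Wsp_borel_version[OF v0])
  define a where "a = avg v z r"
  have Wz: "W z r > 0" using r by (rule W_pos)
  have [measurable]: "v0 \<in> borel_measurable ?L" using v0 by (simp add: Wsp_def Lp_def)
  have [measurable]: "w0 \<in> borel_measurable ?L" using w0 by (rule measurable_restrict_space1)
  have weighted: "(\<integral>\<^sup>+x. ennreal (\<bar>f0 x\<bar> * w0 x) \<partial>?L) = (\<integral>\<^sup>+x. ennreal (norm (f0 x * w0 x)) \<partial>?L)" for f0
    unfolding nn_integral_lebesgue_on_ball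
    using eq by (intro nn_integral_cong_AE, elim eventually_mono) (use w_pos in \<open>auto simp: abs_mult less_imp_le\<close>)
  have w0_int: "integrable ?L w0"
  proof (rule integrableI_bounded)
    have "(\<integral>\<^sup>+x. ennreal (1 * w0 x) \<partial>?L) = (\<integral>\<^sup>+x\<in>?B. ennreal 1 \<partial>\<mu>)"
      by (rule nn_integral_weighted_ball[OF eq]) auto
    then have "(\<integral>\<^sup>+x. ennreal (norm (w0 x)) \<partial>?L) = ennreal (W z r)"
      using weighted[of "\<lambda>_. 1"] by (simp add: emeasure_mu_ball)
    then show "(\<integral>\<^sup>+x. ennreal (norm (w0 x)) \<partial>?L) < \<infinity>" by (simp only:) simp
  qed measurable
  have w0_total: "(LINT x|?L. w0 x) = W z r"
    using wmeas_ball[OF w0 eq, of z r] by (simp add: wmeas_def)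
  have dev: "(\<integral>\<^sup>+x. ennreal (norm ((v0 x - a) * w0 x)) \<partial>?L) = (\<integral>\<^sup>+x\<in>?B. ennreal \<bar>v x - a\<bar> \<partial>\<mu>)"
    unfolding weighted[symmetric]
    by (rule nn_integral_weighted_ball[OF eq]) (use eqv in \<open>auto elim!: eventually_mono\<close>)
  have E: "energy s p w0 ?B v0 < \<infinity>" using v0 by (simp add: Wsp_def)
  have fin: "mu_energy s ?B v < \<infinity>" using E by (simp add: energy_eq_mu_energy[OF w0 eq v eqv])
  have dev_fin: "(\<integral>\<^sup>+x\<in>?B. ennreal \<bar>v x - a\<bar> \<partial>\<mu>) < \<infinity>"
  proof -
    \<comment> \<open>Any admissible positive value serves here, since only finiteness is at stake.\<close>
    define \<epsilon> where "\<epsilon> = enn2real (mu_energy s ?B v) / W z r + 1"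
    have pos: "\<epsilon> > 0" using Wz by (simp add: \<epsilon>_def add_nonneg_pos)
    have "mu_energy s ?B v = ennreal (enn2real (mu_energy s ?B v))" using fin by simp
    also have "\<dots> \<le> ennreal (\<epsilon> * W z r)"
      using Wz by (intro ennreal_leI) (simp add: \<epsilon>_def distrib_right)
    finally have le: "mu_energy s ?B v \<le> ennreal (\<epsilon> * W z r)" .
    from mean_deviation_mu[OF n v v_int r s pos le] show ?thesis
      unfolding a_def by (rule le_less_trans) simp
  qed
  have int: "integrable ?L (\<lambda>x. (v0 x - a) * w0 x)"
    by (rule integrableI_bounded) (use dev dev_fin in simp_all)
  have vw: "integrable ?L (\<lambda>x. v0 x * w0 x)"
    using Bochner_Integration.integrable_add[OF int integrable_mult_right[OF w0_int, of a]]
    by (simp add: left_diff_distrib)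
  then show "integrable ?L (\<lambda>x. v0 x * \<psi> x)" by (simp add: \<psi>_def)
  have diff: "(psi_mean \<psi> ?B v0 - a) * W z r = (LINT x|?L. (v0 x - a) * w0 x)"
  proof -
    have "(LINT x|?L. (v0 x - a) * w0 x) = (LINT x|?L. v0 x * w0 x) - (LINT x|?L. a * w0 x)"
      using vw w0_int by (subst Bochner_Integration.integral_diff[symmetric]) (auto simp: left_diff_distrib)
    also have "(LINT x|?L. v0 x * w0 x) = psi_mean \<psi> ?B v0 * W z r"
      using Wz by (simp add: psi_mean_def \<psi>_def wmeas_ball[OF w0 eq])
    finally show ?thesis by (simp add: w0_total left_diff_distrib)
  qed
  have dist: "ennreal (\<bar>a - psi_mean \<psi> ?B v0\<bar> * W z r) \<le> (\<integral>\<^sup>+x\<in>?B. ennreal \<bar>v x - a\<bar> \<partial>\<mu>)"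
  proof -
    have "\<bar>a - psi_mean \<psi> ?B v0\<bar> * W z r = norm (LINT x|?L. (v0 x - a) * w0 x)"
      using Wz by (simp add: diff[symmetric] abs_mult abs_minus_commute)
    also have "ennreal \<dots> \<le> (\<integral>\<^sup>+x. ennreal (norm ((v0 x - a) * w0 x)) \<partial>?L)"
      by (rule integral_norm_bound_ennreal[OF int])
    finally show ?thesis by (simp only: dev)
  qed
  show "osc_lhs s p w0 ?B v0 (psi_mean \<psi> ?B v0) \<le> ennreal (sobolev_const strong_const) * energy_rhs s p w0 ?B r v0"
  proof (rule osc_lhs_le[OF n w0 eq v eqv v0 r s])
    fix \<epsilon> :: real assume \<epsilon>: "0 < \<epsilon>" "mu_energy s ?B v \<le> ennreal (\<epsilon> * W z r)"
    define n where "n = real DIM('a)"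
    define q where "q = n * p / (n - s)"
    have n2: "n \<ge> 2" using assms(1) by (simp add: n_def)
    have ns: "n - s > 0" using n2 s by simp
    have q0: "q > 0" using ns n2 p_gt_1 by (simp add: q_def)
    define Y where "Y = strong_const * scaled_energy s r \<epsilon> powr (n / (n - s))"
    have Y: "Y \<ge> 0" using strong_const_ge_1 by (simp add: Y_def)
    have "ennreal (\<bar>a - psi_mean \<psi> ?B v0\<bar> * W z r) \<le> ennreal (W z r * Y powr (1 / q))"
      using order.trans[OF dist[unfolded a_def] mean_deviation_mu[OF assms(1) v v_int r s \<epsilon>]]
      by (simp add: a_def Y_def q_def n_def)
    then have "\<bar>a - psi_mean \<psi> ?B v0\<bar> * W z r \<le> W z r * Y powr (1 / q)"
      by (subst (asm) ennreal_le_iff) auto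
    then have "\<bar>a - psi_mean \<psi> ?B v0\<bar> \<le> Y powr (1 / q)" using Wz by (simp add: mult.commute)
    then have "\<bar>a - psi_mean \<psi> ?B v0\<bar> powr q \<le> (Y powr (1 / q)) powr q"
      using q0 by (intro powr_mono2) auto
    also have "\<dots> = Y" using q0 Y by (simp add: powr_powr)
    finally show "\<bar>avg v z r - psi_mean \<psi> ?B v0\<bar> powr (DIM('a) * p / (DIM('a) - s))
      \<le> strong_const * scaled_energy s r \<epsilon> powr (DIM('a) / (DIM('a) - s))"
      by (simp add: a_def Y_def q_def n_def)
  qed (use strong_const_ge_1 in simp)
qed

end

theorem theorem2p19:
  assumes "CARD('n::finite) \<ge> 2"
  shows
    "(\<exists>C :: real \<Rightarrow> ennreal \<Rightarrow> real.
       \<forall>p > 1. \<forall>s \<in> {0<..<1}. \<forall>w :: real ^ 'n \<Rightarrow> real. w \<in> Ap_class p \<longrightarrow>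
       (\<forall>z. \<forall>r > 0. \<forall>v \<in> Wsp s p w (ball z r).
          osc_lhs s p w (ball z r) v (mean v (ball z r))
            \<le> ennreal (C p (Ap_const p w)) * energy_rhs s p w (ball z r) r v)) \<and>
     (\<exists>C :: real \<Rightarrow> ennreal \<Rightarrow> real.
       \<forall>p > 1. \<forall>s \<in> {0<..<1}. \<forall>w :: real ^ 'n \<Rightarrow> real. w \<in> Ap_class p \<longrightarrow>
       (\<forall>z. \<forall>r > 0. \<forall>v \<in> Wsp s p w (ball z r).
          let \<psi> = (\<lambda>x. w x / wmeas w (ball z r)) in
          integrable (lebesgue_on (ball z r)) (\<lambda>x. v x * \<psi> x) \<and>
          osc_lhs s p w (ball z r) v (psi_mean \<psi> (ball z r) v)
            \<le> ennreal (C p (Ap_const p w)) * energy_rhs s p w (ball z r) r v)) \<and>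
     (\<exists>C :: real \<Rightarrow> ennreal \<Rightarrow> real \<Rightarrow> real.
       \<forall>p > 1. \<forall>s \<in> {0<..<1}. \<forall>w :: real ^ 'n \<Rightarrow> real. w \<in> Ap_class p \<longrightarrow>
       (\<forall>z. \<forall>r > 0. \<forall>v \<in> Wsp s p w (ball z r). \<forall>c0. \<forall>\<psi> \<in> Linf (ball z r).
          (LINT x|lebesgue_on (ball z r). \<psi> x) = 1 \<longrightarrow>
          Linf_norm (ball z r) \<psi> \<le> ennreal (c0 / measure lebesgue (ball z r)) \<longrightarrow>
          osc_lhs s p w (ball z r) v (psi_mean \<psi> (ball z r) v)
            \<le> ennreal (C p (Ap_const p w) c0) * energy_rhs s p w (ball z r) r v))"
proof -
  have dim: "2 \<le> DIM(real ^ 'n)" using assms by simp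
  let ?C = "\<lambda>p a K. muckenhoupt_weight.sobolev_const TYPE(real ^ 'n) p (enn2real a) K"
  let ?S = "\<lambda>p a. muckenhoupt_weight.strong_const TYPE(real ^ 'n) p (enn2real a)"
  have weight: "w \<in> borel_measurable lebesgue \<and>
      (\<exists>w'. muckenhoupt_weight w' p (enn2real (Ap_const p w)) \<and> (AE x in lborel. w x = w' x))"
    if p: "1 < p" and w: "w \<in> Ap_class p" for p and w :: "real ^ 'n \<Rightarrow> real"
  proof
    have wt: "is_weight w" using w by (simp add: Ap_class_def)
    then show "w \<in> borel_measurable lebesgue" by (rule weight_lebesgue_measurable)
    obtain w' where "w' \<in> borel_measurable borel" "\<And>x. 0 < w' x" "AE x in lborel. w x = w' x"
      by (rule borel_version_of_weight[OF wt]) blast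
    then show "\<exists>w'. muckenhoupt_weight w' p (enn2real (Ap_const p w)) \<and> (AE x in lborel. w x = w' x)"
      using Ap_class_muckenhoupt_weight[OF w p] by blast
  qed
  show ?thesis
  proof (intro conjI)
    show "\<exists>C :: real \<Rightarrow> ennreal \<Rightarrow> real.
       \<forall>p > 1. \<forall>s \<in> {0<..<1}. \<forall>w :: real ^ 'n \<Rightarrow> real. w \<in> Ap_class p \<longrightarrow>
       (\<forall>z. \<forall>r > 0. \<forall>v \<in> Wsp s p w (ball z r).
          osc_lhs s p w (ball z r) v (mean v (ball z r))
            \<le> ennreal (C p (Ap_const p w)) * energy_rhs s p w (ball z r) r v)"
      by (rule exI[of _ "\<lambda>p a. ?C p a 0"])
         (use weight dim in \<open>fastforce intro: muckenhoupt_weight.sobolev_mean\<close>)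
  next
    show "\<exists>C :: real \<Rightarrow> ennreal \<Rightarrow> real.
       \<forall>p > 1. \<forall>s \<in> {0<..<1}. \<forall>w :: real ^ 'n \<Rightarrow> real. w \<in> Ap_class p \<longrightarrow>
       (\<forall>z. \<forall>r > 0. \<forall>v \<in> Wsp s p w (ball z r).
          let \<psi> = (\<lambda>x. w x / wmeas w (ball z r)) in
          integrable (lebesgue_on (ball z r)) (\<lambda>x. v x * \<psi> x) \<and>
          osc_lhs s p w (ball z r) v (psi_mean \<psi> (ball z r) v)
            \<le> ennreal (C p (Ap_const p w)) * energy_rhs s p w (ball z r) r v)"
      unfolding Let_def
      by (rule exI[of _ "\<lambda>p a. ?C p a (?S p a)"])
         (use weight dim in \<open>fastforce intro: muckenhoupt_weight.sobolev_weighted_mean\<close>)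
  next
    show "\<exists>C :: real \<Rightarrow> ennreal \<Rightarrow> real \<Rightarrow> real.
       \<forall>p > 1. \<forall>s \<in> {0<..<1}. \<forall>w :: real ^ 'n \<Rightarrow> real. w \<in> Ap_class p \<longrightarrow>
       (\<forall>z. \<forall>r > 0. \<forall>v \<in> Wsp s p w (ball z r). \<forall>c0. \<forall>\<psi> \<in> Linf (ball z r).
          (LINT x|lebesgue_on (ball z r). \<psi> x) = 1 \<longrightarrow>
          Linf_norm (ball z r) \<psi> \<le> ennreal (c0 / measure lebesgue (ball z r)) \<longrightarrow>
          osc_lhs s p w (ball z r) v (psi_mean \<psi> (ball z r) v)
            \<le> ennreal (C p (Ap_const p w) c0) * energy_rhs s p w (ball z r) r v)"
      by (rule exI[of _ "\<lambda>p a c0. ?C p a (max 1 c0 powr (2 * p))"])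
         (use weight dim in \<open>fastforce intro: muckenhoupt_weight.sobolev_psi_mean\<close>)
  qed
qed

end
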